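(* Let $m\ge1$, let $a,c\in\mathbb{C}$, $b\in\mathbb{C}^m$ be such that all the exponents $\alpha_0,\dots,\alpha_{m+2}$ defined in the context are non-integers, and let $x_1,\dots,x_m\in\mathbb{C}$ be such that $x_0=0,x_1,\dots,x_m,x_{m+1}=1$ are pairwise distinct. For $0\le k\le m+1$ the matrix $Q_k(a,b,c;x)=\big(I_c((t-x_k)\varphi_i,\varphi_j)\big)_{i,j=0,\dots,m}$ of intersection numbers is given by \begin{align*} Q_k(a,b,c;x)=2\pi\sqrt{-1}\Big\{&\frac{1-x_k}{\alpha_{m+1}}N+\frac{1}{\alpha_{m+2}}\,\mathrm{diag}(0,1-x_1,\dots,1-x_m)\cdot N\cdot\mathrm{diag}(1,0,\dots,0)\\ &-\frac{1}{1-\alpha_{m+2}}\,\mathrm{diag}(1,0,\dots,0)\cdot N\cdot\mathrm{diag}(0,1-x_1,\dots,1-x_m)\\ &+\mathrm{diag}\Big(\frac{1-x_k}{\alpha_{m+2}}-\frac{1}{1-\alpha_{m+2}}\Big(\frac{\sum_{p=1}^{m+1}\alpha_p x_p}{\alpha_{m+2}}+1\Big),\frac{x_1-x_k}{\alpha_1},\dots,\frac{x_m-x_k}{\alpha_m}\Big)\Big\}, \end{align*} where $N$ is the $(m+1)\times(m+1)$ matrix all of whose entries are $1$.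
   Context: Put $x_0=0$, $x_{m+1}=1$, $\alpha_0=-c+\sum_{j=1}^m b_j$, $\alpha_k=-b_k$ $(1\le k\le m)$, $\alpha_{m+1}=c-a$, $\alpha_{m+2}=a$. Let $T_x=\mathbb{C}\setminus\{x_0,\dots,x_{m+1}\}$, $u_x(t)=\prod_{i=0}^{m+1}(t-x_i)^{\alpha_i}$, $\omega=d\log u_x$, $\nabla_{\pm\omega}=d\pm\omega\wedge$ ($d$ with respect to $t$). $H^1(T_x,\nabla_{\pm\omega})=\ker(\nabla_{\pm\omega}:\mathcal{E}^1\to\mathcal{E}^2)/\nabla_{\pm\omega}(\mathcal{E}^0)$ for smooth forms on $T_x$; $H^1_c(T_x,\nabla_\omega)$ is the analogous group for compactly supported smooth forms. There is a canonical isomorphism $\jmath:H^1(T_x,\nabla_\omega)\to H^1_c(T_x,\nabla_\omega)$ (inverse of the natural map), and the intersection form is $I_c(\psi,\psi')=\int_{T_x}\jmath(\psi)\wedge\psi'$ for $\psi\in H^1(T_x,\nabla_\omega)$, $\psi'\in H^1(T_x,\nabla_{-\omega})$. The 1-forms are $\varphi_0=\frac{dt}{t-1}$ and $\varphi_k=\frac{dt}{t-1}-\frac{dt}{t-x_k}=\frac{(1-x_k)dt}{(t-x_k)(t-1)}$ for $1\le k\le m$; in $I_c((t-x_k)\varphi_i,\varphi_j)$ the form $(t-x_k)\varphi_i$ is regarded as a class in $H^1(T_x,\nabla_\omega)$ and $\varphi_j$ as a class in $H^1(T_x,\nabla_{-\omega})$. Known fact: writing $\varphi_{i,m+2}=\frac{dt}{t-x_i}$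 and $\varphi_{i,j}=\varphi_{i,m+2}-\varphi_{j,m+2}$, one has $I_c(\varphi_{i,j},\varphi_{p,q})=2\pi\sqrt{-1}\big(\frac{\delta_{i,p}-\delta_{i,q}}{\alpha_i}-\frac{\delta_{j,p}-\delta_{j,q}}{\alpha_j}\big)$. *)

theory Defs
  imports "HOL-Analysis.Analysis" "Jordan_Normal_Form.Matrix"
begin

section \<open>Complex-valued smooth forms on an open subset of the plane\<close>

text \<open>
  The complex plane is regarded as the real plane with coordinates \<open>t = x + \<i> y\<close>, oriented by
  \<open>dx \<and> dy\<close>.  A 0-form is a function \<open>f\<close>, the 1-form \<open>P dx + Q dy\<close> is the function
  \<open>t \<mapsto> (P t, Q t)\<close>, and the 2-form \<open>h dx \<and> dy\<close> is the function \<open>h\<close>.  Forms on \<open>T\<close> are total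
  functions whose values outside \<open>T\<close> carry no information: every condition and every equation
  below is imposed on \<open>T\<close> only.
\<close>

type_synonym form1 = "complex \<Rightarrow> complex \<times> complex"

primrec Ck_on :: "nat \<Rightarrow> complex set \<Rightarrow> (complex \<Rightarrow> complex) \<Rightarrow> bool" where
  "Ck_on 0 T f \<longleftrightarrow> continuous_on T f"
| "Ck_on (Suc k) T f \<longleftrightarrow>
     (\<forall>z\<in>T. f differentiable (at z)) \<and> (\<forall>v. Ck_on k T (\<lambda>z. frechet_derivative f (at z) v))"

text \<open>Only used for open \<open>T\<close>; differentiability is over the reals.\<close>

definition smooth_on :: "complex set \<Rightarrow> (complex \<Rightarrow> complex) \<Rightarrow> bool" where
  "smooth_on T f \<longleftrightarrow> (\<forall>k. Ck_on k T f)"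

definition dx :: "(complex \<Rightarrow> complex) \<Rightarrow> complex \<Rightarrow> complex" where
  "dx f z = frechet_derivative f (at z) 1"

definition dy :: "(complex \<Rightarrow> complex) \<Rightarrow> complex \<Rightarrow> complex" where
  "dy f z = frechet_derivative f (at z) \<i>"

definition E0 :: "complex set \<Rightarrow> (complex \<Rightarrow> complex) set" where
  "E0 T = {f. smooth_on T f}"

definition E1 :: "complex set \<Rightarrow> form1 set" where
  "E1 T = {\<eta>. smooth_on T (\<lambda>z. fst (\<eta> z)) \<and> smooth_on T (\<lambda>z. snd (\<eta> z))}"

definition compactly_supported :: "complex set \<Rightarrow> (complex \<Rightarrow> 'b::zero) \<Rightarrow> bool" where
  "compactly_supported T \<eta> \<longleftrightarrow> (\<exists>K. compact K \<and> K \<subseteq> T \<and> (\<forall>z\<in>T - K. \<eta> z = 0))"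

definition E0c :: "complex set \<Rightarrow> (complex \<Rightarrow> complex) set" where
  "E0c T = {f \<in> E0 T. compactly_supported T f}"

definition E1c :: "complex set \<Rightarrow> form1 set" where
  "E1c T = {\<eta> \<in> E1 T. compactly_supported T \<eta>}"

definition wedge :: "form1 \<Rightarrow> form1 \<Rightarrow> complex \<Rightarrow> complex" where
  "wedge \<eta> \<xi> z = fst (\<eta> z) * snd (\<xi> z) - snd (\<eta> z) * fst (\<xi> z)"

definition fmul :: "(complex \<Rightarrow> complex) \<Rightarrow> form1 \<Rightarrow> form1" where
  "fmul f \<eta> = (\<lambda>z. (f z * fst (\<eta> z), f z * snd (\<eta> z)))"

definition d0 :: "(complex \<Rightarrow> complex) \<Rightarrow> form1" where
  "d0 f = (\<lambda>z. (dx f z, dy f z))"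

definition d1 :: "form1 \<Rightarrow> complex \<Rightarrow> complex" where
  "d1 \<eta> z = dx (\<lambda>w. snd (\<eta> w)) z - dy (\<lambda>w. fst (\<eta> w)) z"

text \<open>The form \<open>f dt\<close>, where \<open>dt = dx + \<i> dy\<close>.\<close>

definition fdt :: "(complex \<Rightarrow> complex) \<Rightarrow> form1" where
  "fdt f = (\<lambda>z. (f z, \<i> * f z))"

section \<open>Twisted cohomology and the intersection form\<close>

text \<open>\<open>\<nabla>\<^sub>\<omega> = d + \<omega>\<and>\<close> on 0-forms and on 1-forms.\<close>

definition nabla0 :: "form1 \<Rightarrow> (complex \<Rightarrow> complex) \<Rightarrow> form1" where
  "nabla0 \<omega> f = (\<lambda>z. d0 f z + fmul f \<omega> z)"

definition nabla1 :: "form1 \<Rightarrow> form1 \<Rightarrow> complex \<Rightarrow> complex" where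
  "nabla1 \<omega> \<eta> = (\<lambda>z. d1 \<eta> z + wedge \<omega> \<eta> z)"

definition Z1 :: "complex set \<Rightarrow> form1 \<Rightarrow> form1 set" where
  "Z1 T \<omega> = {\<eta> \<in> E1 T. \<forall>z\<in>T. nabla1 \<omega> \<eta> z = 0}"

definition Z1c :: "complex set \<Rightarrow> form1 \<Rightarrow> form1 set" where
  "Z1c T \<omega> = {\<eta> \<in> E1c T. \<forall>z\<in>T. nabla1 \<omega> \<eta> z = 0}"

definition cohom :: "complex set \<Rightarrow> form1 \<Rightarrow> (form1 \<times> form1) set" where
  "cohom T \<omega> = {(\<eta>, \<xi>). \<eta> \<in> Z1 T \<omega> \<and> \<xi> \<in> Z1 T \<omega> \<and>
     (\<exists>f\<in>E0 T. \<forall>z\<in>T. \<eta> z - \<xi> z = nabla0 \<omega> f z)}"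

definition cohomc :: "complex set \<Rightarrow> form1 \<Rightarrow> (form1 \<times> form1) set" where
  "cohomc T \<omega> = {(\<eta>, \<xi>). \<eta> \<in> Z1c T \<omega> \<and> \<xi> \<in> Z1c T \<omega> \<and>
     (\<exists>f\<in>E0c T. \<forall>z\<in>T. \<eta> z - \<xi> z = nabla0 \<omega> f z)}"

text \<open>
  Cohomology classes are equivalence classes.  Since the relations only look at values on \<open>T\<close>,
  forms that agree on \<open>T\<close> are identified in the quotients.
\<close>

definition H1 :: "complex set \<Rightarrow> form1 \<Rightarrow> form1 set set" where
  "H1 T \<omega> = Z1 T \<omega> // cohom T \<omega>"

definition H1c :: "complex set \<Rightarrow> form1 \<Rightarrow> form1 set set" where
  "H1c T \<omega> = Z1c T \<omega> // cohomc T \<omega>"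

definition coclass :: "complex set \<Rightarrow> form1 \<Rightarrow> form1 \<Rightarrow> form1 set" where
  "coclass T \<omega> \<eta> = cohom T \<omega> `` {\<eta>}"

text \<open>The map from \<open>H1c T \<omega>\<close> to \<open>H1 T \<omega>\<close> induced by the inclusion of \<open>Z1c T \<omega>\<close> in \<open>Z1 T \<omega>\<close>.\<close>

definition natmap :: "complex set \<Rightarrow> form1 \<Rightarrow> form1 set \<Rightarrow> form1 set" where
  "natmap T \<omega> C = cohom T \<omega> `` C"

definition jmath :: "complex set \<Rightarrow> form1 \<Rightarrow> form1 set \<Rightarrow> form1 set" where
  "jmath T \<omega> = inv_into (H1c T \<omega>) (natmap T \<omega>)"

text \<open>
  The intersection pairing of a class for \<open>\<omega>\<close> with a class for \<open>-\<omega>\<close>.  The integral does not depend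
  on the chosen representatives, i.e. the set of values below is a singleton.
\<close>

definition Ic :: "complex set \<Rightarrow> form1 \<Rightarrow> form1 set \<Rightarrow> form1 set \<Rightarrow> complex" where
  "Ic T \<omega> \<Psi> \<Psi>' =
     the_elem {(LINT z:T|lborel. wedge \<eta> \<xi> z) | \<eta> \<xi>. \<eta> \<in> jmath T \<omega> \<Psi> \<and> \<xi> \<in> \<Psi>'}"

section \<open>The data attached to the parameters\<close>

text \<open>
  The vectors \<open>b\<close> and \<open>x\<close> are indexed from 1 to \<open>m\<close>; other values of these functions are not used.
\<close>

definition alpha :: "nat \<Rightarrow> complex \<Rightarrow> (nat \<Rightarrow> complex) \<Rightarrow> complex \<Rightarrow> nat \<Rightarrow> complex" where
  "alpha m a b c k =
     (if k = 0 then - c + (\<Sum>j=1..m. b j)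
      else if k \<le> m then - b k
      else if k = m + 1 then c - a
      else a)"

definition pt :: "nat \<Rightarrow> (nat \<Rightarrow> complex) \<Rightarrow> nat \<Rightarrow> complex" where
  "pt m x k = (if k = 0 then 0 else if k = m + 1 then 1 else x k)"

definition Tx :: "nat \<Rightarrow> (nat \<Rightarrow> complex) \<Rightarrow> complex set" where
  "Tx m x = UNIV - pt m x ` {0..m+1}"

text \<open>\<open>\<omega> = d log u\<^sub>x\<close> for the multivalued function \<open>u\<^sub>x(t) = \<Prod>\<^sub>i (t - x\<^sub>i)\<^bsup>\<alpha>\<^sub>i\<^esup>\<close>, that is
  \<open>\<Sum>\<^sub>i \<alpha>\<^sub>i dt / (t - x\<^sub>i)\<close>.\<close>

definition omega :: "nat \<Rightarrow> complex \<Rightarrow> (nat \<Rightarrow> complex) \<Rightarrow> complex \<Rightarrow> (nat \<Rightarrow> complex) \<Rightarrow> form1" where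
  "omega m a b c x = fdt (\<lambda>t. \<Sum>i=0..m+1. alpha m a b c i / (t - pt m x i))"

definition phi :: "nat \<Rightarrow> (nat \<Rightarrow> complex) \<Rightarrow> nat \<Rightarrow> form1" where
  "phi m x k =
     (if k = 0 then fdt (\<lambda>t. 1 / (t - 1))
      else fdt (\<lambda>t. 1 / (t - 1) - 1 / (t - pt m x k)))"

definition Qmat ::
  "nat \<Rightarrow> complex \<Rightarrow> (nat \<Rightarrow> complex) \<Rightarrow> complex \<Rightarrow> (nat \<Rightarrow> complex) \<Rightarrow> nat \<Rightarrow> complex mat" where
  "Qmat m a b c x k =
     (let T = Tx m x; \<omega> = omega m a b c x; \<omega>' = (\<lambda>z. - \<omega> z)
      in Matrix.mat (m+1) (m+1) (\<lambda>(i, j).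
           Ic T \<omega> (coclass T \<omega> (fmul (\<lambda>t. t - pt m x k) (phi m x i)))
                   (coclass T \<omega>' (phi m x j))))"

definition Nmat :: "nat \<Rightarrow> complex mat" where
  "Nmat m = Matrix.mat (m+1) (m+1) (\<lambda>_. 1)"

end

(*
  Intersection numbers are computed by localization. Near each puncture, and near infinity, the
  equation dF + F omega = psi has a meromorphic solution F (a power series argument; this is where the
  exponents must not be integers). Gluing the local solutions by cutoff functions to a smooth
  function G, the form psi - (dG + G omega) has compact support and represents the class of psi.
  Its pairing with a holomorphic form q dt is the integral of -dG /\ q dt, which localizes in the
  annuli where the cutoff functions vary and gives 2 pi i times the sum of the residues of F q dt
  at all the points, infinity included. The natural map from compactly supported cohomology is
  injective because a flat section is killed by its nontrivial monodromy around every puncture.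
*)
theory Submission
  imports Defs "HOL-Complex_Analysis.Complex_Analysis"
begin

section \<open>Smooth functions\<close>

text \<open>Each local solution is holomorphic across its puncture, because the simple pole of psi
  is matched by the simple pole of omega; hence the glued function is smooth on the whole plane and
  the integrals can be taken there. Infinity is what shapes the formula. The rational function of (t
  - x_k) phi_i has as constant term the sum of the residues of phi_i, which is 1 for i = 0 and 0
  otherwise. A nonzero constant is a double pole at infinity, so the solution there has the form t
  H(1/t), and two Taylor coefficients of H enter the residue. Solving for them divides by 1 + sum
  \<alpha> and by sum \<alpha>, that is by 1 - \<alpha>_{m+2} and by -\<alpha>_{m+2}; the sum of the
  \<alpha>_p x_p is the next coefficient of omega at infinity. Since \<open>Ic\<close> is defined
  through \<open>inv_into\<close> and \<open>the_elem\<close>, injectivity and independence of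
  representatives must be settled before any integral can be read as its value.\<close>

lemma has_derivative_cong_open:
  assumes "open T" "\<And>z. z \<in> T \<Longrightarrow> f z = g z" "z \<in> T"
  shows "(f has_derivative D) (at z) \<longleftrightarrow> (g has_derivative D) (at z)"
proof
  show "(g has_derivative D) (at z)" if "(f has_derivative D) (at z)"
    by (rule has_derivative_transform_within_open[OF that assms(1,3)]) (rule assms(2))
  show "(f has_derivative D) (at z)" if "(g has_derivative D) (at z)"
    by (rule has_derivative_transform_within_open[OF that assms(1,3)]) (simp add: assms(2))
qed

lemma frechet_derivative_cong_open:
  assumes "open T" "\<And>z. z \<in> T \<Longrightarrow> f z = g z" "z \<in> T"
  shows "frechet_derivative f (at z) = frechet_derivative g (at z)"
  unfolding frechet_derivative_def
  by (rule arg_cong[where f = Eps], rule ext, rule has_derivative_cong_open[OF assms])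

lemma differentiable_cong_open:
  assumes "open T" "\<And>z. z \<in> T \<Longrightarrow> f z = g z" "z \<in> T"
  shows "f differentiable (at z) \<longleftrightarrow> g differentiable (at z)"
  unfolding differentiable_def
  by (rule arg_cong[where f = Ex], rule ext, rule has_derivative_cong_open[OF assms])

lemma frechet_derivative_eqI: "(f has_derivative D) (at z) \<Longrightarrow> frechet_derivative f (at z) = D"
  using frechet_derivative_at by metis

lemma Ck_on_cong:
  assumes "open T" "\<And>z. z \<in> T \<Longrightarrow> f z = g z"
  shows "Ck_on k T f \<longleftrightarrow> Ck_on k T g"
  using assms(2)
proof (induction k arbitrary: f g)
  case 0
  thus ?case by (auto intro: continuous_on_cong)
next
  case (Suc k)
  have "\<And>v. Ck_on k T (\<lambda>z. frechet_derivative f (at z) v) \<longleftrightarrow> Ck_on k T (\<lambda>z. frechet_derivative g (at z) v)"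
    using frechet_derivative_cong_open[OF assms(1) Suc.prems] by (intro Suc.IH) auto
  thus ?case using differentiable_cong_open[OF assms(1) Suc.prems] by auto
qed

text \<open>An explicit family \<open>D\<close> may stand in for \<open>frechet_derivative\<close>,
  which is a choice operator; this makes the closure properties below accessible to induction on
  k.\<close>

lemma Ck_on_SucI:
  assumes "open T" "\<And>z. z \<in> T \<Longrightarrow> (f has_derivative D z) (at z)"
    and "\<And>v. Ck_on k T (\<lambda>z. D z v)"
  shows "Ck_on (Suc k) T f"
proof -
  have "Ck_on k T (\<lambda>z. frechet_derivative f (at z) v)" for v
    using Ck_on_cong[OF assms(1), of "\<lambda>z. frechet_derivative f (at z) v" "\<lambda>z. D z v"]
      frechet_derivative_eqI[OF assms(2)] assms(3) by simp
  thus ?thesis using assms(2) by (auto simp: differentiable_def)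
qed

lemma Ck_on_SucD: "Ck_on (Suc k) T f \<Longrightarrow> Ck_on k T f"
proof (induction k arbitrary: f)
  case 0
  thus ?case
    by (auto intro!: continuous_at_imp_continuous_on differentiable_imp_continuous_within)
next
  case (Suc k)
  thus ?case by auto
qed

lemma Ck_on_has_derivative:
  "Ck_on (Suc k) T f \<Longrightarrow> z \<in> T \<Longrightarrow> (f has_derivative frechet_derivative f (at z)) (at z)"
  by (simp add: frechet_derivative_works)

lemma Ck_on_subset: "Ck_on k T f \<Longrightarrow> S \<subseteq> T \<Longrightarrow> Ck_on k S f"
  by (induction k arbitrary: f) (auto intro: continuous_on_subset)

lemma Ck_on_Un: "open S \<Longrightarrow> open T \<Longrightarrow> Ck_on k S f \<Longrightarrow> Ck_on k T f \<Longrightarrow> Ck_on k (S \<union> T) f"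
  by (induction k arbitrary: f) (auto intro: continuous_on_open_Un)

lemma Ck_on_const: "open T \<Longrightarrow> Ck_on k T (\<lambda>_. c)"
proof (induction k arbitrary: c)
  case 0
  thus ?case by simp
next
  case (Suc k)
  thus ?case by (intro Ck_on_SucI[where D = "\<lambda>_ _. 0"]) auto
qed

lemma Ck_on_bounded_linear: "open T \<Longrightarrow> bounded_linear L \<Longrightarrow> Ck_on k T L"
proof (cases k)
  case 0
  thus "open T \<Longrightarrow> bounded_linear L \<Longrightarrow> Ck_on k T L" by (simp add: linear_continuous_on)
next
  case (Suc n)
  assume "open T" "bounded_linear L"
  thus ?thesis unfolding Suc
    by (intro Ck_on_SucI[where D = "\<lambda>_. L"] Ck_on_const) (auto intro: bounded_linear_imp_has_derivative)
qed

lemma Ck_on_add: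
  assumes "open T"
  shows "Ck_on k T f \<Longrightarrow> Ck_on k T g \<Longrightarrow> Ck_on k T (\<lambda>z. f z + g z)"
proof (induction k arbitrary: f g)
  case 0
  thus ?case by (simp add: continuous_on_add)
next
  case (Suc k)
  show ?case
  proof (rule Ck_on_SucI[OF assms])
    fix z assume "z \<in> T"
    thus "((\<lambda>z. f z + g z) has_derivative
        (\<lambda>v. frechet_derivative f (at z) v + frechet_derivative g (at z) v)) (at z)"
      using Suc.prems by (intro has_derivative_add Ck_on_has_derivative) auto
  qed (use Suc in auto)
qed

lemma Ck_on_mult:
  assumes "open T"
  shows "Ck_on k T f \<Longrightarrow> Ck_on k T g \<Longrightarrow> Ck_on k T (\<lambda>z. f z * g z)"
proof (induction k arbitrary: f g)
  case 0
  thus ?case by (simp add: continuous_on_mult)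
next
  case (Suc k)
  show ?case
  proof (rule Ck_on_SucI[OF assms])
    fix z assume "z \<in> T"
    thus "((\<lambda>z. f z * g z) has_derivative
        (\<lambda>v. f z * frechet_derivative g (at z) v + frechet_derivative f (at z) v * g z)) (at z)"
      using Suc.prems by (intro has_derivative_mult Ck_on_has_derivative) auto
  next
    fix v
    show "Ck_on k T (\<lambda>z. f z * frechet_derivative g (at z) v + frechet_derivative f (at z) v * g z)"
      using Suc.prems by (intro Ck_on_add[OF assms] Suc.IH Ck_on_SucD[of k T f] Ck_on_SucD[of k T g]) auto
  qed
qed

lemma Ck_on_inverse:
  assumes "open T" "\<And>z. z \<in> T \<Longrightarrow> f z \<noteq> 0"
  shows "Ck_on k T f \<Longrightarrow> Ck_on k T (\<lambda>z. inverse (f z))"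
proof (induction k)
  case 0
  thus ?case using assms by (auto intro!: continuous_on_inverse)
next
  case (Suc k)
  show ?case
  proof (rule Ck_on_SucI[OF assms(1)])
    fix z assume z: "z \<in> T"
    show "((\<lambda>z. inverse (f z)) has_derivative
        (\<lambda>v. - (inverse (f z) * frechet_derivative f (at z) v * inverse (f z)))) (at z)"
      by (rule Deriv.has_derivative_inverse[OF assms(2)[OF z] Ck_on_has_derivative[OF Suc.prems z]])
  next
    fix v
    have 1: "Ck_on k T (\<lambda>z. inverse (f z))"
      using Suc.IH Ck_on_SucD Suc.prems by blast
    have "Ck_on k T (\<lambda>z. (- 1) * ((inverse (f z) * frechet_derivative f (at z) v) * inverse (f z)))"
      using Suc.prems by (intro Ck_on_mult Ck_on_const assms(1) 1) auto
    thus "Ck_on k T (\<lambda>z. - (inverse (f z) * frechet_derivative f (at z) v * inverse (f z)))"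
      by simp
  qed
qed

text \<open>The directional derivative of a holomorphic f is v times \<open>deriv f\<close>, again
  holomorphic, so the induction runs over all f at once.\<close>

lemma Ck_on_holomorphic:
  assumes "open T"
  shows "f holomorphic_on T \<Longrightarrow> Ck_on k T f"
proof (induction k arbitrary: f)
  case 0
  thus ?case by (simp add: holomorphic_on_imp_continuous_on)
next
  case (Suc k)
  show ?case
  proof (rule Ck_on_SucI[OF assms])
    fix z assume "z \<in> T"
    thus "(f has_derivative (\<lambda>v. deriv f z * v)) (at z)"
      using holomorphic_derivI[OF Suc.prems assms] by (simp add: has_field_derivative_def)
  next
    fix v
    show "Ck_on k T (\<lambda>z. deriv f z * v)"
      by (intro Suc.IH holomorphic_intros holomorphic_deriv Suc.prems assms)
  qed
qed

lemma smooth_on_cong: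
  "open T \<Longrightarrow> (\<And>z. z \<in> T \<Longrightarrow> f z = g z) \<Longrightarrow> smooth_on T f \<longleftrightarrow> smooth_on T g"
  unfolding smooth_on_def using Ck_on_cong by blast

lemma smooth_on_subset: "smooth_on T f \<Longrightarrow> S \<subseteq> T \<Longrightarrow> smooth_on S f"
  unfolding smooth_on_def using Ck_on_subset by blast

lemma smooth_on_Un: "open S \<Longrightarrow> open T \<Longrightarrow> smooth_on S f \<Longrightarrow> smooth_on T f \<Longrightarrow> smooth_on (S \<union> T) f"
  unfolding smooth_on_def using Ck_on_Un by blast

lemma smooth_on_const: "open T \<Longrightarrow> smooth_on T (\<lambda>_. c)"
  unfolding smooth_on_def using Ck_on_const by blast

lemma smooth_on_add: "open T \<Longrightarrow> smooth_on T f \<Longrightarrow> smooth_on T g \<Longrightarrow> smooth_on T (\<lambda>z. f z + g z)"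
  unfolding smooth_on_def using Ck_on_add by blast

lemma smooth_on_mult: "open T \<Longrightarrow> smooth_on T f \<Longrightarrow> smooth_on T g \<Longrightarrow> smooth_on T (\<lambda>z. f z * g z)"
  unfolding smooth_on_def using Ck_on_mult by blast

lemma smooth_on_minus: "open T \<Longrightarrow> smooth_on T f \<Longrightarrow> smooth_on T (\<lambda>z. - f z)"
  using smooth_on_mult[OF _ smooth_on_const[where c = "-1"], of T f] by simp

lemma smooth_on_diff: "open T \<Longrightarrow> smooth_on T f \<Longrightarrow> smooth_on T g \<Longrightarrow> smooth_on T (\<lambda>z. f z - g z)"
  using smooth_on_add[OF _ _ smooth_on_minus] by simp

lemma smooth_on_sum:
  "open T \<Longrightarrow> (\<And>i. i \<in> I \<Longrightarrow> smooth_on T (f i)) \<Longrightarrow> smooth_on T (\<lambda>z. \<Sum>i\<in>I. f i z)"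
  by (induction I rule: infinite_finite_induct) (auto intro: smooth_on_add smooth_on_const)

lemma smooth_on_divide:
  "open T \<Longrightarrow> smooth_on T f \<Longrightarrow> smooth_on T g \<Longrightarrow> (\<And>z. z \<in> T \<Longrightarrow> g z \<noteq> 0) \<Longrightarrow> smooth_on T (\<lambda>z. f z / g z)"
  unfolding divide_inverse by (intro smooth_on_mult) (auto simp: smooth_on_def Ck_on_inverse)

lemma smooth_on_holomorphic: "open T \<Longrightarrow> f holomorphic_on T \<Longrightarrow> smooth_on T f"
  unfolding smooth_on_def using Ck_on_holomorphic by blast

lemma smooth_on_has_derivative:
  "smooth_on T f \<Longrightarrow> z \<in> T \<Longrightarrow> (f has_derivative frechet_derivative f (at z)) (at z)"
  unfolding smooth_on_def using Ck_on_has_derivative by blast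

lemma smooth_on_frechet_derivative:
  assumes "smooth_on T f"
  shows "smooth_on T (\<lambda>z. frechet_derivative f (at z) v)"
  unfolding smooth_on_def
proof
  fix k
  have "Ck_on (Suc k) T f" using assms unfolding smooth_on_def by blast
  thus "Ck_on k T (\<lambda>z. frechet_derivative f (at z) v)" by simp
qed

lemma smooth_on_continuous: "smooth_on T f \<Longrightarrow> continuous_on T f"
  unfolding smooth_on_def using Ck_on.simps(1) by blast

section \<open>Cutoff functions\<close>

text \<open>The powers of 1/s turn the classical exp(-1/s) into a family whose span is closed under
  differentiation: the derivative of \<open>flat n\<close> combines \<open>flat (n+1)\<close> and
  \<open>flat (n+2)\<close>. Smoothness then follows by induction.\<close>

definition flat :: "nat \<Rightarrow> real \<Rightarrow> real" where
  "flat n s = (if s \<le> 0 then 0 else exp (- inverse s) * inverse s ^ n)"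

lemma flat_nonneg: "flat n s \<ge> 0"
  by (simp add: flat_def)

lemma flat_pos: "s > 0 \<Longrightarrow> flat n s > 0"
  by (simp add: flat_def)

lemma flat_eq_0: "s \<le> 0 \<Longrightarrow> flat n s = 0"
  by (simp add: flat_def)

text \<open>Putting x = 1/s reduces the limit from the right to the decay of x^n / exp x.\<close>

lemma tendsto_flat_0: "(flat n \<longlongrightarrow> 0) (at 0)"
proof -
  have "((\<lambda>x::real. x ^ n / exp x) \<longlongrightarrow> 0) at_top"
    by (rule tendsto_power_div_exp_0)
  hence "((\<lambda>s::real. inverse s ^ n / exp (inverse s)) \<longlongrightarrow> 0) (at_right 0)"
    by (rule filterlim_compose[OF _ filterlim_inverse_at_top_right])
  hence "(flat n \<longlongrightarrow> 0) (at_right 0)"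
    by (rule Lim_transform_eventually)
       (auto simp: flat_def eventually_at_right_field exp_minus field_simps intro!: exI[of _ 1])
  moreover have "(flat n \<longlongrightarrow> 0) (at_left 0)"
    by (rule tendsto_eventually) (auto simp: flat_def eventually_at_left_field intro!: exI[of _ "-1"])
  ultimately show ?thesis by (simp add: filterlim_split_at)
qed

lemma flat_has_derivative:
  "(flat n has_real_derivative (flat (n + 2) s - real n * flat (n + 1) s)) (at s)"
proof -
  consider "s < 0" | "s = 0" | "s > 0" by linarith
  thus ?thesis
  proof cases
    case 1
    have "((\<lambda>_. 0) has_real_derivative 0) (at s)" by simp
    hence "(flat n has_real_derivative 0) (at s)"
      by (rule has_field_derivative_transform_within_open[of _ _ _ "{..<0}"]) (use 1 in \<open>auto simp: flat_def\<close>)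
    thus ?thesis using 1 by (simp add: flat_def)
  next
    case 2
    \<comment> \<open>The difference quotient at 0 is itself a member of the family, so its limit is
      already known.\<close>
    have "(\<lambda>h. (flat n (0 + h) - flat n 0) / h) = flat (n + 1)"
      by (auto simp: flat_def fun_eq_iff field_simps)
    thus ?thesis using tendsto_flat_0[of "n+1"] 2
      by (simp add: DERIV_def flat_def)
  next
    case 3
    have "((\<lambda>s. exp (- inverse s) * inverse s ^ n) has_real_derivative
            (flat (n + 2) s - real n * flat (n + 1) s)) (at s)"
      using 3 apply (auto intro!: derivative_eq_intros simp: flat_def)
      by (cases n) (auto simp: field_simps power2_eq_square)
    thus ?thesis
      by (rule has_field_derivative_transform_within_open[of _ _ _ "{0<..}"]) (use 3 in \<open>auto simp: flat_def\<close>)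
  qed
qed

text \<open>The induction on k must hold for all n simultaneously, since differentiating raises n.
  The chain rule contributes the factor \<open>D z v\<close>, assumed smooth in z.\<close>

lemma Ck_on_flat:
  assumes "open T" "\<And>z. (\<sigma> has_derivative D z) (at z)" "\<And>v. smooth_on T (\<lambda>z. of_real (D z v))"
  shows "Ck_on k T (\<lambda>z. of_real (flat n (\<sigma> z)))"
proof (induction k arbitrary: n)
  case 0
  have "isCont (\<lambda>z. complex_of_real (flat n (\<sigma> z))) z" for z
    using has_derivative_continuous[OF assms(2)] DERIV_isCont[OF flat_has_derivative]
    by (intro continuous_of_real isCont_o2[of z \<sigma> "flat n"])
  thus ?case unfolding Ck_on.simps by (intro continuous_at_imp_continuous_on ballI)
next
  case (Suc k)
  show ?case
  proof (rule Ck_on_SucI[OF assms(1)])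
    fix z
    show "((\<lambda>z. of_real (flat n (\<sigma> z)) :: complex) has_derivative
       (\<lambda>v. (of_real (flat (n+2) (\<sigma> z)) + (- of_nat n) * of_real (flat (n+1) (\<sigma> z))) * of_real (D z v))) (at z)"
      using DERIV_compose_FDERIV[OF flat_has_derivative assms(2), THEN has_derivative_of_real, of n z]
      by (simp add: algebra_simps)
  next
    fix v
    have "Ck_on k T (\<lambda>z. of_real (D z v))" using assms(3) unfolding smooth_on_def by blast
    thus "Ck_on k T (\<lambda>z. (of_real (flat (n+2) (\<sigma> z)) + (- of_nat n) * of_real (flat (n+1) (\<sigma> z))) * of_real (D z v))"
      by (intro Ck_on_mult Ck_on_add Suc.IH Ck_on_const assms(1))
  qed
qed

text \<open>2 - s and s - 1 are never both nonpositive, so the denominator is positive and this is a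
  transition from 1 (for s at most 1) to 0 (for s at least 2).\<close>

definition smooth_step :: "real \<Rightarrow> real" where
  "smooth_step s = flat 0 (2 - s) / (flat 0 (2 - s) + flat 0 (s - 1))"

lemma smooth_step_denom_pos: "flat 0 (2 - s) + flat 0 (s - 1) > 0"
  using flat_pos[of "2 - s" 0] flat_pos[of "s - 1" 0] flat_nonneg[of 0 "2 - s"] flat_nonneg[of 0 "s - 1"]
  by (cases "s < 2") force+

lemma smooth_step_eq_1: "s \<le> 1 \<Longrightarrow> smooth_step s = 1"
  using smooth_step_denom_pos[of s] by (simp add: smooth_step_def flat_eq_0)

lemma smooth_step_eq_0: "s \<ge> 2 \<Longrightarrow> smooth_step s = 0"
  by (simp add: smooth_step_def flat_eq_0)

lemma smooth_step_deriv:
  obtains smooth_step' where "\<And>s. (smooth_step has_real_derivative smooth_step' s) (at s)" "continuous_on UNIV smooth_step'"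
proof
  define smooth_step' where "smooth_step' s = (let p = flat 0 (2 - s); q = flat 0 (s - 1); p' = - flat 2 (2 - s); q' = flat 2 (s - 1)
     in (p' * (p + q) - p * (p' + q')) / ((p + q) * (p + q)))" for s
  show "(smooth_step has_real_derivative smooth_step' s) (at s)" for s
  proof -
    have "((\<lambda>s. 2 - s) has_real_derivative - 1) (at s)" "((\<lambda>s. s - 1) has_real_derivative 1) (at s)"
      by (auto intro!: derivative_eq_intros)
    from this[THEN DERIV_chain2[OF flat_has_derivative[of 0]]]
    have 1: "((\<lambda>s. flat 0 (2 - s)) has_real_derivative - flat 2 (2 - s)) (at s)"
      and 2: "((\<lambda>s. flat 0 (s - 1)) has_real_derivative flat 2 (s - 1)) (at s)"
      by (simp_all add: numeral_2_eq_2)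
    have 3: "flat 0 (2 - s) + flat 0 (s - 1) \<noteq> 0" using smooth_step_denom_pos[of s] by linarith
    show ?thesis unfolding smooth_step_def[abs_def] smooth_step'_def Let_def
      using DERIV_divide[OF 1 DERIV_add[OF 1 2] 3] by simp
  qed
  have "isCont (flat n) s" for n s using DERIV_isCont[OF flat_has_derivative] .
  hence "continuous_on UNIV (flat n)" for n by (auto intro: continuous_at_imp_continuous_on)
  hence *: "continuous_on UNIV g \<Longrightarrow> continuous_on UNIV (\<lambda>s. flat n (g s))" for n g
    using continuous_on_compose2[of UNIV "flat n"] by blast
  show "continuous_on UNIV smooth_step'" unfolding smooth_step'_def Let_def
    using smooth_step_denom_pos by (intro continuous_intros *) (simp add: less_imp_neq[THEN not_sym])
qed

text \<open>The squared modulus is a polynomial in the real coordinates, so there is no singularity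
  at c, and it makes radial integrals one-dimensional without a weight. The transition ends at
  radius sqrt 2 * r; 3/2 * r is a convenient bound beyond it.\<close>

definition cutoff :: "complex \<Rightarrow> real \<Rightarrow> complex \<Rightarrow> complex" where
  "cutoff c r z = of_real (smooth_step ((cmod (z - c))\<^sup>2 / r\<^sup>2))"

lemma cutoff_eq_1: "r > 0 \<Longrightarrow> cmod (z - c) \<le> r \<Longrightarrow> cutoff c r z = 1"
  unfolding cutoff_def by (subst smooth_step_eq_1) (auto simp: power_mono)

lemma cutoff_eq_0: "r > 0 \<Longrightarrow> cmod (z - c) \<ge> 3/2 * r \<Longrightarrow> cutoff c r z = 0"
proof -
  assume r: "r > 0" and "cmod (z - c) \<ge> 3/2 * r"
  hence "(cmod (z - c))\<^sup>2 \<ge> (3/2 * r)\<^sup>2" by (intro power_mono) auto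
  moreover have "(3/2 * r)\<^sup>2 \<ge> 2 * r\<^sup>2" using r by (simp add: power_mult_distrib power2_eq_square)
  ultimately have "(cmod (z - c))\<^sup>2 \<ge> 2 * r\<^sup>2" by linarith
  thus ?thesis unfolding cutoff_def using r by (subst smooth_step_eq_0) (auto simp: field_simps)
qed

lemma cmod_power2_has_derivative:
  "((\<lambda>z. (cmod (z - c))\<^sup>2) has_derivative (\<lambda>v. 2 * ((z - c) \<bullet> v))) (at z)"
proof -
  have "((\<lambda>z. (z - c) \<bullet> (z - c)) has_derivative (\<lambda>v. 2 * ((z - c) \<bullet> v))) (at z)"
    by (auto intro!: derivative_eq_intros simp: inner_commute)
  thus ?thesis by (simp add: power2_norm_eq_inner)
qed

lemma smooth_on_cutoff: "open T \<Longrightarrow> smooth_on T (cutoff c r)"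
proof -
  assume T: "open T"
  \<comment> \<open>The two parameters cover both arguments in \<open>smooth_step\<close>: (-1/r^2,
    2) and (1/r^2, -1).\<close>
  have sm: "smooth_on T (\<lambda>z. of_real (flat 0 (\<kappa> * (cmod (z - c))\<^sup>2 + \<mu>)))" for \<kappa> \<mu>
    unfolding smooth_on_def
  proof (intro allI Ck_on_flat[OF T, where D = "\<lambda>z v. \<kappa> * (2 * ((z - c) \<bullet> v))"])
    show "((\<lambda>z. \<kappa> * (cmod (z - c))\<^sup>2 + \<mu>) has_derivative (\<lambda>v. \<kappa> * (2 * ((z - c) \<bullet> v)))) (at z)" for z
      by (rule has_derivative_add[OF has_derivative_mult_right[OF cmod_power2_has_derivative] has_derivative_const, simplified])
    show "smooth_on T (\<lambda>z. complex_of_real (\<kappa> * (2 * ((z - c) \<bullet> v))))" for v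
    proof -
      have "bounded_linear (\<lambda>z. complex_of_real (2 * \<kappa> * (z \<bullet> v)))"
        by (intro bounded_linear_intros bounded_linear_of_real[THEN bounded_linear_compose])
      hence "smooth_on T (\<lambda>z. complex_of_real (2 * \<kappa> * (z \<bullet> v)))"
        unfolding smooth_on_def using Ck_on_bounded_linear[OF T] by blast
      from smooth_on_diff[OF T this smooth_on_const[OF T, of "of_real (2 * \<kappa> * (c \<bullet> v))"]]
      show ?thesis by (simp add: inner_diff_left algebra_simps)
    qed
  qed
  have 1: "smooth_on T (\<lambda>z. of_real (flat 0 (2 - (cmod (z - c))\<^sup>2 / r\<^sup>2)))"
    using sm[of "-1/r^2" 2] by (simp add: algebra_simps)
  have 2: "smooth_on T (\<lambda>z. of_real (flat 0 ((cmod (z - c))\<^sup>2 / r\<^sup>2 - 1)))"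
    using sm[of "1/r^2" "-1"] by simp
  have 3: "(complex_of_real (flat 0 (2 - s)) + of_real (flat 0 (s - 1))) \<noteq> 0" for s
    unfolding of_real_add[symmetric] using smooth_step_denom_pos[of s] by (simp del: of_real_add)
  show ?thesis unfolding cutoff_def[abs_def] smooth_step_def of_real_divide of_real_add
    by (intro smooth_on_divide smooth_on_add T 1 2 3)
qed

section \<open>Stokes' theorem for compactly supported forms\<close>

text \<open>The mean value inequality in the form used three times: for second differences, for
  dominating difference quotients, and with B = 0 to show that a function is constant along a
  circle.\<close>

lemma norm_diff_le_of_vector_derivative:
  fixes g :: "real \<Rightarrow> 'a::real_normed_vector"
  assumes "s \<ge> 0" "\<And>x. x \<in> {0..s} \<Longrightarrow> (g has_vector_derivative g' x) (at x)"
    and "\<And>x. x \<in> {0..s} \<Longrightarrow> norm (g' x) \<le> B"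
  shows "norm (g s - g 0) \<le> B * s"
proof -
  have "norm (g s - g 0) \<le> B * norm (s - 0)"
  proof (rule differentiable_bound[of "{0..s}" g "\<lambda>x h. h *\<^sub>R g' x"])
    show "(g has_derivative (\<lambda>h. h *\<^sub>R g' x)) (at x within {0..s})" if "x \<in> {0..s}" for x
      using assms(2)[OF that] unfolding has_vector_derivative_def by (rule has_derivative_at_withinI)
    show "onorm (\<lambda>h. h *\<^sub>R g' x) \<le> B" if "x \<in> {0..s}" for x
      using assms(3)[OF that] onorm_le[of "\<lambda>h::real. h *\<^sub>R g' x" "norm (g' x)"]
      by (fastforce simp: mult.commute)
  qed (use assms(1) in auto)
  thus ?thesis using assms(1) by simp
qed

lemma smooth_on_line_derivative:
  assumes "smooth_on T f" "z + s *\<^sub>R v \<in> T"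
  shows "((\<lambda>s. f (z + s *\<^sub>R v)) has_vector_derivative frechet_derivative f (at (z + s *\<^sub>R v)) v) (at s)"
proof -
  have "((\<lambda>s. z + s *\<^sub>R v) has_vector_derivative v) (at s)"
    by (auto intro!: derivative_eq_intros)
  from vector_derivative_diff_chain_within[OF this, of f "frechet_derivative f (at (z + s *\<^sub>R v))"]
  show ?thesis
    using has_derivative_at_withinI[OF smooth_on_has_derivative[OF assms]] by (simp add: o_def)
qed

text \<open>Two applications of the mean value inequality: in direction v to the derivative
  \<open>fu\<close>, then in direction u to f. Continuity of the mixed derivative keeps the error
  below \<epsilon> on the small parallelogram.\<close>

lemma second_difference_bound:
  fixes u v z :: complex
  assumes "open T" "z \<in> T" "smooth_on T f" "\<epsilon> > 0"
  defines "fu \<equiv> \<lambda>w. frechet_derivative f (at w) u"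
  shows "\<exists>\<delta>>0. \<forall>s. 0 < s \<and> s < \<delta> \<longrightarrow>
    norm (f (z + s *\<^sub>R u + s *\<^sub>R v) - f (z + s *\<^sub>R u) - f (z + s *\<^sub>R v) + f z
      - (s * s) *\<^sub>R frechet_derivative fu (at z) v) \<le> \<epsilon> * s * s"
proof -
  define E where "E w = frechet_derivative fu (at w) v" for w
  have sfu: "smooth_on T fu" unfolding fu_def by (rule smooth_on_frechet_derivative[OF assms(3)])
  have "continuous_on T E" unfolding E_def
    by (intro smooth_on_continuous smooth_on_frechet_derivative sfu)
  hence "isCont E z" using assms(1,2) by (simp add: continuous_on_eq_continuous_at)
  then obtain d1 where d1: "d1 > 0" "\<And>w. dist w z < d1 \<Longrightarrow> dist (E w) (E z) < \<epsilon>"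
    using assms(4) unfolding continuous_at_eps_delta by metis
  obtain d2 where d2: "d2 > 0" "ball z d2 \<subseteq> T"
    using assms(1,2) openE by blast
  define d where "d = min d1 d2"
  \<comment> \<open>Chosen so that z + a u + b v with a, b in [0, s] stays within distance d of z;
    the summand 1 keeps the denominator positive when u = v = 0.\<close>
  define \<delta> where "\<delta> = d / (norm u + norm v + 1)"
  have np: "norm u + norm v + 1 > 0" using norm_ge_zero[of u] norm_ge_zero[of v] by linarith
  have "\<delta> > 0" using d1 d2 np by (auto simp: \<delta>_def d_def)
  moreover have "norm (f (z + s *\<^sub>R u + s *\<^sub>R v) - f (z + s *\<^sub>R u) - f (z + s *\<^sub>R v) + f z
      - (s * s) *\<^sub>R E z) \<le> \<epsilon> * s * s" if s: "0 < s" "s < \<delta>" for s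
  proof -
    have near: "z + a *\<^sub>R u + b *\<^sub>R v \<in> T \<and> norm (E (z + a *\<^sub>R u + b *\<^sub>R v) - E z) \<le> \<epsilon>"
      if "a \<in> {0..s}" "b \<in> {0..s}" for a b
    proof -
      have "norm (a *\<^sub>R u + b *\<^sub>R v) \<le> a * norm u + b * norm v"
        using that norm_triangle_ineq[of "a *\<^sub>R u" "b *\<^sub>R v"] by simp
      also have "\<dots> \<le> s * norm u + s * norm v"
        using that by (intro add_mono mult_right_mono) auto
      also have "\<dots> < s * (norm u + norm v + 1)" using s by (simp add: algebra_simps)
      also have "\<dots> < d" using s np by (simp add: \<delta>_def field_simps)
      finally have "norm (a *\<^sub>R u + b *\<^sub>R v) < d" .
      hence "dist (z + a *\<^sub>R u + b *\<^sub>R v) z < d" by (simp add: dist_norm add.assoc)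
      hence "dist (z + a *\<^sub>R u + b *\<^sub>R v) z < d1" "z + a *\<^sub>R u + b *\<^sub>R v \<in> ball z d2"
        by (simp_all add: d_def dist_commute)
      thus ?thesis using d1(2) d2(2) by (fastforce simp: dist_norm)
    qed
    have k: "norm (fu (z + a *\<^sub>R u + s *\<^sub>R v) - fu (z + a *\<^sub>R u) - s *\<^sub>R E z) \<le> \<epsilon> * s"
      if a: "a \<in> {0..s}" for a
    proof -
      have "norm ((\<lambda>b. fu (z + a *\<^sub>R u + b *\<^sub>R v) - b *\<^sub>R E z) s - (\<lambda>b. fu (z + a *\<^sub>R u + b *\<^sub>R v) - b *\<^sub>R E z) 0) \<le> \<epsilon> * s"
      proof (rule norm_diff_le_of_vector_derivative)
        fix b assume b: "b \<in> {0..s}"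
        show "((\<lambda>b. fu (z + a *\<^sub>R u + b *\<^sub>R v) - b *\<^sub>R E z) has_vector_derivative
            (E (z + a *\<^sub>R u + b *\<^sub>R v) - E z)) (at b)"
          using smooth_on_line_derivative[OF sfu, of "z + a *\<^sub>R u" b v] near[OF a b] unfolding E_def
          by (auto intro!: derivative_eq_intros)
      qed (use s near[OF a] in auto)
      thus ?thesis by (simp add: algebra_simps)
    qed
    have "norm ((\<lambda>a. f (z + s *\<^sub>R v + a *\<^sub>R u) - f (z + a *\<^sub>R u) - (a * s) *\<^sub>R E z) s
             - (\<lambda>a. f (z + s *\<^sub>R v + a *\<^sub>R u) - f (z + a *\<^sub>R u) - (a * s) *\<^sub>R E z) 0) \<le> (\<epsilon> * s) * s"
    proof (rule norm_diff_le_of_vector_derivative)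
      fix a assume a: "a \<in> {0..s}"
      have i: "z + s *\<^sub>R v + a *\<^sub>R u \<in> T" "z + a *\<^sub>R u \<in> T"
        using near[OF a, of s] near[OF a, of 0] s by (auto simp: algebra_simps)
      have "((\<lambda>a. (a * s) *\<^sub>R E z) has_vector_derivative s *\<^sub>R E z) (at a)"
        by (auto intro!: derivative_eq_intros)
      with smooth_on_line_derivative[OF assms(3) i(1)] smooth_on_line_derivative[OF assms(3) i(2)]
      show "((\<lambda>a. f (z + s *\<^sub>R v + a *\<^sub>R u) - f (z + a *\<^sub>R u) - (a * s) *\<^sub>R E z) has_vector_derivative
            (fu (z + s *\<^sub>R v + a *\<^sub>R u) - fu (z + a *\<^sub>R u) - s *\<^sub>R E z)) (at a)"
        unfolding fu_def by (intro has_vector_derivative_diff)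
    qed (use s k in \<open>auto simp: algebra_simps\<close>)
    thus ?thesis by (simp add: algebra_simps)
  qed
  ultimately show ?thesis unfolding E_def by blast
qed

text \<open>The second difference is symmetric in u and v, so after division by s^2 it is within
  \<epsilon> of both mixed derivatives. Taking \<epsilon> as a quarter of their distance is
  contradictory.\<close>

lemma second_derivative_symmetric:
  assumes "open T" "z \<in> T" "smooth_on T f"
  shows "frechet_derivative (\<lambda>w. frechet_derivative f (at w) u) (at z) v =
         frechet_derivative (\<lambda>w. frechet_derivative f (at w) v) (at z) u" (is "?A = ?B")
proof (rule ccontr)
  assume "?A \<noteq> ?B"
  define \<epsilon> where "\<epsilon> = norm (?A - ?B) / 4"
  have e: "\<epsilon> > 0" using \<open>?A \<noteq> ?B\<close> by (simp add: \<epsilon>_def)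
  obtain d1 where d1: "d1 > 0" "\<And>s. 0 < s \<Longrightarrow> s < d1 \<Longrightarrow>
    norm (f (z + s *\<^sub>R u + s *\<^sub>R v) - f (z + s *\<^sub>R u) - f (z + s *\<^sub>R v) + f z
      - (s * s) *\<^sub>R ?A) \<le> \<epsilon> * s * s"
    using second_difference_bound[OF assms e, of u v] by blast
  obtain d2 where d2: "d2 > 0" "\<And>s. 0 < s \<Longrightarrow> s < d2 \<Longrightarrow>
    norm (f (z + s *\<^sub>R v + s *\<^sub>R u) - f (z + s *\<^sub>R v) - f (z + s *\<^sub>R u) + f z
      - (s * s) *\<^sub>R ?B) \<le> \<epsilon> * s * s"
    using second_difference_bound[OF assms e, of v u] by blast
  define s where "s = min d1 d2 / 2"
  have s: "0 < s" "s < d1" "s < d2" using d1(1) d2(1) by (auto simp: s_def)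
  define \<Delta> where "\<Delta> = f (z + s *\<^sub>R u + s *\<^sub>R v) - f (z + s *\<^sub>R u) - f (z + s *\<^sub>R v) + f z"
  have 1: "norm (\<Delta> - (s * s) *\<^sub>R ?A) \<le> \<epsilon> * s * s" using d1(2)[OF s(1,2)] by (simp add: \<Delta>_def)
  have "z + s *\<^sub>R v + s *\<^sub>R u = z + s *\<^sub>R u + s *\<^sub>R v" by simp
  hence 2: "norm (\<Delta> - (s * s) *\<^sub>R ?B) \<le> \<epsilon> * s * s" using d2(2)[OF s(1,3)]
    by (simp add: \<Delta>_def algebra_simps)
  have "(s * s) * norm (?A - ?B) = norm ((\<Delta> - (s * s) *\<^sub>R ?B) - (\<Delta> - (s * s) *\<^sub>R ?A))"
    by (simp add: scaleR_diff_right[symmetric] abs_mult)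
  also have "\<dots> \<le> \<epsilon> * s * s + \<epsilon> * s * s"
    using 1 2 norm_triangle_ineq4 by (meson add_mono order_trans)
  finally have "(s * s) * (4 * \<epsilon>) \<le> (s * s) * (2 * \<epsilon>)" by (simp add: \<epsilon>_def algebra_simps)
  hence "4 * \<epsilon> \<le> 2 * \<epsilon>" using s by (subst (asm) mult_le_cancel_left) auto
  thus False using e by simp
qed

lemma d1_d0_eq_0:
  assumes "open T" "smooth_on T f" "z \<in> T"
  shows "d1 (d0 f) z = 0"
  using second_derivative_symmetric[OF assms(1,3,2)]
  unfolding d1_def d0_def by (simp add: dx_def[abs_def] dy_def[abs_def])

lemma set_integrable_compactly_supported:
  fixes f :: "complex \<Rightarrow> complex"
  assumes "continuous_on T f" "compactly_supported T f"
  shows "set_integrable lborel T f"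
proof -
  obtain K where K: "compact K" "K \<subseteq> T" "\<forall>z\<in>T - K. f z = 0"
    using assms(2) unfolding compactly_supported_def by blast
  have "(\<lambda>z. indicator T z *\<^sub>R f z) = (\<lambda>z. indicator K z *\<^sub>R f z)"
    using K by (auto simp: indicator_def fun_eq_iff)
  thus ?thesis unfolding set_integrable_def
    using borel_integrable_compact[OF K(1) continuous_on_subset[OF assms(1) K(2)]] by simp
qed

lemma lborel_integral_translate:
  fixes g :: "complex \<Rightarrow> complex"
  assumes "g \<in> borel_measurable borel"
  shows "(\<integral>z. g (c + z) \<partial>lborel) = (\<integral>z. g z \<partial>lborel)"
  using integral_distr[of "(+) c" lborel borel g] assms by (simp add: lborel_distr_plus)

text \<open>The derivative is the limit of the difference quotients \<open>Q n\<close>, whose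
  integrals vanish by translation invariance of Lebesgue measure. Dominated convergence passes to
  the limit: the quotients are bounded by a bound of the derivative and live in one fixed
  ball.\<close>

lemma integral_directional_derivative_eq_0:
  assumes g: "smooth_on UNIV g" and K: "compact K" "\<And>z. z \<notin> K \<Longrightarrow> g z = 0"
  shows "(\<integral>z. frechet_derivative g (at z) v \<partial>lborel) = 0"
proof -
  define D where "D z = frechet_derivative g (at z) v" for z
  have contD: "continuous_on UNIV D" unfolding D_def
    by (intro smooth_on_continuous smooth_on_frechet_derivative g)
  have contg: "continuous_on UNIV g" by (rule smooth_on_continuous[OF g])
  have D0: "D z = 0" if "z \<notin> K" for z
    using frechet_derivative_cong_open[of "- K" g "\<lambda>_. 0" z] K that compact_imp_closed[OF K(1)]
    by (simp add: D_def open_Compl)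
  obtain B where B: "B > 0" "\<And>z. z \<in> K \<Longrightarrow> norm (D z) \<le> B"
    using compact_imp_bounded[OF compact_continuous_image[OF continuous_on_subset[OF contD] K(1)]]
    unfolding bounded_pos by auto
  have BD: "norm (D z) \<le> B" for z using B D0[of z] by (cases "z \<in> K") auto
  obtain R where R: "K \<subseteq> ball 0 R" using compact_imp_bounded[OF K(1)] bounded_subset_ballD by blast
  define h where "h n = inverse (real (Suc n))" for n
  have h: "h n > 0" "h n \<le> 1" for n by (auto simp: h_def field_simps)
  define Q where "Q n z = (g (h n *\<^sub>R v + z) - g z) /\<^sub>R h n" for n z
  have line: "((\<lambda>s. g (z + s *\<^sub>R v)) has_vector_derivative D (z + s *\<^sub>R v)) (at s)" for z s
    unfolding D_def by (rule smooth_on_line_derivative[OF g]) simp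
  have "norm (Q n z) \<le> B" for n z
  proof -
    have "norm (g (z + h n *\<^sub>R v) - g (z + 0 *\<^sub>R v)) \<le> B * h n"
      by (rule norm_diff_le_of_vector_derivative[OF _ line]) (use h[of n] BD in auto)
    thus ?thesis using h[of n] by (simp add: Q_def add.commute divide_simps)
  qed
  \<comment> \<open>The step lengths \<open>h n\<close> are at most 1, so a shift moves a point by
    at most the norm of v.\<close>
  moreover have "Q n z = 0" if "z \<notin> cball 0 (R + norm v)" for n z
  proof -
    have "norm z \<le> norm (h n *\<^sub>R v + z) + norm (h n *\<^sub>R v)"
      using norm_triangle_ineq4[of "h n *\<^sub>R v + z" "h n *\<^sub>R v"] by simp
    moreover have "norm (h n *\<^sub>R v) \<le> norm v" using h[of n] by (simp add: mult_left_le_one_le)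
    ultimately have "norm (h n *\<^sub>R v + z) > R" using that by simp
    hence "h n *\<^sub>R v + z \<notin> K" "z \<notin> K" using R that norm_ge_zero[of v] by (auto simp del: norm_ge_zero)
    thus ?thesis using K(2) by (simp add: Q_def)
  qed
  ultimately have Qw: "norm (Q n z) \<le> indicator (cball 0 (R + norm v)) z *\<^sub>R B" for n z
    by (cases "z \<in> cball 0 (R + norm v)") auto
  have intg: "integrable lborel g"
  proof -
    have "(\<lambda>z. indicator K z *\<^sub>R g z) = g" using K(2) by (auto simp: fun_eq_iff indicator_def)
    thus ?thesis using borel_integrable_compact[OF K(1) continuous_on_subset[OF contg]] by simp
  qed
  have gm [measurable]: "g \<in> borel_measurable borel" "D \<in> borel_measurable borel"
    using contg contD by (auto intro: borel_measurable_continuous_onI)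
  have "integrable lborel (\<lambda>z. g (c + z))" for c
    using intg integrable_distr_eq[of "(+) c" lborel borel g] by (simp add: lborel_distr_plus)
  hence Q0: "integral\<^sup>L lborel (Q n) = 0" for n
    unfolding Q_def using intg lborel_integral_translate[OF gm(1)] by simp
  have lim: "(\<lambda>n. Q n z) \<longlonglongrightarrow> D z" for z
  proof -
    have "filterlim h (at 0) sequentially"
      using LIMSEQ_inverse_real_of_nat h(1)
      by (auto simp: filterlim_at h_def[abs_def] intro!: always_eventually)
    moreover have "((\<lambda>s. norm ((g (z + s *\<^sub>R v) - g z - s *\<^sub>R D z) /\<^sub>R norm s)) \<longlongrightarrow> 0) (at 0)"
      using line[of z 0] unfolding has_vector_derivative_def has_derivative_at by (simp add: divide_inverse mult.commute)
    ultimately have "(\<lambda>n. norm ((g (z + h n *\<^sub>R v) - g z - h n *\<^sub>R D z) /\<^sub>R norm (h n))) \<longlonglongrightarrow> 0"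
      by (rule filterlim_compose[rotated])
    moreover have "(g (z + h n *\<^sub>R v) - g z - h n *\<^sub>R D z) /\<^sub>R norm (h n) = Q n z - D z" for n
      using h(1)[of n] by (simp add: Q_def scaleR_diff_right add.commute)
    ultimately have "(\<lambda>n. norm (Q n z - D z)) \<longlonglongrightarrow> 0" by (simp only:)
    thus ?thesis using LIM_zero_cancel tendsto_norm_zero_iff by blast
  qed
  have "(\<lambda>n. integral\<^sup>L lborel (Q n)) \<longlonglongrightarrow> integral\<^sup>L lborel D"
  proof (rule integral_dominated_convergence[where w = "\<lambda>z. indicator (cball 0 (R + norm v)) z *\<^sub>R B"])
    show "integrable lborel (\<lambda>z::complex. indicator (cball 0 (R + norm v)) z *\<^sub>R B)"
      by (intro borel_integrable_compact) auto
    show "Q n \<in> borel_measurable lborel" for n unfolding Q_def by measurable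
    show "D \<in> borel_measurable lborel" using gm(2) by simp
    show "AE z in lborel. (\<lambda>n. Q n z) \<longlonglongrightarrow> D z" by (intro AE_I2 lim)
    show "AE z in lborel. norm (Q n z) \<le> indicator (cball 0 (R + norm v)) z *\<^sub>R B" for n
      by (intro AE_I2 Qw)
  qed
  hence "integral\<^sup>L lborel D = 0" unfolding Q0 by (rule LIMSEQ_unique[OF _ tendsto_const])
  thus ?thesis by (simp add: D_def[abs_def])
qed

lemma set_integral_directional_derivative_eq_0:
  assumes T: "open T" and f: "smooth_on T f" "compactly_supported T f"
  shows "(LINT z:T|lborel. frechet_derivative f (at z) v) = 0"
proof -
  obtain K where K: "compact K" "K \<subseteq> T" "\<forall>z\<in>T - K. f z = 0"
    using f(2) unfolding compactly_supported_def by blast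
  have oK: "open (- K)" using compact_imp_closed[OF K(1)] by (simp add: open_Compl)
  \<comment> \<open>The values of f outside T are arbitrary, so f is replaced by its extension by
    zero; it is smooth on T and on the complement of K, and these two open sets cover the
    plane.\<close>
  define g where "g z = (if z \<in> K then f z else 0)" for z
  have gT: "g z = f z" if "z \<in> T" for z using K that by (auto simp: g_def)
  have "smooth_on (T \<union> - K) g"
  proof (rule smooth_on_Un[OF T oK])
    show "smooth_on T g" using smooth_on_cong[OF T, of g f] gT f(1) by simp
    show "smooth_on (- K) g" using smooth_on_cong[OF oK, of g "\<lambda>_. 0"] smooth_on_const[OF oK]
      by (simp add: g_def)
  qed
  moreover have "T \<union> - K = UNIV" using K(2) by auto
  ultimately have "smooth_on UNIV g" by simp
  hence "(\<integral>z. frechet_derivative g (at z) v \<partial>lborel) = 0"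
    by (rule integral_directional_derivative_eq_0[OF _ K(1)]) (simp add: g_def)
  moreover have "indicator T z *\<^sub>R frechet_derivative f (at z) v = frechet_derivative g (at z) v" for z
  proof (cases "z \<in> T")
    case True
    thus ?thesis using frechet_derivative_cong_open[OF T gT True] by simp
  next
    case False
    hence "z \<in> - K" using K(2) by auto
    thus ?thesis using frechet_derivative_cong_open[OF oK, of g "\<lambda>_. 0" z] False by (simp add: g_def)
  qed
  ultimately show ?thesis unfolding set_lebesgue_integral_def by simp
qed

lemma compactly_supported_fst_snd:
  "compactly_supported T \<eta> \<Longrightarrow> compactly_supported T (\<lambda>z. fst (\<eta> z :: complex \<times> complex))"
  "compactly_supported T \<eta> \<Longrightarrow> compactly_supported T (\<lambda>z. snd (\<eta> z))"
  unfolding compactly_supported_def by (metis fst_zero, metis snd_zero)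

lemma compactly_supported_frechet_derivative:
  assumes "open T" "compactly_supported T f"
  shows "compactly_supported T (\<lambda>z. frechet_derivative f (at z) v)"
proof -
  obtain K where K: "compact K" "K \<subseteq> T" "\<forall>z\<in>T - K. f z = 0"
    using assms(2) unfolding compactly_supported_def by blast
  have "open (T - K)" using assms(1) K(1) compact_imp_closed open_Diff by blast
  hence "frechet_derivative f (at z) v = 0" if "z \<in> T - K" for z
    using frechet_derivative_cong_open[of "T - K" f "\<lambda>_. 0" z] K(3) that by simp
  thus ?thesis unfolding compactly_supported_def using K by blast
qed

theorem stokes:
  assumes T: "open T" and "\<eta> \<in> E1c T"
  shows "(LINT z:T|lborel. d1 \<eta> z) = 0"
proof -
  let ?p = "\<lambda>z. fst (\<eta> z)" and ?q = "\<lambda>z. snd (\<eta> z)"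
  have s: "smooth_on T ?p" "smooth_on T ?q" and c: "compactly_supported T ?p" "compactly_supported T ?q"
    using assms(2) compactly_supported_fst_snd unfolding E1c_def E1_def by auto
  have i: "set_integrable lborel T (\<lambda>z. frechet_derivative f (at z) v)"
    if "smooth_on T f" "compactly_supported T f" for f v
    by (intro set_integrable_compactly_supported smooth_on_continuous[of T] smooth_on_frechet_derivative
        compactly_supported_frechet_derivative that T)
  show ?thesis unfolding d1_def dx_def dy_def
    by (subst set_integral_diff(2)[OF i[OF s(2) c(2)] i[OF s(1) c(1)]])
       (simp add: set_integral_directional_derivative_eq_0[OF T] s c)
qed

section \<open>Differentiation rules for functions and forms\<close>

lemma frechet_derivative_mult:
  assumes "smooth_on T f" "smooth_on T g" "z \<in> T"
  shows "frechet_derivative (\<lambda>z. f z * g z) (at z) v =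
    f z * frechet_derivative g (at z) v + frechet_derivative f (at z) v * g z"
  by (subst frechet_derivative_eqI[OF has_derivative_mult[OF
        smooth_on_has_derivative[OF assms(1,3)] smooth_on_has_derivative[OF assms(2,3)]]]) simp

lemma frechet_derivative_add:
  assumes "smooth_on T f" "smooth_on T g" "z \<in> T"
  shows "frechet_derivative (\<lambda>z. f z + g z) (at z) v =
    frechet_derivative f (at z) v + frechet_derivative g (at z) v"
  by (subst frechet_derivative_eqI[OF has_derivative_add[OF
        smooth_on_has_derivative[OF assms(1,3)] smooth_on_has_derivative[OF assms(2,3)]]]) simp

lemma frechet_derivative_diff:
  assumes "smooth_on T f" "smooth_on T g" "z \<in> T"
  shows "frechet_derivative (\<lambda>z. f z - g z) (at z) v =
    frechet_derivative f (at z) v - frechet_derivative g (at z) v"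
  by (subst frechet_derivative_eqI[OF has_derivative_diff[OF
        smooth_on_has_derivative[OF assms(1,3)] smooth_on_has_derivative[OF assms(2,3)]]]) simp

lemma frechet_derivative_sum:
  assumes "\<And>i. i \<in> I \<Longrightarrow> smooth_on T (f i)" "z \<in> T"
  shows "frechet_derivative (\<lambda>z. \<Sum>i\<in>I. f i z) (at z) v = (\<Sum>i\<in>I. frechet_derivative (f i) (at z) v)"
  by (subst frechet_derivative_eqI[OF has_derivative_sum[OF smooth_on_has_derivative[OF assms]]]) simp_all

lemma frechet_derivative_holomorphic:
  assumes "(f has_field_derivative f') (at z)"
  shows "frechet_derivative f (at z) v = f' * v"
  using frechet_derivative_eqI[of f "(*) f'" z] assms by (simp add: has_field_derivative_def)

lemma d0_holomorphic: "(f has_field_derivative f') (at z) \<Longrightarrow> d0 f z = (f', \<i> * f')"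
  by (simp add: d0_def dx_def dy_def frechet_derivative_holomorphic)

text \<open>Only the antiholomorphic derivative of h survives against dt; in particular the product
  vanishes where h is holomorphic.\<close>

lemma wedge_d0_fdt: "wedge (d0 h) (fdt f) z = \<i> * f z * (dx h z + \<i> * dy h z)"
  by (simp add: wedge_def d0_def fdt_def algebra_simps)

lemma d1_fmul:
  assumes "smooth_on T f" "\<eta> \<in> E1 T" "z \<in> T"
  shows "d1 (fmul f \<eta>) z = wedge (d0 f) \<eta> z + f z * d1 \<eta> z"
  using assms(2) unfolding E1_def d1_def dx_def dy_def fmul_def wedge_def d0_def
  by (simp add: frechet_derivative_mult[OF assms(1) _ assms(3)] algebra_simps)

lemma E1_d0: "smooth_on T f \<Longrightarrow> d0 f \<in> E1 T"
  by (simp add: E1_def d0_def dx_def dy_def smooth_on_frechet_derivative)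

lemma E1_fmul: "open T \<Longrightarrow> smooth_on T f \<Longrightarrow> \<eta> \<in> E1 T \<Longrightarrow> fmul f \<eta> \<in> E1 T"
  by (simp add: E1_def fmul_def smooth_on_mult)

section \<open>The residue pairing with a cutoff function\<close>

text \<open>A disc with squared radius s has area pi * s, so the squared distance to c pushes
  Lebesgue measure forward to pi ds on the half line s >= 0. The sign is reversed in
  \<open>?M\<close> because measures are compared on upper half lines, which have finite measure
  only after the reversal.\<close>

lemma integral_radial:
  fixes g :: "real \<Rightarrow> real"
  assumes [measurable]: "g \<in> borel_measurable borel"
  shows "(\<integral>z. g ((cmod (z - c))\<^sup>2) \<partial>lborel) = pi * (\<integral>s. indicator {0..} s * g s \<partial>lborel)"
proof -
  let ?M = "distr lborel borel (\<lambda>z. - (cmod (z - c))\<^sup>2)"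
  let ?N = "density lborel (\<lambda>s. ennreal (pi * indicator {..0} s))"
  have em: "emeasure ?M {x <..} = ennreal (pi * max 0 (- x))" for x
  proof -
    have "emeasure ?M {x <..} = emeasure lborel {z. x < - (cmod (z - c))\<^sup>2}"
      by (subst emeasure_distr) (auto simp: vimage_def)
    also have "{z. x < - (cmod (z - c))\<^sup>2} = (if x < 0 then ball c (sqrt (- x)) else {})"
    proof -
      have "x < - (cmod (z - c))\<^sup>2 \<longleftrightarrow> cmod (z - c) < sqrt (- x)" if "x < 0" for z
        using real_sqrt_less_iff[of "(cmod (z - c))\<^sup>2" "- x"] by auto
      moreover have "\<not> x < - (cmod (z - c))\<^sup>2" if "\<not> x < 0" for z
        using that zero_le_power2[of "cmod (z - c)"] by linarith
      ultimately show ?thesis by (auto simp: dist_norm norm_minus_commute)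
    qed
    also have "emeasure lborel \<dots> = ennreal (pi * max 0 (- x))"
      by (auto simp: emeasure_ball unit_ball_vol_2)
    finally show ?thesis .
  qed
  have "?M = ?N"
  proof (rule measure_eqI_lessThan)
    fix x :: real
    show "emeasure ?M {x <..} < \<infinity>" by (simp add: em)
    have "emeasure ?N {x <..} = (\<integral>\<^sup>+s. ennreal pi * indicator {x <.. 0} s \<partial>lborel)"
      by (subst emeasure_density) (auto intro!: nn_integral_cong simp: indicator_def)
    also have "\<dots> = ennreal pi * emeasure lborel {x <.. 0}"
      by (rule nn_integral_cmult_indicator) simp
    also have "emeasure lborel {x <.. 0} = ennreal (max 0 (- x))"
      by (cases "x \<le> 0") auto
    also have "ennreal pi * \<dots> = ennreal (pi * max 0 (- x))"
      by (simp add: ennreal_mult)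
    finally show "emeasure ?M {x <..} = emeasure ?N {x <..}" by (simp add: em)
  qed simp_all
  have "(\<integral>z. g ((cmod (z - c))\<^sup>2) \<partial>lborel) = (\<integral>s. g (- s) \<partial>?M)"
    by (subst integral_distr) auto
  also have "\<dots> = (\<integral>s. g (- s) \<partial>?N)" by (simp only: \<open>?M = ?N\<close>)
  also have "\<dots> = (\<integral>s. (pi * indicator {..0} s) *\<^sub>R g (- s) \<partial>lborel)"
    by (rule integral_density) auto
  also have "\<dots> = pi * (\<integral>s. indicator {..0} s * g (- s) \<partial>lborel)"
    by (simp add: mult.assoc)
  also have "(\<integral>s. indicator {..0} s * g (- s) \<partial>lborel) = (\<integral>s. indicator {0..} s * g s \<partial>lborel)"
    by (subst lborel_integral_real_affine[of "-1" _ 0])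
       (auto intro!: Bochner_Integration.integral_cong simp: indicator_def)
  finally show ?thesis .
qed

lemma smooth_step_has_derivative: "(smooth_step has_real_derivative deriv smooth_step s) (at s)"
  using smooth_step_deriv DERIV_imp_deriv by metis

lemma continuous_on_deriv_smooth_step: "continuous_on UNIV (deriv smooth_step)"
proof -
  obtain smooth_step' where *: "\<And>s. (smooth_step has_real_derivative smooth_step' s) (at s)" "continuous_on UNIV smooth_step'"
    using smooth_step_deriv by blast
  have "deriv smooth_step = smooth_step'" using DERIV_imp_deriv[OF *(1)] by auto
  thus ?thesis using *(2) by simp
qed

lemma deriv_smooth_step_eq_0: "s < 1 \<or> s > 2 \<Longrightarrow> deriv smooth_step s = 0"
proof (rule DERIV_imp_deriv)
  have *: "((\<lambda>_. k) has_real_derivative 0) (at s)" for k :: real by simp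
  assume "s < 1 \<or> s > 2"
  thus "(smooth_step has_real_derivative 0) (at s)"
  proof
    assume "s < 1"
    thus ?thesis
      using has_field_derivative_transform_within_open[OF *, of "{..<1}" 1 smooth_step] by (simp add: smooth_step_eq_1)
  next
    assume "s > 2"
    thus ?thesis
      using has_field_derivative_transform_within_open[OF *, of "{2<..}" 0 smooth_step] by (simp add: smooth_step_eq_0)
  qed
qed

lemma integral_deriv_smooth_step:
  assumes "r > 0"
  shows "(\<integral>z. deriv smooth_step ((cmod (z - c))\<^sup>2 / r\<^sup>2) \<partial>lborel) = - (pi * r\<^sup>2)"
proof -
  have dm: "deriv smooth_step \<in> borel_measurable borel"
    using continuous_on_deriv_smooth_step by (rule borel_measurable_continuous_onI)
  hence m: "(\<lambda>s. deriv smooth_step (s / r\<^sup>2)) \<in> borel_measurable borel" by measurable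
  \<comment> \<open>The integrand vanishes beyond 2 * r^2; the bound 3 * r^2 is one choice past that
    point, giving a compact interval for the fundamental theorem of calculus.\<close>
  have "(\<integral>s. indicator {0..} s * deriv smooth_step (s / r\<^sup>2) \<partial>lborel) =
        (\<integral>s. deriv smooth_step (s / r\<^sup>2) * indicator {0..3 * r\<^sup>2} s \<partial>lborel)"
  proof (rule Bochner_Integration.integral_cong)
    fix s
    have "deriv smooth_step (s / r\<^sup>2) = 0" if "s > 3 * r\<^sup>2"
      using that assms by (intro deriv_smooth_step_eq_0) (auto simp: field_simps)
    thus "indicator {0..} s * deriv smooth_step (s / r\<^sup>2) = deriv smooth_step (s / r\<^sup>2) * indicator {0..3 * r\<^sup>2} s"
      by (auto simp: indicator_def)
  qed simp
  also have "\<dots> = r\<^sup>2 * smooth_step (3 * r\<^sup>2 / r\<^sup>2) - r\<^sup>2 * smooth_step (0 / r\<^sup>2)"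
  proof (rule integral_FTC_Icc_real)
    fix s
    have "((\<lambda>s. s / r\<^sup>2) has_real_derivative 1 / r\<^sup>2) (at s)" by (rule DERIV_cdivide[OF DERIV_ident])
    from DERIV_cmult[OF DERIV_chain2[OF smooth_step_has_derivative this], of "r\<^sup>2"]
    show "((\<lambda>s. r\<^sup>2 * smooth_step (s / r\<^sup>2)) has_real_derivative deriv smooth_step (s / r\<^sup>2)) (at s)"
      by (rule DERIV_cong) (use assms in simp)
    have "isCont (deriv smooth_step) u" for u
      using continuous_on_deriv_smooth_step by (simp add: continuous_on_eq_continuous_at)
    thus "isCont (\<lambda>s. deriv smooth_step (s / r\<^sup>2)) s"
      by (intro isCont_o2[of s "\<lambda>s. s / r\<^sup>2" "deriv smooth_step"]) (use assms in auto)
  qed simp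
  also have "\<dots> = - (r\<^sup>2)" using assms by (simp add: smooth_step_eq_0 smooth_step_eq_1)
  finally show ?thesis using integral_radial[OF m, of c] by simp
qed

lemma cutoff_has_derivative:
  "(cutoff c r has_derivative
    (\<lambda>v. of_real (deriv smooth_step ((cmod (z - c))\<^sup>2 / r\<^sup>2) * (2 * ((z - c) \<bullet> v) / r\<^sup>2)))) (at z)"
proof -
  have "((\<lambda>z. (cmod (z - c))\<^sup>2 / r\<^sup>2) has_derivative (\<lambda>v. 2 * ((z - c) \<bullet> v) / r\<^sup>2)) (at z)"
    using bounded_linear.has_derivative[OF bounded_linear_divide cmod_power2_has_derivative] .
  from DERIV_compose_FDERIV[OF smooth_step_has_derivative this, THEN has_derivative_of_real]
  show ?thesis unfolding cutoff_def[abs_def] by (rule has_derivative_eq_rhs) (simp add: mult.commute)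
qed

text \<open>Applied to the squared distance, dx + i dy gives 2 (z - c): exactly the factor that
  cancels a simple pole at c.\<close>

lemma dbar_cutoff:
  "dx (cutoff c r) z + \<i> * dy (cutoff c r) z = of_real (2 * deriv smooth_step ((cmod (z - c))\<^sup>2 / r\<^sup>2) / r\<^sup>2) * (z - c)"
proof -
  have "of_real ((z - c) \<bullet> 1) + \<i> * of_real ((z - c) \<bullet> \<i>) = z - c"
    by (simp add: complex_eq_iff inner_complex_def)
  moreover have "dx (cutoff c r) z + \<i> * dy (cutoff c r) z =
     of_real (2 * deriv smooth_step ((cmod (z - c))\<^sup>2 / r\<^sup>2) / r\<^sup>2) * (of_real ((z - c) \<bullet> 1) + \<i> * of_real ((z - c) \<bullet> \<i>))"
    unfolding dx_def dy_def frechet_derivative_eqI[OF cutoff_has_derivative]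
    by (simp add: complex_eq_iff del: of_real_mult of_real_divide of_real_diff)
  ultimately show ?thesis by simp
qed

lemma d0_cutoff_eq_0:
  assumes "r > 0" "cmod (z - c) < r \<or> cmod (z - c) > 3/2 * r"
  shows "d0 (cutoff c r) z = 0"
proof -
  have *: "d0 (cutoff c r) z = 0" if "open S" "z \<in> S" "\<And>w. w \<in> S \<Longrightarrow> cutoff c r w = k" for S k
    using frechet_derivative_cong_open[of S "cutoff c r" "\<lambda>_. k" z] that
    by (simp add: d0_def dx_def dy_def zero_prod_def)
  from assms(2) show ?thesis
  proof
    assume "cmod (z - c) < r"
    thus ?thesis using assms(1)
      by (intro *[of "ball c r" 1]) (auto simp: dist_norm norm_minus_commute intro!: cutoff_eq_1)
  next
    assume "cmod (z - c) > 3/2 * r"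
    thus ?thesis using assms(1)
      by (intro *[of "- cball c (3/2 * r)" 0]) (auto simp: dist_norm norm_minus_commute intro!: cutoff_eq_0)
  qed
qed

text \<open>After cancellation of the pole the integrand is a constant times a radial function,
  whose integral is -(pi * r^2). The constant 2 i \<kappa> / r^2 then yields minus 2 pi i times the
  residue, for every radius.\<close>

lemma has_integral_cutoff_pole:
  assumes "r > 0"
  shows "has_bochner_integral lborel (\<lambda>z. wedge (d0 (cutoff c r)) (fdt (\<lambda>z. \<kappa> / (z - c))) z) (- 2 * pi * \<i> * \<kappa>)"
proof -
  let ?g = "\<lambda>z. deriv smooth_step ((cmod (z - c))\<^sup>2 / r\<^sup>2)"
  \<comment> \<open>At z = c the left side is 0 because of the factor z - c; the right side agrees
    since the step is constant near 0.\<close>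
  have eq: "wedge (d0 (cutoff c r)) (fdt (\<lambda>z. \<kappa> / (z - c))) z = (2 * \<i> * \<kappa> / r\<^sup>2) * of_real (?g z)" for z
    using deriv_smooth_step_eq_0[of 0] assms
    by (cases "z = c") (auto simp: wedge_d0_fdt dbar_cutoff field_simps)
  have cont: "continuous_on UNIV ?g"
    by (intro continuous_on_compose2[OF continuous_on_deriv_smooth_step] continuous_intros) (use assms in auto)
  have "?g z = 0" if "z \<notin> cball c (2 * r)" for z
  proof -
    have "(2 * r)\<^sup>2 < (cmod (z - c))\<^sup>2"
      using that assms by (intro power_strict_mono) (auto simp: dist_norm norm_minus_commute)
    hence "4 * r\<^sup>2 < (cmod (z - c))\<^sup>2" by (simp add: power_mult_distrib)
    moreover have "r\<^sup>2 > 0" using assms by simp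
    ultimately have "2 * r\<^sup>2 < (cmod (z - c))\<^sup>2" by linarith
    thus ?thesis using assms by (intro deriv_smooth_step_eq_0) (simp add: field_simps)
  qed
  hence "(\<lambda>z. indicator (cball c (2 * r)) z *\<^sub>R ?g z) = ?g" by (auto simp: fun_eq_iff indicator_def)
  hence "integrable lborel ?g"
    using borel_integrable_compact[OF compact_cball continuous_on_subset[OF cont], of c "2 * r"] by simp
  hence "has_bochner_integral lborel ?g (- (pi * r\<^sup>2))"
    using integral_deriv_smooth_step[OF assms, of c] by (simp add: has_bochner_integral_iff)
  hence "has_bochner_integral lborel (\<lambda>z. complex_of_real (?g z)) (of_real (- (pi * r\<^sup>2)))"
    by (rule has_bochner_integral_of_real)
  from has_bochner_integral_mult_right[OF this, of "2 * \<i> * \<kappa> / r\<^sup>2"] show ?thesis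
    unfolding eq using assms by (simp add: field_simps)
qed

text \<open>If \<open>f = m'\<close>, the form \<open>d\<chi> \<and> f dt = d\<chi> \<and> dm = - d(m d\<chi>)\<close> is the differential of a form
  supported in the annulus where the cutoff \<open>\<chi>\<close> is not constant.\<close>

lemma has_integral_cutoff:
  assumes r: "r > 0" and U: "open U" "{z. r \<le> cmod (z - c) \<and> cmod (z - c) \<le> 3/2 * r} \<subseteq> U"
    and m: "\<And>z. z \<in> U \<Longrightarrow> (m has_field_derivative f z - \<kappa> / (z - c)) (at z)"
  shows "has_bochner_integral lborel (\<lambda>z. wedge (d0 (cutoff c r)) (fdt f) z) (- 2 * pi * \<i> * \<kappa>)"
proof -
  let ?A = "{z. r \<le> cmod (z - c) \<and> cmod (z - c) \<le> 3/2 * r}"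
  let ?h = "cutoff c r" and ?g = "\<lambda>z. f z - \<kappa> / (z - c)"
  have "?A = cball c (3/2 * r) - ball c r" by (auto simp: dist_norm norm_minus_commute)
  hence A: "compact ?A" by (simp add: compact_diff)
  have hA: "d0 ?h z = 0" if "z \<notin> ?A" for z using that by (intro d0_cutoff_eq_0 r) auto
  have mU: "smooth_on U m"
    using m by (intro smooth_on_holomorphic U) (auto simp: holomorphic_on_open[OF U(1)])
  have hU: "smooth_on U ?h" by (rule smooth_on_cutoff[OF U(1)])
  have "\<forall>z\<in>U - ?A. fmul m (d0 ?h) z = 0"
  proof
    fix z assume "z \<in> U - ?A"
    hence "d0 ?h z = 0" using hA by blast
    thus "fmul m (d0 ?h) z = 0" by (simp add: fmul_def zero_prod_def)
  qed
  hence "compactly_supported U (fmul m (d0 ?h))"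
    unfolding compactly_supported_def using A U(2) by blast
  hence E: "fmul m (d0 ?h) \<in> E1c U"
    unfolding E1c_def by (simp add: E1_fmul E1_d0 U mU hU)
  have d: "d1 (fmul m (d0 ?h)) z = - wedge (d0 ?h) (fdt ?g) z" if z: "z \<in> U" for z
    unfolding d1_fmul[OF mU E1_d0[OF hU] z] d1_d0_eq_0[OF U(1) hU z]
    by (simp add: wedge_def d0_holomorphic[OF m[OF z]] fdt_def algebra_simps)
  have w: "indicator U z *\<^sub>R d1 (fmul m (d0 ?h)) z = - wedge (d0 ?h) (fdt ?g) z" for z
  proof (cases "z \<in> U")
    case False
    hence "d0 ?h z = 0" using U(2) by (intro hA) blast
    thus ?thesis using False by (simp add: wedge_def)
  qed (simp add: d)
  have "set_integrable lborel U (d1 (fmul m (d0 ?h)))"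
  proof (rule set_integrable_compactly_supported)
    show "continuous_on U (d1 (fmul m (d0 ?h)))"
      unfolding d1_def[abs_def] dx_def dy_def using E unfolding E1c_def E1_def
      by (intro continuous_on_diff smooth_on_continuous[OF smooth_on_frechet_derivative]) auto
    show "compactly_supported U (d1 (fmul m (d0 ?h)))"
      unfolding compactly_supported_def using d hA A U(2)
      by (intro exI[of _ ?A]) (auto simp: wedge_def)
  qed
  with stokes[OF U(1) E]
  have "has_bochner_integral lborel (\<lambda>z. - wedge (d0 ?h) (fdt ?g) z) 0"
    unfolding set_integrable_def set_lebesgue_integral_def w by (simp add: has_bochner_integral_iff)
  from has_bochner_integral_diff[OF has_integral_cutoff_pole[OF r, of c \<kappa>] this]
  show ?thesis by (simp add: wedge_d0_fdt algebra_simps)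
qed

section \<open>Local solutions and monodromy\<close>

text \<open>On power series s d/ds + \<beta> acts diagonally, multiplying the n-th coefficient by
  \<beta> + n. These numbers are nonzero and tend to infinity, so their inverses are bounded and
  dividing by them does not shrink the disc of convergence.\<close>

lemma euler_operator_solvable:
  assumes g: "g holomorphic_on ball 0 \<rho>" and r: "\<rho> > 0" and \<beta>: "\<And>n. \<beta> + of_nat n \<noteq> (0 :: complex)"
  obtains H where "H holomorphic_on ball 0 \<rho>" "\<And>s. s \<in> ball 0 \<rho> \<Longrightarrow> s * deriv H s + \<beta> * H s = g s"
proof -
  define G where "G = fps_expansion g 0"
  have cG: "fps_conv_radius G \<ge> ereal \<rho>" and evG: "\<And>z. z \<in> ball 0 \<rho> \<Longrightarrow> eval_fps G z = g z"
    unfolding G_def using conv_radius_fps_expansion[of g 0 "ereal \<rho>"] eval_fps_expansion[of g 0 "ereal \<rho>"] g by auto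
  define F where "F = Abs_fps (\<lambda>n. fps_nth G n / (\<beta> + of_nat n))"
  have "filterlim (\<lambda>n. \<beta> + of_nat n) at_infinity sequentially"
    by (rule tendsto_add_filterlim_at_infinity[OF tendsto_const tendsto_of_nat])
  hence "(\<lambda>n. inverse (\<beta> + of_nat n)) \<longlonglongrightarrow> 0" by (rule tendsto_inverse_0[THEN filterlim_compose])
  hence "Bseq (\<lambda>n. inverse (\<beta> + of_nat n))" by (intro convergent_imp_Bseq convergentI)
  then obtain C where C: "C > 0" "\<And>n. cmod (inverse (\<beta> + of_nat n)) \<le> C" by (auto elim: BseqE)
  have cF: "fps_conv_radius F \<ge> ereal \<rho>"
    unfolding fps_conv_radius_def
  proof (rule conv_radius_geI_ex)
    fix t :: real assume t: "0 < t" "ereal t < ereal \<rho>"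
    have "summable (\<lambda>n. norm (fps_nth G n * of_real t ^ n))"
      using less_le_trans[OF t(2) cG] t(1)
      by (intro abs_summable_in_conv_radius) (simp add: fps_conv_radius_def)
    hence "summable (\<lambda>n. C * norm (fps_nth G n * of_real t ^ n))" by (rule summable_mult)
    hence "summable (\<lambda>n. fps_nth F n * of_real t ^ n)"
    proof (rule summable_comparison_test'[where N = 0])
      fix n
      have "norm (fps_nth F n * of_real t ^ n) = cmod (inverse (\<beta> + of_nat n)) * norm (fps_nth G n * of_real t ^ n)"
        by (simp add: F_def norm_mult norm_divide norm_inverse divide_inverse mult_ac)
      also have "\<dots> \<le> C * norm (fps_nth G n * of_real t ^ n)" by (intro mult_right_mono C) auto
      finally show "norm (fps_nth F n * of_real t ^ n) \<le> C * norm (fps_nth G n * of_real t ^ n)" .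
    qed
    thus "\<exists>z. norm z = t \<and> summable (\<lambda>n. fps_nth F n * z ^ n)"
      using t by (intro exI[of _ "of_real t"]) auto
  qed
  have FG: "fps_X * fps_deriv F + fps_const \<beta> * F = G"
  proof (rule fps_ext)
    fix n
    have "fps_nth (fps_X * fps_deriv F + fps_const \<beta> * F) n = (\<beta> + of_nat n) * fps_nth F n"
      by (cases n) (simp_all add: algebra_simps)
    also have "\<dots> = fps_nth G n" using \<beta>[of n] by (simp add: F_def)
    finally show "fps_nth (fps_X * fps_deriv F + fps_const \<beta> * F) n = fps_nth G n" .
  qed
  show ?thesis
  proof (rule that[of "eval_fps F"])
    show "eval_fps F holomorphic_on ball 0 \<rho>"
      using less_le_trans[OF _ cF] by (intro holomorphic_on_eval_fps) (auto simp: eball_def)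
    fix s :: complex assume s: "s \<in> ball 0 \<rho>"
    have sF: "ereal (norm s) < fps_conv_radius F" using s less_le_trans[OF _ cF] by simp
    have sF': "ereal (norm s) < fps_conv_radius (fps_deriv F)"
      using fps_conv_radius_deriv[of F] sF by (rule less_le_trans[rotated])
    have 1: "ereal (norm s) < fps_conv_radius (fps_X * fps_deriv F)"
      using fps_conv_radius_mult[of fps_X "fps_deriv F"] sF' by (auto intro: less_le_trans)
    have 2: "ereal (norm s) < fps_conv_radius (fps_const \<beta> * F)"
      using fps_conv_radius_mult[of "fps_const \<beta>" F] sF by (auto intro: less_le_trans)
    have "eval_fps G s = s * deriv (eval_fps F) s + \<beta> * eval_fps F s"
      unfolding FG[symmetric] using 1 2 sF sF'
      by (simp add: eval_fps_add eval_fps_mult eval_fps_deriv)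
    thus "s * deriv (eval_fps F) s + \<beta> * eval_fps F s = g s" using evG[OF s] by simp
  qed
qed

text \<open>With V a primitive of v, the integrating factor exp V absorbs the holomorphic part of
  the coefficient and leaves the Euler operator with right-hand side exp(V) * g.\<close>

lemma singular_ode_solvable:
  assumes g: "g holomorphic_on ball 0 \<rho>" and v: "v holomorphic_on ball 0 \<rho>" and r: "\<rho> > 0"
    and \<beta>: "\<And>n. \<beta> + of_nat n \<noteq> (0 :: complex)"
  obtains H where "H holomorphic_on ball 0 \<rho>"
    "\<And>s. s \<in> ball 0 \<rho> \<Longrightarrow> s * deriv H s + (\<beta> + s * v s) * H s = g s"
proof -
  obtain V where V: "\<And>s. s \<in> ball 0 \<rho> \<Longrightarrow> (V has_field_derivative v s) (at s)"
    using holomorphic_convex_primitive'[OF convex_ball open_ball v] at_within_open[OF _ open_ball] by metis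
  hence hV: "V holomorphic_on ball 0 \<rho>" unfolding holomorphic_on_open[OF open_ball] by blast
  obtain G where G: "G holomorphic_on ball 0 \<rho>"
    "\<And>s. s \<in> ball 0 \<rho> \<Longrightarrow> s * deriv G s + \<beta> * G s = exp (V s) * g s"
    using euler_operator_solvable[OF _ r \<beta>, of "\<lambda>s. exp (V s) * g s"] holomorphic_on_mult[OF holomorphic_on_exp'[OF hV] g]
    by blast
  show ?thesis
  proof (rule that[of "\<lambda>s. exp (- V s) * G s"])
    show "(\<lambda>s. exp (- V s) * G s) holomorphic_on ball 0 \<rho>" by (intro holomorphic_intros hV G)
    fix s :: complex assume s: "s \<in> ball 0 \<rho>"
    have "((\<lambda>s. exp (- V s) * G s) has_field_derivative
        exp (- V s) * (deriv G s - v s * G s)) (at s)"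
      using V[OF s] holomorphic_derivI[OF G(1) open_ball s]
      by (auto intro!: derivative_eq_intros simp: algebra_simps)
    hence "s * deriv (\<lambda>s. exp (- V s) * G s) s + (\<beta> + s * v s) * (exp (- V s) * G s) =
        exp (- V s) * (s * deriv G s + \<beta> * G s)"
      by (simp add: DERIV_imp_deriv algebra_simps)
    also have "\<dots> = g s" using G(2)[OF s] by (simp add: exp_minus)
    finally show "s * deriv (\<lambda>s. exp (- V s) * G s) s + (\<beta> + s * v s) * (exp (- V s) * G s) = g s" .
  qed
qed

text \<open>A flat section transported around the circle picks up the factor \<open>exp (- 2 \<pi> \<i> \<beta>) \<noteq> 1\<close>.\<close>

lemma flat_section_eq_0:
  assumes f: "\<And>z. cmod (z - c) = cmod (z0 - c) \<Longrightarrow> (f has_derivative (\<lambda>v. - (f z * w z) * v)) (at z)"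
    and W: "\<And>z. cmod (z - c) = cmod (z0 - c) \<Longrightarrow> (W has_field_derivative w z - \<beta> / (z - c)) (at z)"
    and "\<beta> \<notin> \<int>" "z0 \<noteq> c"
  shows "f z0 = 0"
proof -
  define \<gamma> where "\<gamma> \<theta> = c + (z0 - c) * exp (\<i> * of_real \<theta>)" for \<theta> :: real
  have nrm: "cmod (\<gamma> \<theta> - c) = cmod (z0 - c)" for \<theta> by (simp add: \<gamma>_def norm_mult)
  have d\<gamma>: "(\<gamma> has_vector_derivative \<i> * (\<gamma> \<theta> - c)) (at \<theta>)" for \<theta>
    unfolding \<gamma>_def[abs_def]
    by (rule has_vector_derivative_real_field) (auto intro!: derivative_eq_intros)
  \<comment> \<open>f times the exponential of a primitive of w dt along the circle:
    \<open>W\<close> is its single-valued part and i \<beta> \<theta> follows the branch of \<beta>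
    log(z - c). Flatness makes the product constant.\<close>
  define \<phi> where "\<phi> \<theta> = f (\<gamma> \<theta>) * exp (\<i> * \<beta> * of_real \<theta> + W (\<gamma> \<theta>))" for \<theta>
  have "(\<phi> has_vector_derivative 0) (at \<theta>)" for \<theta>
  proof -
    have ne: "\<gamma> \<theta> - c \<noteq> 0" using nrm[of \<theta>] assms(4) by auto
    have fd: "(f has_derivative (\<lambda>v. - (f (\<gamma> \<theta>) * w (\<gamma> \<theta>)) * v)) (at (\<gamma> \<theta>) within range \<gamma>)"
      using f[OF nrm] has_derivative_at_withinI by blast
    have 1: "((\<lambda>\<theta>. f (\<gamma> \<theta>)) has_vector_derivative - (f (\<gamma> \<theta>) * w (\<gamma> \<theta>)) * (\<i> * (\<gamma> \<theta> - c))) (at \<theta>)"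
      using vector_derivative_diff_chain_within[OF d\<gamma> fd] by (simp add: o_def)
    have "((\<lambda>\<theta>. W (\<gamma> \<theta>)) has_vector_derivative (\<i> * (\<gamma> \<theta> - c)) * (w (\<gamma> \<theta>) - \<beta> / (\<gamma> \<theta> - c))) (at \<theta>)"
      using field_vector_diff_chain_at[OF d\<gamma> W[OF nrm]] by (simp add: o_def)
    moreover have "((\<lambda>\<theta>. \<i> * \<beta> * of_real \<theta>) has_vector_derivative \<i> * \<beta>) (at \<theta>)"
      by (rule has_vector_derivative_real_field) (auto intro!: derivative_eq_intros)
    ultimately have 2: "((\<lambda>\<theta>. \<i> * \<beta> * of_real \<theta> + W (\<gamma> \<theta>)) has_vector_derivative
        \<i> * \<beta> + (\<i> * (\<gamma> \<theta> - c)) * (w (\<gamma> \<theta>) - \<beta> / (\<gamma> \<theta> - c))) (at \<theta>)"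
      by (intro has_vector_derivative_add)
    have "\<i> * \<beta> + (\<i> * (\<gamma> \<theta> - c)) * (w (\<gamma> \<theta>) - \<beta> / (\<gamma> \<theta> - c)) = w (\<gamma> \<theta>) * (\<i> * (\<gamma> \<theta> - c))"
      using ne by (simp add: field_simps)
    with field_vector_diff_chain_at[OF 2 DERIV_exp]
    have 3: "((\<lambda>\<theta>. exp (\<i> * \<beta> * of_real \<theta> + W (\<gamma> \<theta>))) has_vector_derivative
       (w (\<gamma> \<theta>) * (\<i> * (\<gamma> \<theta> - c))) * exp (\<i> * \<beta> * of_real \<theta> + W (\<gamma> \<theta>))) (at \<theta>)"
      by (simp add: o_def)
    show ?thesis unfolding \<phi>_def[abs_def]
      using has_vector_derivative_mult[OF 1 3] by (simp add: algebra_simps)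
  qed
  hence "norm (\<phi> (2 * pi) - \<phi> 0) \<le> 0 * (2 * pi)"
    by (intro norm_diff_le_of_vector_derivative[where g' = "\<lambda>_. 0"]) auto
  hence "\<phi> (2 * pi) = \<phi> 0" by simp
  moreover have "\<gamma> (2 * pi) = z0" "\<gamma> 0 = z0"
    using exp_two_pi_i by (simp_all add: \<gamma>_def mult_ac)
  ultimately have "f z0 = 0 \<or> exp (\<i> * \<beta> * of_real (2 * pi)) = 1"
    by (simp add: \<phi>_def exp_add)
  moreover have "exp (\<i> * \<beta> * of_real (2 * pi)) \<noteq> 1"
  proof
    assume "exp (\<i> * \<beta> * of_real (2 * pi)) = 1"
    then obtain n :: int where n: "Im \<beta> = 0" "Re \<beta> * (2 * pi) = of_int (2 * n) * pi"
      by (auto simp: exp_eq_1)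
    hence "\<beta> = of_int n" by (simp add: complex_eq_iff)
    thus False using assms(3) by simp
  qed
  ultimately show ?thesis by blast
qed

section \<open>The intersection pairing\<close>

lemma compactly_supported_add:
  fixes f g :: "complex \<Rightarrow> 'b::ab_group_add"
  assumes "compactly_supported T f" "compactly_supported T g"
  shows "compactly_supported T (\<lambda>z. f z + g z)"
proof -
  obtain K L where "compact K" "K \<subseteq> T" "\<forall>z\<in>T - K. f z = 0" "compact L" "L \<subseteq> T" "\<forall>z\<in>T - L. g z = 0"
    using assms unfolding compactly_supported_def by blast
  thus ?thesis unfolding compactly_supported_def
    by (intro exI[of _ "K \<union> L"]) auto
qed

lemma compactly_supported_minus:
  fixes f :: "complex \<Rightarrow> 'b::ab_group_add"
  shows "compactly_supported T f \<Longrightarrow> compactly_supported T (\<lambda>z. - f z)"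
  unfolding compactly_supported_def by auto

lemma E0c_iff: "f \<in> E0c T \<longleftrightarrow> smooth_on T f \<and> compactly_supported T f"
  by (simp add: E0c_def E0_def)

lemma zero_in_E0c: "open T \<Longrightarrow> (\<lambda>_. 0) \<in> E0c T"
  unfolding E0c_iff compactly_supported_def by (auto intro!: smooth_on_const)

lemma add_in_E0c: "open T \<Longrightarrow> f \<in> E0c T \<Longrightarrow> g \<in> E0c T \<Longrightarrow> (\<lambda>z. f z + g z) \<in> E0c T"
  unfolding E0c_iff by (auto intro: smooth_on_add compactly_supported_add)

lemma minus_in_E0c: "open T \<Longrightarrow> f \<in> E0c T \<Longrightarrow> (\<lambda>z. - f z) \<in> E0c T"
  unfolding E0c_iff by (auto intro: smooth_on_minus compactly_supported_minus)

lemma nabla0_add: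
  assumes "smooth_on T f" "smooth_on T g" "z \<in> T"
  shows "nabla0 \<omega> (\<lambda>z. f z + g z) z = nabla0 \<omega> f z + nabla0 \<omega> g z"
  by (simp add: nabla0_def d0_def dx_def dy_def fmul_def frechet_derivative_add[OF assms] algebra_simps)

lemma nabla0_zero: "nabla0 \<omega> (\<lambda>_. 0) z = 0"
  by (simp add: nabla0_def d0_def dx_def dy_def fmul_def zero_prod_def)

lemma nabla0_minus:
  assumes "open T" "smooth_on T f" "z \<in> T"
  shows "nabla0 \<omega> (\<lambda>z. - f z) z = - nabla0 \<omega> f z"
  using nabla0_add[OF assms(2) smooth_on_minus[OF assms(1,2)] assms(3), of \<omega>]
  by (simp add: nabla0_zero eq_neg_iff_add_eq_0 add.commute)

section \<open>Cohomology classes and independence of representatives\<close>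

lemma equiv_cohom:
  assumes T: "open T"
  shows "equiv (Z1 T \<omega>) (cohom T \<omega>)"
proof (rule equivI)
  show "cohom T \<omega> \<subseteq> Z1 T \<omega> \<times> Z1 T \<omega>" by (auto simp: cohom_def)
  show "refl_on (Z1 T \<omega>) (cohom T \<omega>)"
    using smooth_on_const[OF T, of 0] by (auto simp: refl_on_def cohom_def E0_def nabla0_zero intro!: bexI[of _ "\<lambda>_. 0"])
  show "sym (cohom T \<omega>)"
  proof (rule symI)
    fix \<eta> \<xi> assume "(\<eta>, \<xi>) \<in> cohom T \<omega>"
    then obtain f where *: "\<eta> \<in> Z1 T \<omega>" "\<xi> \<in> Z1 T \<omega>" "smooth_on T f" "\<forall>z\<in>T. \<eta> z - \<xi> z = nabla0 \<omega> f z"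
      by (auto simp: cohom_def E0_def)
    have "\<forall>z\<in>T. \<xi> z - \<eta> z = nabla0 \<omega> (\<lambda>z. - f z) z"
      using *(4) nabla0_minus[OF T *(3)] by (metis minus_diff_eq)
    thus "(\<xi>, \<eta>) \<in> cohom T \<omega>" using * smooth_on_minus[OF T] by (auto simp: cohom_def E0_def)
  qed
  show "trans (cohom T \<omega>)"
  proof (rule transI)
    fix \<eta> \<xi> \<zeta> assume "(\<eta>, \<xi>) \<in> cohom T \<omega>" "(\<xi>, \<zeta>) \<in> cohom T \<omega>"
    then obtain f g where *: "\<eta> \<in> Z1 T \<omega>" "\<zeta> \<in> Z1 T \<omega>" "smooth_on T f" "smooth_on T g"
      "\<forall>z\<in>T. \<eta> z - \<xi> z = nabla0 \<omega> f z" "\<forall>z\<in>T. \<xi> z - \<zeta> z = nabla0 \<omega> g z"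
      by (auto simp: cohom_def E0_def)
    have "\<forall>z\<in>T. \<eta> z - \<zeta> z = nabla0 \<omega> (\<lambda>z. f z + g z) z"
    proof
      fix z assume z: "z \<in> T"
      have "\<eta> z - \<zeta> z = nabla0 \<omega> f z + nabla0 \<omega> g z" using bspec[OF *(5) z, symmetric] bspec[OF *(6) z, symmetric] by simp
      thus "\<eta> z - \<zeta> z = nabla0 \<omega> (\<lambda>z. f z + g z) z"
        using nabla0_add[OF *(3,4) z] by simp
    qed
    thus "(\<eta>, \<zeta>) \<in> cohom T \<omega>" using * smooth_on_add[OF T *(3,4)] by (auto simp: cohom_def E0_def)
  qed
qed

lemma equiv_cohomc:
  assumes T: "open T"
  shows "equiv (Z1c T \<omega>) (cohomc T \<omega>)"
proof (rule equivI)
  show "cohomc T \<omega> \<subseteq> Z1c T \<omega> \<times> Z1c T \<omega>" by (auto simp: cohomc_def)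
  show "refl_on (Z1c T \<omega>) (cohomc T \<omega>)"
    using zero_in_E0c[OF T] by (auto simp: refl_on_def cohomc_def nabla0_zero intro!: bexI[of _ "\<lambda>_. 0"])
  show "sym (cohomc T \<omega>)"
  proof (rule symI)
    fix \<eta> \<xi> assume "(\<eta>, \<xi>) \<in> cohomc T \<omega>"
    then obtain f where *: "\<eta> \<in> Z1c T \<omega>" "\<xi> \<in> Z1c T \<omega>" "f \<in> E0c T" "\<forall>z\<in>T. \<eta> z - \<xi> z = nabla0 \<omega> f z"
      by (auto simp: cohomc_def)
    have "\<forall>z\<in>T. \<xi> z - \<eta> z = nabla0 \<omega> (\<lambda>z. - f z) z"
      using *(3,4) nabla0_minus[OF T] unfolding E0c_iff by (metis minus_diff_eq)
    thus "(\<xi>, \<eta>) \<in> cohomc T \<omega>" using * minus_in_E0c[OF T *(3)] by (auto simp: cohomc_def)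
  qed
  show "trans (cohomc T \<omega>)"
  proof (rule transI)
    fix \<eta> \<xi> \<zeta> assume "(\<eta>, \<xi>) \<in> cohomc T \<omega>" "(\<xi>, \<zeta>) \<in> cohomc T \<omega>"
    then obtain f g where *: "\<eta> \<in> Z1c T \<omega>" "\<zeta> \<in> Z1c T \<omega>" "f \<in> E0c T" "g \<in> E0c T"
      "\<forall>z\<in>T. \<eta> z - \<xi> z = nabla0 \<omega> f z" "\<forall>z\<in>T. \<xi> z - \<zeta> z = nabla0 \<omega> g z"
      by (auto simp: cohomc_def)
    have "\<forall>z\<in>T. \<eta> z - \<zeta> z = nabla0 \<omega> (\<lambda>z. f z + g z) z"
    proof
      fix z assume z: "z \<in> T"
      have "\<eta> z - \<zeta> z = nabla0 \<omega> f z + nabla0 \<omega> g z" using bspec[OF *(5) z, symmetric] bspec[OF *(6) z, symmetric] by simp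
      thus "\<eta> z - \<zeta> z = nabla0 \<omega> (\<lambda>z. f z + g z) z"
        using *(3,4) nabla0_add[OF _ _ z] by (simp add: E0c_iff)
    qed
    thus "(\<eta>, \<zeta>) \<in> cohomc T \<omega>" using * add_in_E0c[OF T *(3,4)] by (auto simp: cohomc_def)
  qed
qed

lemma cohomc_imp_cohom: "(\<eta>, \<xi>) \<in> cohomc T \<omega> \<Longrightarrow> (\<eta>, \<xi>) \<in> cohom T \<omega>"
  unfolding cohomc_def cohom_def Z1c_def Z1_def E1c_def E0c_def by auto

lemma smooth_on_wedge: "open T \<Longrightarrow> \<eta> \<in> E1 T \<Longrightarrow> \<xi> \<in> E1 T \<Longrightarrow> smooth_on T (wedge \<eta> \<xi>)"
  unfolding wedge_def[abs_def] E1_def by (auto intro!: smooth_on_diff smooth_on_mult)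

lemma set_integrable_wedge:
  assumes "open T" "\<eta> \<in> E1c T" "\<xi> \<in> E1 T"
  shows "set_integrable lborel T (wedge \<eta> \<xi>)" "set_integrable lborel T (wedge \<xi> \<eta>)"
proof -
  have e: "\<eta> \<in> E1 T" and "compactly_supported T \<eta>" using assms(2) by (auto simp: E1c_def)
  hence "compactly_supported T (wedge \<eta> \<xi>)" "compactly_supported T (wedge \<xi> \<eta>)"
    unfolding compactly_supported_def wedge_def by (metis fst_zero snd_zero mult_zero_left mult_zero_right diff_self)+
  thus "set_integrable lborel T (wedge \<eta> \<xi>)" "set_integrable lborel T (wedge \<xi> \<eta>)"
    using smooth_on_continuous[OF smooth_on_wedge] assms e by (auto intro!: set_integrable_compactly_supported)
qed

lemma E1c_fmul:
  assumes "open T" "smooth_on T f" "\<eta> \<in> E1 T" "compactly_supported T f \<or> compactly_supported T \<eta>"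
  shows "fmul f \<eta> \<in> E1c T"
proof -
  have "compactly_supported T (fmul f \<eta>)"
    using assms(4) unfolding compactly_supported_def fmul_def
    by (metis fst_zero snd_zero mult_zero_left mult_zero_right zero_prod_def)
  thus ?thesis using E1_fmul[OF assms(1-3)] by (simp add: E1c_def)
qed

lemma integral_wedge_nabla0_left:
  assumes T: "open T" and f: "f \<in> E0c T" and \<xi>: "\<xi> \<in> Z1 T (\<lambda>z. - \<omega> z)"
  shows "(LINT z:T|lborel. wedge (nabla0 \<omega> f) \<xi> z) = 0"
proof -
  have fs: "smooth_on T f" "compactly_supported T f" and x: "\<xi> \<in> E1 T" using f \<xi> by (auto simp: E0c_iff Z1_def)
  have "(LINT z:T|lborel. wedge (nabla0 \<omega> f) \<xi> z) = (LINT z:T|lborel. d1 (fmul f \<xi>) z)"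
  proof (intro set_lebesgue_integral_cong allI impI)
    fix z assume z: "z \<in> T"
    have "nabla1 (\<lambda>z. - \<omega> z) \<xi> z = 0" using \<xi> z by (auto simp: Z1_def)
    hence d: "d1 \<xi> z = wedge \<omega> \<xi> z"
      unfolding nabla1_def wedge_def by (simp add: add_eq_0_iff2)
    show "wedge (nabla0 \<omega> f) \<xi> z = d1 (fmul f \<xi>) z"
      unfolding d1_fmul[OF fs(1) x z] d by (simp add: nabla0_def wedge_def fmul_def algebra_simps)
  qed (use T in auto)
  also have "\<dots> = 0" using fs x by (intro stokes T E1c_fmul) auto
  finally show ?thesis .
qed

text \<open>Here the integrand is -d(g \<eta>), and the compact support comes from \<eta> while g is
  an arbitrary smooth function.\<close>

lemma integral_wedge_nabla0_right:
  assumes T: "open T" and \<eta>: "\<eta> \<in> Z1c T \<omega>" and g: "smooth_on T g"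
  shows "(LINT z:T|lborel. wedge \<eta> (nabla0 (\<lambda>z. - \<omega> z) g) z) = 0"
proof -
  have e: "\<eta> \<in> E1 T" "compactly_supported T \<eta>" using \<eta> by (auto simp: Z1c_def E1c_def)
  have "(LINT z:T|lborel. wedge \<eta> (nabla0 (\<lambda>z. - \<omega> z) g) z) = (LINT z:T|lborel. - d1 (fmul g \<eta>) z)"
  proof (intro set_lebesgue_integral_cong allI impI)
    fix z assume z: "z \<in> T"
    have d: "d1 \<eta> z = - wedge \<omega> \<eta> z" using \<eta> z by (auto simp: Z1c_def nabla1_def eq_neg_iff_add_eq_0)
    show "wedge \<eta> (nabla0 (\<lambda>z. - \<omega> z) g) z = - d1 (fmul g \<eta>) z"
      unfolding d1_fmul[OF g e(1) z] d by (simp add: nabla0_def wedge_def fmul_def algebra_simps)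
  qed (use T in auto)
  also have "\<dots> = - (LINT z:T|lborel. d1 (fmul g \<eta>) z)" unfolding set_lebesgue_integral_def by simp
  also have "\<dots> = 0" using e g by (subst stokes[OF T E1c_fmul]) (auto simp: T)
  finally show ?thesis .
qed

lemma integral_wedge_cong:
  assumes T: "open T" and \<omega>: "\<omega> \<in> E1 T"
    and \<eta>: "(\<eta>, \<eta>') \<in> cohomc T \<omega>" and \<xi>: "(\<xi>, \<xi>') \<in> cohom T (\<lambda>z. - \<omega> z)"
  shows "(LINT z:T|lborel. wedge \<eta> \<xi> z) = (LINT z:T|lborel. wedge \<eta>' \<xi>' z)"
proof -
  obtain f where f: "f \<in> E0c T" "\<And>z. z \<in> T \<Longrightarrow> \<eta> z - \<eta>' z = nabla0 \<omega> f z" and Z: "\<eta> \<in> Z1c T \<omega>" "\<eta>' \<in> Z1c T \<omega>"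
    using \<eta> by (auto simp: cohomc_def)
  obtain g where g: "smooth_on T g" "\<And>z. z \<in> T \<Longrightarrow> \<xi> z - \<xi>' z = nabla0 (\<lambda>z. - \<omega> z) g z"
    and Z': "\<xi> \<in> Z1 T (\<lambda>z. - \<omega> z)" "\<xi>' \<in> Z1 T (\<lambda>z. - \<omega> z)"
    using \<xi> by (auto simp: cohom_def E0_def)
  have i: "set_integrable lborel T (wedge e x)" if "e \<in> Z1c T \<omega>" "x \<in> Z1 T (\<lambda>z. - \<omega> z)" for e x
    using that set_integrable_wedge(1)[OF T] by (auto simp: Z1c_def Z1_def)
  have "(LINT z:T|lborel. wedge \<eta> \<xi> z) - (LINT z:T|lborel. wedge \<eta>' \<xi> z) =
        (LINT z:T|lborel. wedge (nabla0 \<omega> f) \<xi> z)"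
    unfolding set_integral_diff(2)[OF i i, OF Z(1) Z'(1) Z(2) Z'(1), symmetric]
    using T by (intro set_lebesgue_integral_cong) (auto simp: f(2)[symmetric] wedge_def algebra_simps)
  moreover have "(LINT z:T|lborel. wedge \<eta>' \<xi> z) - (LINT z:T|lborel. wedge \<eta>' \<xi>' z) =
        (LINT z:T|lborel. wedge \<eta>' (nabla0 (\<lambda>z. - \<omega> z) g) z)"
    unfolding set_integral_diff(2)[OF i i, OF Z(2) Z'(1) Z(2) Z'(2), symmetric]
    using T by (intro set_lebesgue_integral_cong) (auto simp: g(2)[symmetric] wedge_def algebra_simps)
  ultimately show ?thesis
    using integral_wedge_nabla0_left[OF T f(1) Z'(1)] integral_wedge_nabla0_right[OF T Z(2) g(1)] by simp
qed

text \<open>Turns \<open>Ic\<close> into one integral once a compactly supported representative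
  \<eta> of the class of \<psi> is at hand. The existence of \<eta> puts that class in the image of
  \<open>natmap\<close>; \<open>inj\<close> identifies the preimage picked by
  \<open>inv_into\<close> with the class of \<eta>; independence of representatives makes the set
  under \<open>the_elem\<close> a singleton.\<close>

lemma Ic_eqI:
  assumes T: "open T" and \<omega>: "\<omega> \<in> E1 T"
    and inj: "\<And>\<eta> \<xi>. \<eta> \<in> Z1c T \<omega> \<Longrightarrow> \<xi> \<in> Z1c T \<omega> \<Longrightarrow> (\<eta>, \<xi>) \<in> cohom T \<omega> \<Longrightarrow> (\<eta>, \<xi>) \<in> cohomc T \<omega>"
    and \<eta>: "\<eta> \<in> Z1c T \<omega>" "(\<psi>, \<eta>) \<in> cohom T \<omega>" and \<phi>: "\<phi> \<in> Z1 T (\<lambda>z. - \<omega> z)"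
  shows "Ic T \<omega> (coclass T \<omega> \<psi>) (coclass T (\<lambda>z. - \<omega> z) \<phi>) = (LINT z:T|lborel. wedge \<eta> \<phi> z)"
proof -
  note eq = equiv_cohom[OF T, of \<omega>] and eqc = equiv_cohomc[OF T, of \<omega>] and eq' = equiv_cohom[OF T, of "\<lambda>z. - \<omega> z"]
  have nat: "natmap T \<omega> (cohomc T \<omega> `` {e}) = cohom T \<omega> `` {e}" if "e \<in> Z1c T \<omega>" for e
  proof -
    have "(e, e) \<in> cohomc T \<omega>" using eqc that by (auto simp: equiv_def refl_on_def)
    moreover have "(e, x) \<in> cohom T \<omega>" if "(e, y) \<in> cohomc T \<omega>" "(y, x) \<in> cohom T \<omega>" for x y
      using cohomc_imp_cohom[OF that(1)] that(2) eq unfolding equiv_def trans_def by blast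
    ultimately show ?thesis unfolding natmap_def by blast
  qed
  define C where "C = jmath T \<omega> (coclass T \<omega> \<psi>)"
  have cl: "coclass T \<omega> \<psi> = cohom T \<omega> `` {\<eta>}"
    unfolding coclass_def using equiv_class_eq[OF eq \<eta>(2)] .
  have im: "coclass T \<omega> \<psi> \<in> natmap T \<omega> ` H1c T \<omega>"
    unfolding cl nat[OF \<eta>(1), symmetric] H1c_def by (intro imageI quotientI \<eta>(1))
  have "C \<in> H1c T \<omega>" "natmap T \<omega> C = coclass T \<omega> \<psi>"
    unfolding C_def jmath_def by (rule inv_into_into[OF im], rule f_inv_into_f[OF im])
  \<comment> \<open>\<open>e\<close> represents whatever preimage was chosen; a priori it is related
    to \<eta> only in the cohomology without supports.\<close>
  then obtain e where e: "e \<in> Z1c T \<omega>" "C = cohomc T \<omega> `` {e}" "cohom T \<omega> `` {e} = cohom T \<omega> `` {\<eta>}"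
    using nat unfolding H1c_def cl by (auto elim!: quotientE)
  have "\<eta> \<in> Z1 T \<omega>" using \<eta>(1) by (auto simp: Z1c_def Z1_def E1c_def)
  hence "(e, \<eta>) \<in> cohom T \<omega>" using eq_equiv_class[OF e(3) eq] by blast
  hence "(e, \<eta>) \<in> cohomc T \<omega>" by (intro inj e \<eta>)
  hence C: "C = cohomc T \<omega> `` {\<eta>}" using equiv_class_eq[OF eqc] e(2) by blast
  have "(\<eta>, \<eta>) \<in> cohomc T \<omega>" using eqc \<eta>(1) by (auto simp: equiv_def refl_on_def)
  moreover have "(\<phi>, \<phi>) \<in> cohom T (\<lambda>z. - \<omega> z)" using eq' \<phi> by (auto simp: equiv_def refl_on_def)
  moreover have "(LINT z:T|lborel. wedge h x z) = (LINT z:T|lborel. wedge \<eta> \<phi> z)"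
    if "(\<eta>, h) \<in> cohomc T \<omega>" "(\<phi>, x) \<in> cohom T (\<lambda>z. - \<omega> z)" for h x
    using integral_wedge_cong[OF T \<omega> that] by simp
  ultimately have "{(LINT z:T|lborel. wedge h x z) | h x. h \<in> C \<and> x \<in> coclass T (\<lambda>z. - \<omega> z) \<phi>}
      = {LINT z:T|lborel. wedge \<eta> \<phi> z}"
    unfolding C coclass_def by blast
  thus ?thesis unfolding Ic_def C_def by simp
qed

lemma smooth_on_fdt: "open T \<Longrightarrow> smooth_on T f \<Longrightarrow> fdt f \<in> E1 T"
  by (simp add: E1_def fdt_def smooth_on_mult smooth_on_const)

lemma fdt_in_Z1:
  assumes T: "open T" and f: "f holomorphic_on T"
  shows "fdt f \<in> Z1 T (fdt w)" "fdt f \<in> Z1 T (\<lambda>z. - fdt w z)"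
proof -
  have sm: "smooth_on T f" by (rule smooth_on_holomorphic[OF T f])
  have "d1 (fdt f) z = 0" if z: "z \<in> T" for z
  proof -
    have d: "(f has_field_derivative deriv f z) (at z)" by (rule holomorphic_derivI[OF f T z])
    show ?thesis unfolding d1_def dx_def dy_def fdt_def
      by (simp add: frechet_derivative_holomorphic[OF d] frechet_derivative_holomorphic[OF DERIV_cmult[OF d]])
  qed
  thus "fdt f \<in> Z1 T (fdt w)" "fdt f \<in> Z1 T (\<lambda>z. - fdt w z)"
    using smooth_on_fdt[OF T sm] by (auto simp: Z1_def nabla1_def wedge_def fdt_def)
qed

lemma d1_fdt:
  assumes T: "open T" and f: "f holomorphic_on T" and z: "z \<in> T"
  shows "d1 (fdt f) z = 0"
  using fdt_in_Z1(1)[OF T f, of f] z by (simp add: Z1_def nabla1_def wedge_def)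

lemma nabla0_in_Z1:
  assumes T: "open T" and w: "w holomorphic_on T" and f: "smooth_on T f"
  shows "nabla0 (fdt w) f \<in> Z1 T (fdt w)"
proof -
  have ws: "fdt w \<in> E1 T" by (intro smooth_on_fdt smooth_on_holomorphic T w)
  have E: "d0 f \<in> E1 T" "fmul f (fdt w) \<in> E1 T" by (intro E1_d0 E1_fmul T f ws)+
  have "nabla1 (fdt w) (nabla0 (fdt w) f) z = 0" if z: "z \<in> T" for z
  proof -
    have "d1 (nabla0 (fdt w) f) z = d1 (d0 f) z + d1 (fmul f (fdt w)) z"
      using E unfolding E1_def d1_def nabla0_def dx_def dy_def
      by (simp add: frechet_derivative_add[OF _ _ z])
    also have "\<dots> = wedge (d0 f) (fdt w) z"
      by (simp add: d1_d0_eq_0[OF T f z] d1_fmul[OF f ws z] d1_fdt[OF T w z])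
    finally show ?thesis by (simp add: nabla1_def wedge_def nabla0_def fmul_def algebra_simps)
  qed
  moreover have "nabla0 (fdt w) f \<in> E1 T"
    using E unfolding E1_def nabla0_def by (simp add: smooth_on_add[OF T])
  ultimately show ?thesis by (simp add: Z1_def)
qed

lemma diff_in_Z1:
  assumes T: "open T" and "\<eta> \<in> Z1 T \<omega>" "\<xi> \<in> Z1 T \<omega>"
  shows "(\<lambda>z. \<eta> z - \<xi> z) \<in> Z1 T \<omega>"
proof -
  have E: "\<eta> \<in> E1 T" "\<xi> \<in> E1 T" using assms by (auto simp: Z1_def)
  have "nabla1 \<omega> (\<lambda>z. \<eta> z - \<xi> z) z = nabla1 \<omega> \<eta> z - nabla1 \<omega> \<xi> z" if z: "z \<in> T" for z
    using E unfolding E1_def nabla1_def d1_def dx_def dy_def wedge_def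
    by (simp add: frechet_derivative_diff[OF _ _ z] algebra_simps)
  thus ?thesis using assms E by (auto simp: Z1_def E1_def smooth_on_diff[OF T])
qed

text \<open>Flatness prescribes the derivative in the directions 1 and i; real linearity extends
  this to all v and shows the derivative to be complex linear.\<close>

lemma nabla0_eq_0_has_derivative:
  assumes "smooth_on T f" "z \<in> T" "nabla0 (fdt w) f z = 0"
  shows "(f has_derivative (\<lambda>v. - (f z * w z) * v)) (at z)"
proof -
  let ?D = "frechet_derivative f (at z)"
  have d: "(f has_derivative ?D) (at z)" by (rule smooth_on_has_derivative[OF assms(1,2)])
  interpret D: bounded_linear ?D using has_derivative_bounded_linear[OF d] .
  have D1: "?D 1 = - (f z * w z)" "?D \<i> = - (\<i> * (f z * w z))"
    using assms(3) by (auto simp: nabla0_def d0_def dx_def dy_def fmul_def fdt_def zero_prod_def eq_neg_iff_add_eq_0 mult_ac)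
  have "?D v = - (f z * w z) * v" for v
  proof -
    have "v = Re v *\<^sub>R 1 + Im v *\<^sub>R \<i>" by (simp add: complex_eq_iff)
    hence "?D v = Re v *\<^sub>R ?D 1 + Im v *\<^sub>R ?D \<i>" by (metis D.add D.scaleR)
    also have "\<dots> = - (f z * w z) * (Re v *\<^sub>R 1 + Im v *\<^sub>R \<i>)" by (simp add: D1 scaleR_conv_of_real algebra_simps)
    finally show ?thesis by (simp add: complex_eq_iff)
  qed
  thus ?thesis using d by (metis (no_types, lifting) has_derivative_eq_rhs ext)
qed

section \<open>Intersection numbers on a punctured plane\<close>

lemma inverse_in_ball:
  fixes t :: complex
  assumes "\<rho> > 0" "cmod t > \<rho>"
  shows "t \<noteq> 0" "1 / t \<in> ball 0 (1 / \<rho>)"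
  using assms by (auto simp: norm_divide intro!: divide_strict_left_mono mult_pos_pos)

lemma holomorphic_ball_primitive:
  assumes "f holomorphic_on ball c d"
  shows "\<exists>P. \<forall>z\<in>ball c d. (P has_field_derivative f z) (at z)"
  using holomorphic_convex_primitive'[OF convex_ball open_ball assms] at_within_open[OF _ open_ball] by metis

text \<open>The equation and its derivative, both evaluated at s = 0. These two Taylor coefficients
  are what the residue at infinity requires.\<close>

lemma singular_ode_coeffs:
  assumes H: "H holomorphic_on ball 0 \<rho>" and g: "g holomorphic_on ball 0 \<rho>" and v: "v holomorphic_on ball 0 \<rho>"
    and r: "\<rho> > 0" and ode: "\<And>s. s \<in> ball 0 \<rho> \<Longrightarrow> s * deriv H s + (\<beta> + s * v s) * H s = g s"
  shows "\<beta> * H 0 = g 0" "(\<beta> + 1) * deriv H 0 + v 0 * H 0 = deriv g 0"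
proof -
  have 0: "(0::complex) \<in> ball 0 \<rho>" using r by simp
  show "\<beta> * H 0 = g 0" using ode[OF 0] by simp
  note d = holomorphic_derivI[OF _ open_ball 0]
  have "((\<lambda>s. s * deriv H s + (\<beta> + s * v s) * H s) has_field_derivative
      (deriv H 0 + v 0 * H 0 + \<beta> * deriv H 0)) (at 0)"
    using d[OF H] d[OF v] d[OF holomorphic_deriv[OF H open_ball]]
    by (auto intro!: derivative_eq_intros)
  moreover have "((\<lambda>s. s * deriv H s + (\<beta> + s * v s) * H s) has_field_derivative deriv g 0) (at 0)"
    by (rule has_field_derivative_transform_within_open[OF d[OF g] open_ball 0]) (simp add: ode)
  ultimately have "deriv H 0 + v 0 * H 0 + \<beta> * deriv H 0 = deriv g 0" by (rule DERIV_unique)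
  thus "(\<beta> + 1) * deriv H 0 + v 0 * H 0 = deriv g 0" by (simp add: algebra_simps)
qed

lemma cutoff_product:
  assumes U: "open U" and S: "closed S" "S \<subseteq> U" and h: "smooth_on UNIV h" "\<forall>z\<in>- S. h z = 0"
    and F: "F holomorphic_on U"
  shows "smooth_on UNIV (\<lambda>z. h z * F z)"
    and "wedge (d0 (\<lambda>z. h z * F z)) (fdt q) z = wedge (d0 h) (fdt (\<lambda>z. F z * q z)) z"
proof -
  have oS: "open (- S)" using S by (simp add: open_Compl)
  have "smooth_on (U \<union> - S) (\<lambda>z. h z * F z)"
  proof (rule smooth_on_Un[OF U oS])
    show "smooth_on U (\<lambda>z. h z * F z)"
      by (rule smooth_on_mult[OF U smooth_on_subset[OF h(1)] smooth_on_holomorphic[OF U F]]) simp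
    show "smooth_on (- S) (\<lambda>z. h z * F z)"
      using smooth_on_cong[OF oS, of "\<lambda>z. h z * F z" "\<lambda>_. 0"] h(2) smooth_on_const[OF oS] by auto
  qed
  moreover have "U \<union> - S = UNIV" using S(2) by auto
  ultimately show "smooth_on UNIV (\<lambda>z. h z * F z)" by simp
  show "wedge (d0 (\<lambda>z. h z * F z)) (fdt q) z = wedge (d0 h) (fdt (\<lambda>z. F z * q z)) z"
  proof (cases "z \<in> U")
    case True
    have "frechet_derivative (\<lambda>z. h z * F z) (at z) v = h z * (deriv F z * v) + frechet_derivative h (at z) v * F z" for v
      using frechet_derivative_mult[OF smooth_on_subset[OF h(1)] smooth_on_holomorphic[OF U F] True, of v]
        frechet_derivative_holomorphic[OF holomorphic_derivI[OF F U True]] by simp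
    thus ?thesis unfolding wedge_d0_fdt dx_def dy_def by (simp add: algebra_simps)
  next
    case False
    hence z: "z \<in> - S" using S(2) by auto
    show ?thesis
      using frechet_derivative_cong_open[OF oS, of h "\<lambda>_. 0" z] h(2) z
        frechet_derivative_cong_open[OF oS, of "\<lambda>z. h z * F z" "\<lambda>_. 0" z]
      unfolding wedge_d0_fdt dx_def dy_def by simp
  qed
qed

text \<open>Passes from integrals over the plane to integrals over the punctured plane: the
  punctures form a null set.\<close>

lemma set_integral_cofinite:
  fixes f :: "complex \<Rightarrow> complex"
  assumes "finite S" "has_bochner_integral lborel f a"
  shows "set_integrable lborel (UNIV - S) f" "(LINT z:UNIV - S|lborel. f z) = a"
proof -
  have f: "integrable lborel f" "integral\<^sup>L lborel f = a" using assms(2) by (auto simp: has_bochner_integral_iff)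
  have [measurable]: "S \<in> sets borel" using assms(1) by (simp add: finite_imp_closed)
  have m [measurable]: "f \<in> borel_measurable borel" using borel_measurable_integrable[OF f(1)] by simp
  have ae: "AE z in lborel. indicator (UNIV - S) z *\<^sub>R f z = f z"
    using AE_not_in[OF finite_imp_null_set_lborel[OF assms(1)]] by eventually_elim auto
  show "set_integrable lborel (UNIV - S) f" unfolding set_integrable_def
    by (subst integrable_cong_AE[OF _ _ ae]) (use f in auto)
  show "(LINT z:UNIV - S|lborel. f z) = a" unfolding set_lebesgue_integral_def
    by (subst integral_cong_AE[OF _ _ ae]) (use f in auto)
qed

text \<open>The last condition concerns infinity, where the exponent of the multivalued function is
  minus the sum of the \<alpha> i.\<close>

locale punctured_plane =
  fixes I :: "'i set" and X \<alpha> :: "'i \<Rightarrow> complex"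
  assumes finite_I: "finite I" and inj_X: "inj_on X I"
    and \<alpha>_nonint: "\<And>i. i \<in> I \<Longrightarrow> \<alpha> i \<notin> \<int>" and sum_\<alpha>_nonint: "(\<Sum>i\<in>I. \<alpha> i) \<notin> \<int>"
begin

definition T :: "complex set" where "T = UNIV - X ` I"

text \<open>The constant k is included because multiplying a function with simple poles by t - x_k
  produces one.\<close>

definition rat :: "complex \<Rightarrow> ('i \<Rightarrow> complex) \<Rightarrow> complex \<Rightarrow> complex" where
  "rat k A t = k + (\<Sum>i\<in>I. A i / (t - X i))"

definition reg :: "complex \<Rightarrow> ('i \<Rightarrow> complex) \<Rightarrow> 'i \<Rightarrow> complex \<Rightarrow> complex" where
  "reg k A i t = k + (\<Sum>j\<in>I - {i}. A j / (t - X j))"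

text \<open>\<open>rat k A t = k + u * atinf A u\<close> in the coordinate \<open>u = 1 / t\<close> at infinity.\<close>

definition atinf :: "('i \<Rightarrow> complex) \<Rightarrow> complex \<Rightarrow> complex" where
  "atinf A u = (\<Sum>i\<in>I. A i / (1 - X i * u))"

lemma open_T: "open T"
  unfolding T_def using finite_I by (intro open_Diff finite_imp_closed) auto

lemma rat_holomorphic: "rat k A holomorphic_on T"
  unfolding rat_def[abs_def] T_def by (intro holomorphic_intros) auto

lemma rat_split: "i \<in> I \<Longrightarrow> rat k A t = A i / (t - X i) + reg k A i t"
  unfolding rat_def reg_def using sum.remove[OF finite_I] by (simp add: algebra_simps)

lemma reg_holomorphic:
  assumes "\<And>j. j \<in> I \<Longrightarrow> j \<noteq> i \<Longrightarrow> X j \<notin> S"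
  shows "reg k A i holomorphic_on S"
  unfolding reg_def[abs_def] using assms by (intro holomorphic_intros) auto

lemma rat_atinf: "t \<noteq> 0 \<Longrightarrow> rat k A t = k + (1 / t) * atinf A (1 / t)"
  unfolding rat_def atinf_def sum_distrib_left
  by (intro arg_cong2[of _ _ _ _ "(+)"] sum.cong) (auto simp: field_simps)

lemma atinf_denom:
  assumes "\<And>i. i \<in> I \<Longrightarrow> cmod (X i) < \<rho>" "u \<in> ball 0 (1 / \<rho>)" "i \<in> I"
  shows "1 - X i * u \<noteq> 0"
proof -
  have r: "\<rho> > 0" using assms(1)[OF assms(3)] norm_ge_zero[of "X i"] by linarith
  have "cmod (X i * u) \<le> \<rho> * cmod u"
    using assms(1)[OF assms(3)] by (auto simp: norm_mult intro: mult_right_mono)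
  also have "\<dots> < 1" using assms(2) r by (simp add: field_simps)
  finally show ?thesis by auto
qed

lemma atinf_holomorphic:
  assumes "\<And>i. i \<in> I \<Longrightarrow> cmod (X i) < \<rho>"
  shows "atinf A holomorphic_on ball 0 (1 / \<rho>)"
  unfolding atinf_def[abs_def] using atinf_denom[OF assms]
  by (intro holomorphic_intros) auto

lemma atinf_0: "atinf A 0 = sum A I"
  by (simp add: atinf_def)

lemma deriv_atinf_0: "deriv (atinf A) 0 = (\<Sum>i\<in>I. A i * X i)"
  unfolding atinf_def[abs_def]
  by (rule DERIV_imp_deriv) (auto intro!: derivative_eq_intros simp: sum_negf[symmetric])

text \<open>Termwise 1/(1 - x u) = 1 + u x/(1 - x u). The sum of the residues is thereby split off
  as the value at infinity.\<close>

lemma atinf_eq: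
  assumes "\<And>i. i \<in> I \<Longrightarrow> 1 - X i * u \<noteq> 0"
  shows "atinf A u = sum A I + u * atinf (\<lambda>i. A i * X i) u"
  unfolding atinf_def sum_distrib_left sum.distrib[symmetric]
  using assms by (intro sum.cong) (auto simp: field_simps)

text \<open>With gaps of 4 * \<delta>, the disc of radius 4 * \<delta> about one puncture omits all
  the others, and the cutoffs of radius \<delta>, supported within 3/2 * \<delta>, have disjoint
  supports.\<close>

lemma separation:
  obtains \<delta> where "\<delta> > 0" "\<And>i j. i \<in> I \<Longrightarrow> j \<in> I \<Longrightarrow> i \<noteq> j \<Longrightarrow> 4 * \<delta> \<le> dist (X i) (X j)"
proof -
  \<comment> \<open>The element 1 keeps \<open>Min\<close> meaningful when there are fewer than two
    punctures.\<close>
  define D where "D = insert 1 ((\<lambda>(i, j). dist (X i) (X j)) ` {(i, j) \<in> I \<times> I. i \<noteq> j})"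
  have "finite {(i, j) \<in> I \<times> I. i \<noteq> j}" by (rule finite_subset[of _ "I \<times> I"]) (use finite_I in auto)
  hence D: "finite D" "D \<noteq> {}" by (auto simp: D_def)
  have "\<forall>d\<in>D. d > 0" unfolding D_def using inj_X by (auto dest: inj_onD)
  hence "Min D > 0" using D by simp
  moreover have "Min D \<le> dist (X i) (X j)" if "i \<in> I" "j \<in> I" "i \<noteq> j" for i j
    using D(1) that by (intro Min_le) (auto simp: D_def)
  ultimately show ?thesis by (intro that[of "Min D / 4"]) auto
qed

lemma outer_radius:
  obtains \<rho> where "\<rho> > 0" "\<And>i. i \<in> I \<Longrightarrow> cmod (X i) < \<rho>"
proof -
  have "bounded (X ` I)" using finite_I by (simp add: finite_imp_bounded)
  then obtain b where "b > 0" "\<forall>x\<in>X ` I. cmod x \<le> b" unfolding bounded_pos by blast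
  thus ?thesis by (intro that[of "b + 1"]) force+
qed

lemma local_primitive:
  assumes "i \<in> I" "\<And>j. j \<in> I \<Longrightarrow> j \<noteq> i \<Longrightarrow> X j \<notin> ball (X i) d"
  obtains W where "\<And>t. t \<in> ball (X i) d \<Longrightarrow> (W has_field_derivative rat 0 \<alpha> t - \<alpha> i / (t - X i)) (at t)"
proof -
  have "reg 0 \<alpha> i holomorphic_on ball (X i) d" using assms(2) by (intro reg_holomorphic) auto
  from holomorphic_ball_primitive[OF this]
  obtain W where "\<forall>t\<in>ball (X i) d. (W has_field_derivative reg 0 \<alpha> i t) (at t)" ..
  thus ?thesis using rat_split[OF assms(1), of 0 \<alpha>] by (intro that[of W]) simp
qed

text \<open>In the coordinate u = 1/t one has dt = -du/u^2, so the remainder u^2 v(u) dt becomes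
  -v(u) du with v holomorphic near 0.\<close>

lemma primitive_at_infinity:
  assumes "\<rho> > 0" "\<And>i. i \<in> I \<Longrightarrow> cmod (X i) < \<rho>"
  obtains W where "\<And>t. cmod t > \<rho> \<Longrightarrow> (W has_field_derivative rat 0 \<alpha> t - sum \<alpha> I / t) (at t)"
proof -
  let ?v = "atinf (\<lambda>i. \<alpha> i * X i)"
  have hv: "?v holomorphic_on ball 0 (1 / \<rho>)" by (rule atinf_holomorphic[OF assms(2)])
  from holomorphic_ball_primitive[OF this]
  obtain V where V: "\<forall>u\<in>ball 0 (1 / \<rho>). (V has_field_derivative ?v u) (at u)" ..
  show ?thesis
  proof (rule that[of "\<lambda>t. - V (1 / t)"])
    fix t :: complex assume t: "cmod t > \<rho>"
    from inverse_in_ball[OF assms(1) this] have t0: "t \<noteq> 0" and u: "1 / t \<in> ball 0 (1 / \<rho>)" .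
    have "((\<lambda>t. 1 / t) has_field_derivative - (1 / t\<^sup>2)) (at t)"
      using t0 by (auto intro!: derivative_eq_intros simp: power2_eq_square)
    from DERIV_minus[OF DERIV_chain2[OF bspec[OF V u] this]]
    have "((\<lambda>t. - V (1 / t)) has_field_derivative ?v (1 / t) * (1 / t\<^sup>2)) (at t)" by simp
    moreover have "rat 0 \<alpha> t - sum \<alpha> I / t = ?v (1 / t) * (1 / t\<^sup>2)"
      using atinf_denom[OF assms(2) u] t0
      by (subst rat_atinf, simp, subst atinf_eq) (auto simp: field_simps power2_eq_square)
    ultimately show "((\<lambda>t. - V (1 / t)) has_field_derivative rat 0 \<alpha> t - sum \<alpha> I / t) (at t)" by simp
  qed
qed

abbreviation "\<omega> \<equiv> fdt (rat 0 \<alpha>)"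

text \<open>Small circles about a puncture, and large circles about 0, avoid K. On them f is flat
  and the nontrivial monodromy forces f = 0; what remains after removing these regions is compact in
  T.\<close>

lemma flat_compactly_supported:
  assumes f: "smooth_on T f" and K: "compact K" "K \<subseteq> T" "\<And>z. z \<in> T - K \<Longrightarrow> nabla0 \<omega> f z = 0"
  shows "compactly_supported T f"
proof -
  obtain \<delta> where \<delta>: "\<delta> > 0" "\<And>i j. i \<in> I \<Longrightarrow> j \<in> I \<Longrightarrow> i \<noteq> j \<Longrightarrow> 4 * \<delta> \<le> dist (X i) (X j)"
    using separation by blast
  obtain \<rho> where \<rho>: "\<rho> > 0" "\<And>i. i \<in> I \<Longrightarrow> cmod (X i) < \<rho>" using outer_radius by blast
  obtain b where b: "K \<subseteq> ball 0 b" using compact_imp_bounded[OF K(1)] bounded_subset_ballD by blast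
  define R where "R = max b \<rho>"
  have "\<exists>\<epsilon>>0. \<forall>i\<in>I. ball (X i) \<epsilon> \<inter> K = {}"
  proof -
    have "open (- K)" using compact_imp_closed[OF K(1)] by (simp add: open_Compl)
    have "\<forall>i\<in>I. \<exists>e>0. ball (X i) e \<subseteq> - K"
    proof
      fix i assume "i \<in> I"
      hence "X i \<in> - K" using K(2) by (auto simp: T_def)
      thus "\<exists>e>0. ball (X i) e \<subseteq> - K" using \<open>open (- K)\<close> openE by blast
    qed
    then obtain e where e: "\<And>i. i \<in> I \<Longrightarrow> e i > 0 \<and> ball (X i) (e i) \<subseteq> - K" by metis
    have "Min (insert 1 (e ` I)) > 0" using finite_I e by (subst Min_gr_iff) auto
    moreover have "ball (X i) (Min (insert 1 (e ` I))) \<inter> K = {}" if "i \<in> I" for i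
    proof -
      have "Min (insert 1 (e ` I)) \<le> e i" using finite_I that by (intro Min_le) auto
      hence "ball (X i) (Min (insert 1 (e ` I))) \<subseteq> - K" using e[OF that] subset_ball by blast
      thus ?thesis by blast
    qed
    ultimately show ?thesis by blast
  qed
  then obtain \<epsilon>' where \<epsilon>': "\<epsilon>' > 0" "\<And>i. i \<in> I \<Longrightarrow> ball (X i) \<epsilon>' \<inter> K = {}" by metis
  define \<epsilon> where "\<epsilon> = min \<epsilon>' \<delta>"
  have e: "\<epsilon> > 0" "\<And>i. i \<in> I \<Longrightarrow> ball (X i) \<epsilon> \<inter> K = {}" using \<epsilon>' \<delta>(1) by (fastforce simp: \<epsilon>_def)+
  have eX: "X j \<notin> ball (X i) \<epsilon>" if "i \<in> I" "j \<in> I" "j \<noteq> i" for i j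
  proof -
    have "4 * \<delta> \<le> dist (X i) (X j)" using \<delta>(2)[of i j] that by auto
    thus ?thesis using \<delta>(1) by (auto simp: \<epsilon>_def)
  qed
  define L where "L = cball 0 R - (\<Union>i\<in>I. ball (X i) \<epsilon>)"
  have "compact L" unfolding L_def by (intro compact_diff compact_cball open_UN) auto
  moreover have "L \<subseteq> T" using e(1) by (auto simp: L_def T_def)
  moreover have "f z = 0" if z: "z \<in> T - L" for z
  proof -
    have flat: "(f has_derivative (\<lambda>v. - (f t * rat 0 \<alpha> t) * v)) (at t)" if "t \<in> T - K" for t
      using that K(3) by (intro nabla0_eq_0_has_derivative[OF f]) auto
    from z consider "cmod z > R" | i where "i \<in> I" "z \<in> ball (X i) \<epsilon>" by (auto simp: L_def)
    thus ?thesis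
    proof cases
      case 1
      obtain W where W: "\<And>t. cmod t > \<rho> \<Longrightarrow> (W has_field_derivative rat 0 \<alpha> t - sum \<alpha> I / t) (at t)"
        using primitive_at_infinity[OF \<rho>] by blast
      show ?thesis
      proof (rule flat_section_eq_0[where f = f and ?z0.0 = z and w = "rat 0 \<alpha>" and W = W and c = 0 and \<beta> = "sum \<alpha> I"])
        fix t assume t: "cmod (t - 0) = cmod (z - 0)"
        have tn: "cmod t > \<rho>" "cmod t > b" using t 1 by (simp_all add: R_def)
        have "t \<noteq> X i" if "i \<in> I" for i using \<rho>(2)[OF that] tn(1) by auto
        hence "t \<in> T" unfolding T_def by blast
        moreover have "t \<notin> K" using b tn(2) by (auto dest!: subsetD)
        ultimately show "(f has_derivative (\<lambda>v. - (f t * rat 0 \<alpha> t) * v)) (at t)" by (intro flat) auto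
        show "(W has_field_derivative rat 0 \<alpha> t - sum \<alpha> I / (t - 0)) (at t)"
          using W[OF tn(1)] by simp
      qed (use sum_\<alpha>_nonint 1 \<rho>(1) in \<open>auto simp: R_def\<close>)
    next
      case 2
      obtain W where W: "\<And>t. t \<in> ball (X i) \<epsilon> \<Longrightarrow> (W has_field_derivative rat 0 \<alpha> t - \<alpha> i / (t - X i)) (at t)"
        using local_primitive[of i \<epsilon>] eX 2(1) by blast
      have ne: "z \<noteq> X i" using z 2(1) by (auto simp: T_def)
      show ?thesis
      proof (rule flat_section_eq_0[where f = f and ?z0.0 = z and w = "rat 0 \<alpha>" and W = W and c = "X i" and \<beta> = "\<alpha> i"])
        fix t assume t: "cmod (t - X i) = cmod (z - X i)"
        have tb: "t \<in> ball (X i) \<epsilon>" using 2(2) t by (simp add: dist_norm norm_minus_commute)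
        moreover have "t \<noteq> X i" using t ne by auto
        ultimately have "t \<in> T" using eX[OF 2(1)] by (auto simp: T_def)
        moreover have "t \<notin> K" using tb e(2)[OF 2(1)] by blast
        ultimately show "(f has_derivative (\<lambda>v. - (f t * rat 0 \<alpha> t) * v)) (at t)" by (intro flat) auto
        show "(W has_field_derivative rat 0 \<alpha> t - \<alpha> i / (t - X i)) (at t)" by (rule W[OF tb])
      qed (use \<alpha>_nonint 2(1) ne in auto)
    qed
  qed
  ultimately show ?thesis unfolding compactly_supported_def by blast
qed

text \<open>A function whose twisted differential is the difference of two compactly supported forms
  is flat outside the union of their supports, hence itself compactly supported: the same f is a
  witness for both relations.\<close>

lemma cohom_imp_cohomc:
  assumes "\<eta> \<in> Z1c T \<omega>" "\<xi> \<in> Z1c T \<omega>" "(\<eta>, \<xi>) \<in> cohom T \<omega>"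
  shows "(\<eta>, \<xi>) \<in> cohomc T \<omega>"
proof -
  obtain f where f: "smooth_on T f" "\<And>z. z \<in> T \<Longrightarrow> \<eta> z - \<xi> z = nabla0 \<omega> f z"
    using assms(3) by (auto simp: cohom_def E0_def)
  obtain K L where K: "compact K" "K \<subseteq> T" "\<forall>z\<in>T - K. \<eta> z = 0" "compact L" "L \<subseteq> T" "\<forall>z\<in>T - L. \<xi> z = 0"
    using assms(1,2) unfolding Z1c_def E1c_def compactly_supported_def by blast
  have "compactly_supported T f"
  proof (rule flat_compactly_supported[OF f(1), of "K \<union> L"])
    fix z assume z: "z \<in> T - (K \<union> L)"
    hence "\<eta> z = 0" "\<xi> z = 0" using K by auto
    thus "nabla0 \<omega> f z = 0" using f(2)[of z] z by simp
  qed (use K in auto)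
  thus ?thesis using assms(1,2) f by (auto simp: cohomc_def E0c_iff)
qed

text \<open>Multiplying the equation by s = t - X i gives a singular equation with \<beta> =
  \<alpha> i and right-hand side A i + s * (holomorphic). Its value at s = 0 determines F (X i), the
  number that enters the residue.\<close>

lemma local_solution:
  assumes i: "i \<in> I" and d: "d > 0" "\<And>j. j \<in> I \<Longrightarrow> j \<noteq> i \<Longrightarrow> X j \<notin> ball (X i) d"
  shows "\<exists>F. F holomorphic_on ball (X i) d \<and> \<alpha> i * F (X i) = A i \<and>
    (\<forall>t\<in>ball (X i) d - {X i}. deriv F t + rat 0 \<alpha> t * F t = rat k A t)"
proof -
  let ?c = "X i"
  have hol: "(\<lambda>s. reg k' B i (?c + s)) holomorphic_on ball 0 d" for k' B
  proof -
    have "reg k' B i holomorphic_on ball ?c d" using d(2) by (intro reg_holomorphic) auto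
    hence "reg k' B i holomorphic_on (+) ?c ` ball 0 d" by (simp add: ball_translation)
    from holomorphic_on_compose[OF _ this] show ?thesis by (simp add: o_def holomorphic_intros)
  qed
  let ?g = "\<lambda>s. A i + s * reg k A i (?c + s)" and ?v = "\<lambda>s. reg 0 \<alpha> i (?c + s)"
  have g: "?g holomorphic_on ball 0 d" by (intro holomorphic_intros hol)
  have \<beta>: "\<alpha> i + of_nat n \<noteq> 0" for n
    using \<alpha>_nonint[OF i] by (metis Ints_minus Ints_of_nat add_eq_0_iff2)
  obtain H where H: "H holomorphic_on ball 0 d"
    "\<And>s. s \<in> ball 0 d \<Longrightarrow> s * deriv H s + (\<alpha> i + s * ?v s) * H s = ?g s"
    using singular_ode_solvable[OF g hol d(1) \<beta>] by blast
  have sh: "t - ?c \<in> ball 0 d" if "t \<in> ball ?c d" for t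
    using that by (simp add: dist_norm norm_minus_commute)
  have dc: "((\<lambda>t. t - ?c) has_field_derivative 1) (at t)" for t by (auto intro!: derivative_eq_intros)
  have dF: "((\<lambda>t. H (t - ?c)) has_field_derivative deriv H (t - ?c)) (at t)" if "t \<in> ball ?c d" for t
    using DERIV_chain2[where f = H and g = "\<lambda>t. t - ?c" and x = t and Db = 1 and s = UNIV,
        OF holomorphic_derivI[OF H(1) open_ball sh[OF that]]] dc by simp
  show ?thesis
  proof (intro exI[of _ "\<lambda>t. H (t - ?c)"] conjI ballI)
    show "(\<lambda>t. H (t - ?c)) holomorphic_on ball ?c d"
      unfolding holomorphic_on_open[OF open_ball] using dF by blast
    show "\<alpha> i * H (?c - ?c) = A i" using H(2)[of 0] d(1) by simp
    fix t assume t: "t \<in> ball ?c d - {?c}"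
    define s where "s = t - ?c"
    have s: "s \<in> ball 0 d" "s \<noteq> 0" "?c + s = t" using t sh by (auto simp: s_def)
    have D: "deriv (\<lambda>t. H (t - ?c)) t = deriv H s" unfolding s_def using dF t by (intro DERIV_imp_deriv) auto
    have "s * (deriv H s + rat 0 \<alpha> t * H s) = s * rat k A t"
      using H(2)[OF s(1)] s(2) unfolding rat_split[OF i] s(3) s_def[symmetric] by (simp add: field_simps)
    thus "deriv (\<lambda>t. H (t - ?c)) t + rat 0 \<alpha> t * H (t - ?c) = rat k A t"
      using s(2) unfolding D s_def[symmetric] by simp
  qed
qed

text \<open>At infinity, with \<open>u = 1 / t\<close>, the solution is sought in the form \<open>t H(1 / t)\<close>, because a
  constant term of \<open>rat k A\<close> gives \<open>rat k A t dt\<close> a pole of order two there.\<close>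

lemma solution_at_infinity:
  assumes \<rho>: "\<rho> > 0" "\<And>i. i \<in> I \<Longrightarrow> cmod (X i) < \<rho>"
  obtains H where "H holomorphic_on ball 0 (1 / \<rho>)"
    "H 0 = k / (1 + sum \<alpha> I)"
    "deriv H 0 = (sum A I - (\<Sum>i\<in>I. \<alpha> i * X i) * H 0) / sum \<alpha> I"
    "\<And>t. cmod t > \<rho> \<Longrightarrow> ((\<lambda>t. t * H (1 / t)) has_field_derivative
        rat k A t - rat 0 \<alpha> t * (t * H (1 / t))) (at t)"
proof -
  \<comment> \<open>For F = t H(u) one finds dF/dt = H - u H', so the equation reads u H' + (-1 -
    atinf \<alpha> u) H = -(k + u * atinf A u); \<beta> is the coefficient of H at u = 0.\<close>
  define \<beta> where "\<beta> = - (1 + sum \<alpha> I)"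
  let ?g = "\<lambda>u. - (k + u * atinf A u)" and ?v = "\<lambda>u. - atinf (\<lambda>i. \<alpha> i * X i) u"
  have r: "1 / \<rho> > 0" using \<rho>(1) by simp
  note hol = atinf_holomorphic[OF \<rho>(2)]
  have g: "?g holomorphic_on ball 0 (1 / \<rho>)" and v: "?v holomorphic_on ball 0 (1 / \<rho>)"
    using hol by (auto intro!: holomorphic_intros)
  have \<beta>0: "\<beta> + of_nat n \<noteq> 0" for n
  proof
    assume "\<beta> + of_nat n = 0"
    hence "sum \<alpha> I = of_nat n - 1" by (simp add: \<beta>_def algebra_simps)
    also have "\<dots> \<in> \<int>" by (intro Ints_diff Ints_of_nat Ints_1)
    finally show False using sum_\<alpha>_nonint by simp
  qed
  obtain H where H: "H holomorphic_on ball 0 (1 / \<rho>)"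
    "\<And>u. u \<in> ball 0 (1 / \<rho>) \<Longrightarrow> u * deriv H u + (\<beta> + u * ?v u) * H u = ?g u"
    using singular_ode_solvable[OF g v r \<beta>0] by blast
  have dg: "deriv ?g 0 = - sum A I"
  proof (rule DERIV_imp_deriv)
    have "(atinf A has_field_derivative deriv (atinf A) 0) (at 0)"
      using holomorphic_derivI[OF hol open_ball] r by simp
    thus "(?g has_field_derivative - sum A I) (at 0)"
      by (auto intro!: derivative_eq_intros simp: atinf_0)
  qed
  note co = singular_ode_coeffs[OF H(1) g v r H(2)]
  \<comment> \<open>The cases n = 0 and n = 1 of \<open>\<beta>0\<close> are the two denominators in
    the coefficients of H.\<close>
  have "- (1 + sum \<alpha> I) \<noteq> 0" using \<beta>0[of 0] by (simp only: \<beta>_def of_nat_0 add_0_right not_False_eq_True)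
  hence s: "1 + sum \<alpha> I \<noteq> 0" "sum \<alpha> I \<noteq> 0" using \<beta>0[of 1] by (auto simp: \<beta>_def simp del: minus_add_distrib)
  show ?thesis
  proof (rule that[OF H(1)])
    have "(1 + sum \<alpha> I) * H 0 = k" using co(1)
      by (simp only: \<beta>_def mult_minus_left mult_zero_left add_0_right neg_equal_iff_equal)
    thus "H 0 = k / (1 + sum \<alpha> I)" using s(1) by (metis nonzero_mult_div_cancel_left)
    have "sum \<alpha> I * deriv H 0 = sum A I - (\<Sum>i\<in>I. \<alpha> i * X i) * H 0"
      using co(2) unfolding dg atinf_0 by (simp add: \<beta>_def algebra_simps)
    thus "deriv H 0 = (sum A I - (\<Sum>i\<in>I. \<alpha> i * X i) * H 0) / sum \<alpha> I" using s(2) by (simp add: field_simps)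
    fix t :: complex assume t: "cmod t > \<rho>"
    from inverse_in_ball[OF \<rho>(1) this] have t0: "t \<noteq> 0" and u: "1 / t \<in> ball 0 (1 / \<rho>)" .
    have "((\<lambda>t. 1 / t) has_field_derivative - (1 / t\<^sup>2)) (at t)"
      using t0 by (auto intro!: derivative_eq_intros simp: power2_eq_square)
    from DERIV_chain2[OF holomorphic_derivI[OF H(1) open_ball u] this]
    have "((\<lambda>t. t * H (1 / t)) has_field_derivative H (1 / t) - (1 / t) * deriv H (1 / t)) (at t)"
      using t0 by (auto intro!: derivative_eq_intros simp: power2_eq_square)
    moreover have "H (1 / t) - (1 / t) * deriv H (1 / t) = rat k A t - rat 0 \<alpha> t * (t * H (1 / t))"
    proof -
      have w: "rat 0 \<alpha> t * t = atinf \<alpha> (1 / t)" "atinf \<alpha> (1 / t) = sum \<alpha> I + 1 / t * atinf (\<lambda>i. \<alpha> i * X i) (1 / t)"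
        using rat_atinf[OF t0, of 0 \<alpha>] t0 atinf_eq[OF atinf_denom[OF \<rho>(2) u], where A = \<alpha>] by auto
      have "(1 / t) * deriv H (1 / t) + (- 1 - atinf \<alpha> (1 / t)) * H (1 / t) = - rat k A t"
        using H(2)[OF u] unfolding w(2) rat_atinf[OF t0, of k A] \<beta>_def by (simp add: algebra_simps)
      thus ?thesis unfolding w(1)[symmetric] by (simp add: algebra_simps)
    qed
    ultimately show "((\<lambda>t. t * H (1 / t)) has_field_derivative rat k A t - rat 0 \<alpha> t * (t * H (1 / t))) (at t)" by simp
  qed
qed

end

section \<open>Residues of local solutions and the general intersection formula\<close>

lemma simple_pole_primitive:
  assumes "Y holomorphic_on ball c d"
  shows "\<exists>m. \<forall>z\<in>ball c d - {c}. (m has_field_derivative Y z / (z - c) - Y c / (z - c)) (at z)"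
proof -
  let ?M = "\<lambda>z. if z = c then deriv Y c else (Y z - Y c) / (z - c)"
  have "?M holomorphic_on ball c d" by (rule pole_lemma_open[OF assms open_ball])
  from holomorphic_ball_primitive[OF this]
  obtain m where m: "\<forall>z\<in>ball c d. (m has_field_derivative ?M z) (at z)" ..
  show ?thesis
  proof (intro exI[of _ m] ballI)
    fix z assume z: "z \<in> ball c d - {c}"
    hence "?M z = Y z / (z - c) - Y c / (z - c)" by (simp add: diff_divide_distrib)
    thus "(m has_field_derivative Y z / (z - c) - Y c / (z - c)) (at z)" using bspec[OF m, of z] z by simp
  qed
qed

text \<open>K(1/z) is K(0) + K'(0)/z plus 1/z^2 times a holomorphic function of 1/z. The constant
  and the remainder have single-valued primitives, so K'(0) is the only obstruction; two removable
  singularities are filled to expose it.\<close>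

lemma primitive_of_inverse_argument:
  assumes K: "K holomorphic_on ball 0 (1 / \<rho>)" and \<rho>: "\<rho> > 0"
  obtains m where "\<And>z. cmod z > \<rho> \<Longrightarrow> (m has_field_derivative K (1 / z) - deriv K 0 / z) (at z)"
proof -
  let ?L = "\<lambda>u. if u = 0 then deriv K 0 else (K u - K 0) / (u - 0)"
  let ?M = "\<lambda>u. if u = 0 then deriv ?L 0 else (?L u - ?L 0) / (u - 0)"
  have "?L holomorphic_on ball 0 (1 / \<rho>)" by (rule pole_lemma_open[OF K open_ball])
  hence "?M holomorphic_on ball 0 (1 / \<rho>)" by (rule pole_lemma_open[OF _ open_ball])
  from holomorphic_ball_primitive[OF this]
  obtain P where P: "\<forall>u\<in>ball 0 (1 / \<rho>). (P has_field_derivative ?M u) (at u)" ..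
  show ?thesis
  proof (rule that[of "\<lambda>z. K 0 * z - P (1 / z)"])
    fix z :: complex assume z: "cmod z > \<rho>"
    note u = inverse_in_ball[OF \<rho> z]
    have "((\<lambda>z. 1 / z) has_field_derivative - (1 / z\<^sup>2)) (at z)"
      using u(1) by (auto intro!: derivative_eq_intros simp: power2_eq_square)
    from DERIV_chain2[OF bspec[OF P u(2)] this]
    have "((\<lambda>z. K 0 * z - P (1 / z)) has_field_derivative K 0 - ?M (1 / z) * (- (1 / z\<^sup>2))) (at z)"
      by (auto intro!: derivative_eq_intros)
    moreover have "?M (1 / z) = ((K (1 / z) - K 0) / (1 / z) - deriv K 0) / (1 / z)" using u(1) by simp
    hence "K 0 - ?M (1 / z) * (- (1 / z\<^sup>2)) = K (1 / z) - deriv K 0 / z"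
      using u(1) by (simp add: field_simps power2_eq_square)
    ultimately show "((\<lambda>z. K 0 * z - P (1 / z)) has_field_derivative K (1 / z) - deriv K 0 / z) (at z)"
      by (simp only:)
  qed
qed

lemma nabla0_fdt_eq:
  assumes "open N" "t \<in> N" "\<And>z. z \<in> N \<Longrightarrow> G z = F z" "(F has_field_derivative p t - w t * F t) (at t)"
  shows "nabla0 (fdt w) G t = fdt p t"
proof -
  have "d0 G t = d0 F t"
    unfolding d0_def dx_def dy_def using frechet_derivative_cong_open[OF assms(1,3,2)] by simp
  thus ?thesis
    using assms(2,3) d0_holomorphic[OF assms(4)] by (simp add: nabla0_def fmul_def fdt_def algebra_simps)
qed

context punctured_plane
begin

text \<open>F is holomorphic at X i, so F q has at most a simple pole there, with residue F (X i) *
  B i.\<close>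

lemma residue_integral_finite:
  assumes i: "i \<in> I" and \<delta>: "\<delta> > 0" "\<And>j. j \<in> I \<Longrightarrow> j \<noteq> i \<Longrightarrow> X j \<notin> ball (X i) (4 * \<delta>)"
    and F: "F holomorphic_on ball (X i) (4 * \<delta>)" and q: "\<And>t. t \<in> T \<Longrightarrow> q t = rat 0 B t"
  shows "has_bochner_integral lborel (wedge (d0 (\<lambda>t. cutoff (X i) \<delta> t * F t)) (fdt q)) (- 2 * pi * \<i> * (F (X i) * B i))"
    and "smooth_on UNIV (\<lambda>t. cutoff (X i) \<delta> t * F t)"
proof -
  let ?c = "X i"
  have ann: "cball ?c (3/2 * \<delta>) \<subseteq> ball ?c (4 * \<delta>)" using \<delta>(1) by auto
  have cz: "\<forall>z\<in>- cball ?c (3/2 * \<delta>). cutoff ?c \<delta> z = 0"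
    using \<delta>(1) by (intro ballI cutoff_eq_0) (auto simp: dist_norm norm_minus_commute)
  note cp = cutoff_product[OF open_ball closed_cball ann smooth_on_cutoff[OF open_UNIV] cz F]
  show "smooth_on UNIV (\<lambda>t. cutoff (X i) \<delta> t * F t)" by (rule cp(1))
  let ?Y = "\<lambda>z. F z * (B i + (z - ?c) * reg 0 B i z)"
  have "reg 0 B i holomorphic_on ball ?c (4 * \<delta>)" using \<delta>(2) by (intro reg_holomorphic) auto
  hence "?Y holomorphic_on ball ?c (4 * \<delta>)" by (intro holomorphic_intros F)
  from simple_pole_primitive[OF this]
  obtain m where m: "\<forall>z\<in>ball ?c (4 * \<delta>) - {?c}.
      (m has_field_derivative ?Y z / (z - ?c) - ?Y ?c / (z - ?c)) (at z)" ..
  have "has_bochner_integral lborel (\<lambda>z. wedge (d0 (cutoff ?c \<delta>)) (fdt (\<lambda>z. F z * q z)) z) (- 2 * pi * \<i> * (F ?c * B i))"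
  proof (rule has_integral_cutoff[OF \<delta>(1), of "ball ?c (4 * \<delta>) - {?c}" _ m])
    show "{z. \<delta> \<le> cmod (z - ?c) \<and> cmod (z - ?c) \<le> 3/2 * \<delta>} \<subseteq> ball ?c (4 * \<delta>) - {?c}"
      using \<delta>(1) by (auto simp: dist_norm norm_minus_commute)
    fix z assume z: "z \<in> ball ?c (4 * \<delta>) - {?c}"
    hence "z \<in> T" using \<delta>(2) by (auto simp: T_def)
    moreover from z have "z - ?c \<noteq> 0" by simp
    ultimately have "F z * q z - F ?c * B i / (z - ?c) = ?Y z / (z - ?c) - ?Y ?c / (z - ?c)"
      using q rat_split[OF i, of 0 B z] by (simp add: add_divide_distrib distrib_left)
    thus "(m has_field_derivative F z * q z - F ?c * B i / (z - ?c)) (at z)" using bspec[OF m z] by (simp only:)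
  qed auto
  thus "has_bochner_integral lborel (wedge (d0 (\<lambda>t. cutoff (X i) \<delta> t * F t)) (fdt q)) (- 2 * pi * \<i> * (F (X i) * B i))"
    by (simp only: ext[OF cp(2)])
qed

text \<open>The product t H(1/t) q(t) equals K(1/t) with K = H * atinf B, and the coefficient of 1/t
  is K'(0), computed by the product rule. The sign is opposite to the finite case because the cutoff
  is 1 near infinity and 0 inside.\<close>

lemma residue_integral_infinity:
  assumes \<rho>: "\<rho> > 0" "\<And>i. i \<in> I \<Longrightarrow> cmod (X i) < \<rho>" and R: "R > \<rho>"
    and H: "H holomorphic_on ball 0 (1 / \<rho>)" and q: "\<And>t. t \<in> T \<Longrightarrow> q t = rat 0 B t"
  shows "has_bochner_integral lborel (wedge (d0 (\<lambda>t. (1 - cutoff 0 R t) * (t * H (1 / t)))) (fdt q))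
      (2 * pi * \<i> * (deriv H 0 * sum B I + H 0 * (\<Sum>i\<in>I. B i * X i)))"
    and "smooth_on UNIV (\<lambda>t. (1 - cutoff 0 R t) * (t * H (1 / t)))"
proof -
  let ?U = "{t. cmod t > \<rho>}" and ?h = "\<lambda>t. 1 - cutoff 0 R t" and ?F = "\<lambda>t. t * H (1 / t)"
  have oU: "open ?U" by (intro open_Collect_less continuous_intros)
  have F: "?F holomorphic_on ?U"
  proof -
    have "(\<lambda>t. 1 / t) holomorphic_on ?U" using inverse_in_ball(1)[OF \<rho>(1)] by (intro holomorphic_intros) auto
    moreover have "(\<lambda>t. 1 / t) ` ?U \<subseteq> ball 0 (1 / \<rho>)" using inverse_in_ball(2)[OF \<rho>(1)] by blast
    ultimately have "(H \<circ> (\<lambda>t. 1 / t)) holomorphic_on ?U" by (rule holomorphic_on_compose_gen[OF _ H])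
    thus ?thesis by (intro holomorphic_intros) (simp add: o_def)
  qed
  have S: "closed (- ball 0 R :: complex set)" "- ball 0 R \<subseteq> ?U" using R by auto
  have h: "smooth_on UNIV ?h" by (intro smooth_on_diff smooth_on_const smooth_on_cutoff open_UNIV)
  have h0: "\<forall>z\<in>- (- ball 0 R). ?h z = 0"
    using \<rho>(1) R cutoff_eq_1[of R _ 0] by simp
  note cp = cutoff_product[OF oU S h h0 F]
  show "smooth_on UNIV (\<lambda>t. ?h t * ?F t)" by (rule cp(1))
  let ?K = "\<lambda>u. H u * atinf B u"
  have aB: "atinf B holomorphic_on ball 0 (1 / \<rho>)" by (rule atinf_holomorphic[OF \<rho>(2)])
  have K: "?K holomorphic_on ball 0 (1 / \<rho>)" by (intro holomorphic_on_mult H aB)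
  have z0: "(0::complex) \<in> ball 0 (1 / \<rho>)" using \<rho>(1) by simp
  have "deriv ?K 0 = H 0 * deriv (atinf B) 0 + deriv H 0 * atinf B 0"
    by (intro DERIV_imp_deriv DERIV_mult' holomorphic_derivI[OF _ open_ball z0] H aB)
  hence dK: "deriv ?K 0 = deriv H 0 * sum B I + H 0 * (\<Sum>i\<in>I. B i * X i)"
    by (simp add: atinf_0 deriv_atinf_0)
  obtain m where m: "\<And>z. cmod z > \<rho> \<Longrightarrow> (m has_field_derivative ?K (1 / z) - deriv ?K 0 / z) (at z)"
    using primitive_of_inverse_argument[OF K \<rho>(1)] by blast
  have "has_bochner_integral lborel (\<lambda>z. wedge (d0 (cutoff 0 R)) (fdt (\<lambda>z. ?F z * q z)) z) (- 2 * pi * \<i> * deriv ?K 0)"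
  proof (rule has_integral_cutoff[OF _ oU, of R 0 m])
    show "R > 0" using \<rho>(1) R by simp
    show "{z. R \<le> cmod (z - 0) \<and> cmod (z - 0) \<le> 3/2 * R} \<subseteq> ?U" using R by auto
    fix z assume "z \<in> ?U"
    hence z: "cmod z > \<rho>" by simp
    have "z \<noteq> X i" if "i \<in> I" for i using \<rho>(2)[OF that] z by auto
    hence "z \<in> T" by (auto simp: T_def)
    moreover have "z \<noteq> 0" using inverse_in_ball(1)[OF \<rho>(1) z] .
    ultimately have "?F z * q z - deriv ?K 0 / (z - 0) = ?K (1 / z) - deriv ?K 0 / z"
      using q rat_atinf[of z 0 B] by simp
    thus "(m has_field_derivative ?F z * q z - deriv ?K 0 / (z - 0)) (at z)" using m[OF z] by (simp only:)
  qed
  from has_bochner_integral_minus[OF this]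
  have "has_bochner_integral lborel (\<lambda>z. - wedge (d0 (cutoff 0 R)) (fdt (\<lambda>z. ?F z * q z)) z)
     (2 * pi * \<i> * (deriv H 0 * sum B I + H 0 * (\<Sum>i\<in>I. B i * X i)))"
    unfolding dK by simp
  moreover have e: "wedge (d0 (\<lambda>t. ?h t * ?F t)) (fdt q) z = - wedge (d0 (cutoff 0 R)) (fdt (\<lambda>z. ?F z * q z)) z" for z
  proof -
    have "frechet_derivative ?h (at z) v = - frechet_derivative (cutoff 0 R) (at z) v" for v
      using frechet_derivative_diff[OF smooth_on_const[OF open_UNIV] smooth_on_cutoff[OF open_UNIV], of z 1 0 R v] by simp
    hence "wedge (d0 ?h) (fdt (\<lambda>z. ?F z * q z)) z = - wedge (d0 (cutoff 0 R)) (fdt (\<lambda>z. ?F z * q z)) z"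
      unfolding wedge_d0_fdt dx_def dy_def by (simp add: algebra_simps)
    thus ?thesis using cp(2)[of q z] by (simp only:)
  qed
  ultimately show "has_bochner_integral lborel (wedge (d0 (\<lambda>t. ?h t * ?F t)) (fdt q))
      (2 * pi * \<i> * (deriv H 0 * sum B I + H 0 * (\<Sum>i\<in>I. B i * X i)))"
    by (simp only: ext[OF e])
qed

text \<open>The first sum collects the finite residues; the subtracted bracket is the coefficient of
  1/t at infinity, where \<open>h0\<close> and the quotient by sum \<alpha> are H(0) and
  H'(0).\<close>

theorem intersection_number:
  assumes p: "\<And>t. t \<in> T \<Longrightarrow> p t = rat k A t" and q: "\<And>t. t \<in> T \<Longrightarrow> q t = rat 0 B t"
  defines "h0 \<equiv> k / (1 + sum \<alpha> I)"
  shows "Ic T \<omega> (coclass T \<omega> (fdt p)) (coclass T (\<lambda>z. - \<omega> z) (fdt q)) =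
    2 * pi * \<i> * ((\<Sum>i\<in>I. A i * B i / \<alpha> i)
      - ((sum A I - (\<Sum>i\<in>I. \<alpha> i * X i) * h0) / sum \<alpha> I * sum B I + h0 * (\<Sum>i\<in>I. B i * X i)))"
proof -
  obtain \<delta> where \<delta>: "\<delta> > 0" "\<And>i j. i \<in> I \<Longrightarrow> j \<in> I \<Longrightarrow> i \<noteq> j \<Longrightarrow> 4 * \<delta> \<le> dist (X i) (X j)"
    using separation by blast
  obtain \<rho> where \<rho>: "\<rho> > 0" "\<And>i. i \<in> I \<Longrightarrow> cmod (X i) < \<rho>" using outer_radius by blast
  \<comment> \<open>Large enough for the supports of the finite cutoffs to lie in the disc of radius
    R, where the outer term \<open>ginf\<close> vanishes.\<close>
  define R where "R = \<rho> + 4 * \<delta>"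
  have R: "R > \<rho>" "R > 0" using \<rho>(1) \<delta>(1) by (auto simp: R_def)
  have nb: "X j \<notin> ball (X i) (4 * \<delta>)" if "i \<in> I" "j \<in> I" "j \<noteq> i" for i j
    using \<delta>(2)[of i j] that by auto
  have "\<forall>i\<in>I. \<exists>F. F holomorphic_on ball (X i) (4 * \<delta>) \<and> \<alpha> i * F (X i) = A i \<and>
    (\<forall>t\<in>ball (X i) (4 * \<delta>) - {X i}. deriv F t + rat 0 \<alpha> t * F t = rat k A t)"
  proof
    fix i assume i: "i \<in> I"
    have d: "4 * \<delta> > 0" using \<delta>(1) by simp
    show "\<exists>F. F holomorphic_on ball (X i) (4 * \<delta>) \<and> \<alpha> i * F (X i) = A i \<and>
      (\<forall>t\<in>ball (X i) (4 * \<delta>) - {X i}. deriv F t + rat 0 \<alpha> t * F t = rat k A t)"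
      by (rule local_solution[OF i d nb[OF i]])
  qed
  from bchoice[OF this] obtain F where F0: "\<forall>i\<in>I. F i holomorphic_on ball (X i) (4 * \<delta>) \<and> \<alpha> i * F i (X i) = A i \<and>
    (\<forall>t\<in>ball (X i) (4 * \<delta>) - {X i}. deriv (F i) t + rat 0 \<alpha> t * F i t = rat k A t)" ..
  have F: "F i holomorphic_on ball (X i) (4 * \<delta>)" "\<alpha> i * F i (X i) = A i"
    "t \<in> ball (X i) (4 * \<delta>) - {X i} \<Longrightarrow> deriv (F i) t + rat 0 \<alpha> t * F i t = rat k A t" if "i \<in> I" for i t
    using bspec[OF F0 that] by simp_all
  obtain H where H: "H holomorphic_on ball 0 (1 / \<rho>)" "H 0 = h0"
    "deriv H 0 = (sum A I - (\<Sum>i\<in>I. \<alpha> i * X i) * H 0) / sum \<alpha> I"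
    "\<And>t. cmod t > \<rho> \<Longrightarrow> ((\<lambda>t. t * H (1 / t)) has_field_derivative
        rat k A t - rat 0 \<alpha> t * (t * H (1 / t))) (at t)"
    using solution_at_infinity[OF \<rho>, where A = A and k = k] unfolding h0_def by blast
  define g where "g i = (\<lambda>t. cutoff (X i) \<delta> t * F i t)" for i
  define ginf where "ginf = (\<lambda>t. (1 - cutoff 0 R t) * (t * H (1 / t)))"
  define G where "G = (\<lambda>t. (\<Sum>i\<in>I. g i t) + ginf t)"
  note inf = residue_integral_infinity[OF \<rho> R(1) H(1) q, folded ginf_def]
  have sg: "smooth_on UNIV (g i)" if "i \<in> I" for i
    unfolding g_def using that by (intro residue_integral_finite(2)[OF that \<delta>(1) nb F(1) q]) auto
  have sG: "smooth_on UNIV G"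
    unfolding G_def by (intro smooth_on_add smooth_on_sum open_UNIV sg inf(2))
  have sGT: "smooth_on T G" by (rule smooth_on_subset[OF sG]) simp
  have hp: "p holomorphic_on T" "q holomorphic_on T"
    using rat_holomorphic p q by (auto cong: holomorphic_cong)
  define \<eta> where "\<eta> = (\<lambda>z. fdt p z - nabla0 \<omega> G z)"
  note nab = nabla0_in_Z1[OF open_T rat_holomorphic sGT, of 0 \<alpha>]
  have \<eta>Z: "\<eta> \<in> Z1 T \<omega>" unfolding \<eta>_def by (intro diff_in_Z1 open_T fdt_in_Z1(1) hp nab)
  \<comment> \<open>By the triangle inequality t is at least 3 * \<delta> away from X j, outside the
    support of that cutoff.\<close>
  have cosum: "g j t = 0" if "i \<in> I" "j \<in> I" "j \<noteq> i" "t \<in> ball (X i) \<delta>" for i j t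
  proof -
    have "4 * \<delta> \<le> dist (X i) (X j)" using \<delta>(2)[of i j] that by auto
    hence "dist (X j) t \<ge> 3 * \<delta>" using that(4) dist_triangle[of "X i" "X j" t] by (simp add: dist_commute)
    thus ?thesis unfolding g_def using \<delta>(1) by (subst cutoff_eq_0) (auto simp: dist_norm norm_minus_commute)
  qed
  have near: "\<eta> t = 0" if i: "i \<in> I" and t: "t \<in> ball (X i) \<delta> - {X i}" for i t
  proof -
    have "nabla0 \<omega> G t = fdt p t"
    proof (rule nabla0_fdt_eq[of "ball (X i) \<delta> - {X i}" t G "F i"])
      show "open (ball (X i) \<delta> - {X i})" by auto
      fix z assume z: "z \<in> ball (X i) \<delta> - {X i}"
      have "cmod z \<le> R" using z \<rho>(2)[OF i] \<delta>(1) norm_triangle_ineq2[of z "X i"]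
        by (auto simp: R_def dist_norm norm_minus_commute)
      hence "ginf z = 0" using R(2) by (simp add: ginf_def cutoff_eq_1)
      moreover have "(\<Sum>j\<in>I - {i}. g j z) = 0" using cosum[OF i] z by (intro sum.neutral) auto
      moreover have "g i z = F i z" unfolding g_def
        using z \<delta>(1) by (subst cutoff_eq_1) (auto simp: dist_norm norm_minus_commute)
      ultimately show "G z = F i z" unfolding G_def using sum.remove[OF finite_I i, of "\<lambda>i. g i z"] by simp
    next
      have t4: "t \<in> ball (X i) (4 * \<delta>) - {X i}" using t \<delta>(1) by auto
      hence "t \<in> T" using nb[OF i] by (auto simp: T_def)
      moreover have "deriv (F i) t = rat k A t - rat 0 \<alpha> t * F i t" using F(3)[OF i t4] by (simp add: eq_diff_eq)
      ultimately show "(F i has_field_derivative p t - rat 0 \<alpha> t * F i t) (at t)"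
        using holomorphic_derivI[OF F(1)[OF i] open_ball, of t] t4 p by simp
    qed (use t in auto)
    thus ?thesis by (simp add: \<eta>_def)
  qed
  have far: "\<eta> t = 0" if t: "cmod t > 3/2 * R" for t
  proof -
    have "nabla0 \<omega> G t = fdt p t"
    proof (rule nabla0_fdt_eq[of "{z. cmod z > 3/2 * R}" t G "\<lambda>t. t * H (1 / t)"])
      show "open {z::complex. cmod z > 3/2 * R}" by (intro open_Collect_less continuous_intros)
      fix z assume z: "z \<in> {z. cmod z > 3/2 * R}"
      have "g i z = 0" if i: "i \<in> I" for i
      proof -
        have "cmod (z - X i) \<ge> 3/2 * \<delta>" using z \<rho>(2)[OF i] \<delta>(1) norm_triangle_ineq2[of z "X i"] \<rho>(1)
          by (auto simp: R_def)
        thus ?thesis unfolding g_def using \<delta>(1) by (simp add: cutoff_eq_0)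
      qed
      moreover have "ginf z = z * H (1 / z)" using z R(2) by (simp add: ginf_def cutoff_eq_0)
      ultimately show "G z = z * H (1 / z)" unfolding G_def by simp
    next
      have t\<rho>: "cmod t > \<rho>" using t R by simp
      have "t \<noteq> X i" if "i \<in> I" for i using \<rho>(2)[OF that] t\<rho> by auto
      hence "t \<in> T" by (auto simp: T_def)
      thus "((\<lambda>t. t * H (1 / t)) has_field_derivative p t - rat 0 \<alpha> t * (t * H (1 / t))) (at t)"
        using H(4)[OF t\<rho>] p by simp
    qed (use t in auto)
    thus ?thesis by (simp add: \<eta>_def)
  qed
  define L where "L = cball 0 (3/2 * R) - (\<Union>i\<in>I. ball (X i) \<delta>)"
  have "compact L" unfolding L_def by (intro compact_diff compact_cball open_UN) auto
  moreover have "L \<subseteq> T" using \<delta>(1) by (auto simp: L_def T_def)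
  moreover have "\<forall>t\<in>T - L. \<eta> t = 0"
  proof
    fix t assume t: "t \<in> T - L"
    then consider "cmod t > 3/2 * R" | i where "i \<in> I" "t \<in> ball (X i) \<delta> - {X i}"
      by (auto simp: L_def T_def)
    thus "\<eta> t = 0" using near far by cases auto
  qed
  ultimately have "compactly_supported T \<eta>" unfolding compactly_supported_def by blast
  hence \<eta>c: "\<eta> \<in> Z1c T \<omega>" using \<eta>Z by (auto simp: Z1c_def Z1_def E1c_def)
  have \<eta>cl: "(fdt p, \<eta>) \<in> cohom T \<omega>"
    using fdt_in_Z1(1)[OF open_T hp(1)] \<eta>Z sGT by (auto simp: cohom_def E0_def \<eta>_def)
  \<comment> \<open>Both p dt and G \<omega> are multiples of dt and die against q dt; only dG
    contributes, and it splits into the glued pieces.\<close>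
  have w: "wedge \<eta> (fdt q) z = - ((\<Sum>i\<in>I. wedge (d0 (g i)) (fdt q) z) + wedge (d0 ginf) (fdt q) z)" for z
  proof -
    have "frechet_derivative G (at z) v = (\<Sum>i\<in>I. frechet_derivative (g i) (at z) v) + frechet_derivative ginf (at z) v" for v
      unfolding G_def
      using frechet_derivative_add[OF smooth_on_sum[OF open_UNIV, of I g, OF sg] inf(2) UNIV_I]
        frechet_derivative_sum[of I UNIV g, OF sg UNIV_I] by simp
    hence "wedge (d0 G) (fdt q) z = (\<Sum>i\<in>I. wedge (d0 (g i)) (fdt q) z) + wedge (d0 ginf) (fdt q) z"
      unfolding wedge_d0_fdt dx_def dy_def by (simp add: sum_distrib_left sum.distrib distrib_left add_ac)
    thus ?thesis by (simp add: \<eta>_def nabla0_def wedge_def fmul_def fdt_def algebra_simps)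
  qed
  have "Ic T \<omega> (coclass T \<omega> (fdt p)) (coclass T (\<lambda>z. - \<omega> z) (fdt q)) = (LINT z:T|lborel. wedge \<eta> (fdt q) z)"
    by (intro Ic_eqI open_T smooth_on_fdt smooth_on_holomorphic rat_holomorphic cohom_imp_cohomc \<eta>c \<eta>cl fdt_in_Z1 hp)
  also have "\<dots> = (LINT z:T|lborel. - ((\<Sum>i\<in>I. wedge (d0 (g i)) (fdt q) z) + wedge (d0 ginf) (fdt q) z))"
    by (simp only: w)
  also have "\<dots> =
     - ((\<Sum>i\<in>I. - 2 * pi * \<i> * (F i (X i) * B i)) + 2 * pi * \<i> * (deriv H 0 * sum B I + H 0 * (\<Sum>i\<in>I. B i * X i)))"
    unfolding T_def
  proof (rule set_integral_cofinite(2))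
    show "finite (X ` I)" using finite_I by simp
    have "has_bochner_integral lborel (wedge (d0 (g i)) (fdt q)) (- 2 * pi * \<i> * (F i (X i) * B i))" if "i \<in> I" for i
      unfolding g_def using that by (intro residue_integral_finite(1)[OF that \<delta>(1) nb F(1) q]) auto
    thus "has_bochner_integral lborel (\<lambda>z. - ((\<Sum>i\<in>I. wedge (d0 (g i)) (fdt q) z) + wedge (d0 ginf) (fdt q) z))
      (- ((\<Sum>i\<in>I. - 2 * pi * \<i> * (F i (X i) * B i)) + 2 * pi * \<i> * (deriv H 0 * sum B I + H 0 * (\<Sum>i\<in>I. B i * X i))))"
      by (intro has_bochner_integral_minus has_bochner_integral_add has_bochner_integral_sum inf(1))
  qed
  also have "(\<Sum>i\<in>I. - 2 * pi * \<i> * (F i (X i) * B i)) = - 2 * pi * \<i> * (\<Sum>i\<in>I. A i * B i / \<alpha> i)"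
    unfolding sum_distrib_left
  proof (rule sum.cong[OF refl])
    fix i assume i: "i \<in> I"
    have "\<alpha> i \<noteq> 0" using \<alpha>_nonint[OF i] by auto
    hence "F i (X i) = A i / \<alpha> i" using F(2)[OF i] by (simp add: field_simps)
    thus "- 2 * pi * \<i> * (F i (X i) * B i) = - 2 * pi * \<i> * (A i * B i / \<alpha> i)" by simp
  qed
  finally show ?thesis unfolding H(2,3) by (simp add: algebra_simps)
qed

end

section \<open>Specialization to the given exponents and forms\<close>

lemma phi_eq_rat:
  assumes "punctured_plane {0..m+1} (pt m x) \<alpha>" "i \<le> m"
  shows "phi m x i = fdt (punctured_plane.rat {0..m+1} (pt m x) 0 (\<lambda>l. of_bool (l = m + 1) - of_bool (i \<noteq> 0 \<and> l = i)))"
proof -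
  interpret punctured_plane "{0..m+1}" "pt m x" \<alpha> by (rule assms(1))
  have "rat 0 (\<lambda>l. of_bool (l = m + 1) - of_bool (i \<noteq> 0 \<and> l = i)) t =
      1 / (t - 1) - (if i = 0 then 0 else 1 / (t - pt m x i))" for t
  proof -
    have "rat 0 (\<lambda>l. of_bool (l = m + 1) - of_bool (i \<noteq> 0 \<and> l = i)) t =
      (\<Sum>l\<in>{0..m+1}. (if l = m + 1 then 1 / (t - pt m x l) else 0) - (if l = i then (if i = 0 then 0 else 1 / (t - pt m x l)) else 0))"
      unfolding rat_def add_0_left by (intro sum.cong refl) auto
    also have "\<dots> = 1 / (t - pt m x (m + 1)) - (if i = 0 then 0 else 1 / (t - pt m x i))"
      using assms(2) by (simp add: sum_subtractf sum.delta del: sum.cl_ivl_Suc sum.atLeast0_atMost_Suc)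
    finally show ?thesis by (simp add: pt_def)
  qed
  thus ?thesis by (auto simp: phi_def fdt_def fun_eq_iff)
qed

lemma sum_indicator_diff:
  fixes f :: "nat \<Rightarrow> complex"
  assumes "i \<le> m"
  shows "(\<Sum>l\<in>{0..m+1}. (of_bool (l = m + 1) - of_bool (i \<noteq> 0 \<and> l = i)) * f l) = f (m + 1) - (if i = 0 then 0 else f i)"
proof -
  have "(\<Sum>l\<in>{0..m+1}. (of_bool (l = m + 1) - of_bool (i \<noteq> 0 \<and> l = i)) * f l) =
    (\<Sum>l\<in>{0..m+1}. (if l = m + 1 then f l else 0) - (if l = i then (if i = 0 then 0 else f l) else 0))"
    by (intro sum.cong refl) auto
  also have "\<dots> = f (m + 1) - (if i = 0 then 0 else f i)"
    using assms by (simp add: sum_subtractf sum.delta del: sum.cl_ivl_Suc sum.atLeast0_atMost_Suc)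
  finally show ?thesis .
qed

text \<open>All exponents including the one at infinity add up to zero, which identifies
  \<alpha>_{m+2} = a as the exponent at infinity.\<close>

lemma sum_alpha: "(\<Sum>i\<in>{0..m+1}. alpha m a b c i) = - a"
proof -
  have "(\<Sum>i\<in>{0..m+1}. alpha m a b c i) = alpha m a b c 0 + (\<Sum>i\<in>{1..m}. alpha m a b c i) + alpha m a b c (m + 1)"
    by (simp add: sum.atLeast_Suc_atMost)
  also have "(\<Sum>i\<in>{1..m}. alpha m a b c i) = - (\<Sum>i\<in>{1..m}. b i)"
    unfolding sum_negf[symmetric] by (intro sum.cong) (auto simp: alpha_def)
  finally show ?thesis by (simp add: alpha_def)
qed

text \<open>The all-ones matrix has rank one, so scaling its rows and columns gives an outer
  product; the middle terms of the formula are read entrywise from this.\<close>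

lemma mat_diag_Nmat_mat_diag:
  "mat_diag (m+1) f * Nmat m * mat_diag (m+1) g = Matrix.mat (m+1) (m+1) (\<lambda>(i, j). f i * g j)"
proof -
  have N: "Nmat m \<in> carrier_mat (m+1) (m+1)" by (simp add: Nmat_def)
  show ?thesis
    unfolding mat_diag_mult_left[OF N] by (subst mat_diag_mult_right) (auto simp: Nmat_def)
qed

theorem proposition5:
  fixes m k :: nat and a c :: complex and b x :: "nat \<Rightarrow> complex"
  defines "\<alpha> \<equiv> alpha m a b c" and "X \<equiv> pt m x"
  assumes "m \<ge> 1"
    and "\<And>i. i \<le> m + 2 \<Longrightarrow> \<alpha> i \<notin> \<int>"
    and "inj_on X {0..m+1}"
    and "k \<le> m + 1"
  shows "Qmat m a b c x k =
    (2 * complex_of_real pi * \<i>) \<cdot>\<^sub>m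
     ( ((1 - X k) / \<alpha> (m+1)) \<cdot>\<^sub>m Nmat m
     + (1 / \<alpha> (m+2)) \<cdot>\<^sub>m
         (mat_diag (m+1) (\<lambda>i. if i = 0 then 0 else 1 - X i) * Nmat m
            * mat_diag (m+1) (\<lambda>i. if i = 0 then 1 else 0))
     - (1 / (1 - \<alpha> (m+2))) \<cdot>\<^sub>m
         (mat_diag (m+1) (\<lambda>i. if i = 0 then 1 else 0) * Nmat m
            * mat_diag (m+1) (\<lambda>i. if i = 0 then 0 else 1 - X i))
     + mat_diag (m+1) (\<lambda>i. if i = 0
         then (1 - X k) / \<alpha> (m+2)
              - 1 / (1 - \<alpha> (m+2)) * ((\<Sum>p=1..m+1. \<alpha> p * X p) / \<alpha> (m+2) + 1)
         else (X i - X k) / \<alpha> i))" (is "_ = ?R")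
proof -
  have a: "\<alpha> (m + 2) = a" by (simp add: \<alpha>_def alpha_def)
  have aZ: "a \<notin> \<int>" using assms(4)[of "m + 2"] a by simp
  have s\<alpha>: "sum \<alpha> {0..m+1} = - a" unfolding \<alpha>_def by (rule sum_alpha)
  have pp: "punctured_plane {0..m+1} X \<alpha>"
  proof
    show "sum \<alpha> {0..m+1} \<notin> \<int>" unfolding s\<alpha> using aZ by simp
  qed (use assms(4,5) in auto)
  interpret punctured_plane "{0..m+1}" X \<alpha> by (rule pp)
  \<comment> \<open>The residue of phi_i at the l-th point. The guard i \<noteq> 0 is there because
    phi_0 has no pole at x_0 = 0.\<close>
  define C :: "nat \<Rightarrow> nat \<Rightarrow> complex" where "C i l = of_bool (l = m + 1) - of_bool (i \<noteq> 0 \<and> l = i)" for i l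
  define s1 where "s1 = (\<Sum>p=1..m+1. \<alpha> p * X p)"
  have X: "X 0 = 0" "X (m + 1) = 1" by (auto simp: X_def pt_def)
  \<comment> \<open>The sum in the statement starts at p = 1; the term of index 0 vanishes as X 0 =
    0.\<close>
  have s1: "(\<Sum>l\<in>{0..m+1}. \<alpha> l * X l) = s1"
    unfolding s1_def using X(1) by (simp add: sum.atLeast_Suc_atMost)
  have \<omega>: "omega m a b c x = \<omega>" 
    unfolding omega_def rat_def[abs_def] add_0_left unfolding \<alpha>_def X_def ..
  have T: "Tx m x = T" unfolding Tx_def T_def unfolding X_def ..
  have Csum: "(\<Sum>l\<in>{0..m+1}. C i l * f l) = f (m + 1) - (if i = 0 then 0 else f i)" if "i \<le> m" for i f
    unfolding C_def by (rule sum_indicator_diff[OF that])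
  \<comment> \<open>This is the constant term created by multiplication with t - x_k; it singles out
    the first row of the matrix.\<close>
  have Csum1: "sum (C i) {0..m+1} = of_bool (i = 0)" if "i \<le> m" for i
    using Csum[OF that, of "\<lambda>_. 1"] by (simp del: sum.cl_ivl_Suc sum.atLeast0_atMost_Suc)
  have phi: "phi m x i = fdt (rat 0 (C i))" if "i \<le> m" for i
    unfolding C_def[abs_def] using phi_eq_rat[OF pp[unfolded X_def] that] by (simp add: X_def)
  have entry: "Ic (Tx m x) (omega m a b c x) (coclass (Tx m x) (omega m a b c x) (fmul (\<lambda>t. t - pt m x k) (phi m x i)))
      (coclass (Tx m x) (\<lambda>z. - omega m a b c x z) (phi m x j)) =
    2 * pi * \<i> * ((1 - X k) / \<alpha> (m + 1) + (if i = j \<and> i \<noteq> 0 then (X i - X k) / \<alpha> i else 0)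
      + ((1 - X k) - (if i = 0 then 0 else X i - X k) - s1 * (of_bool (i = 0) / (1 - a))) / a * of_bool (j = 0)
      - of_bool (i = 0) / (1 - a) * (1 - (if j = 0 then 0 else X j)))" if i: "i \<le> m" and j: "j \<le> m" for i j
  proof -
    let ?A = "\<lambda>l. C i l * (X l - X k)" and ?p = "\<lambda>t. (t - X k) * rat 0 (C i) t"
    \<comment> \<open>Termwise (t - x_k)/(t - x_l) = 1 + (x_l - x_k)/(t - x_l).\<close>
    have p: "?p t = rat (sum (C i) {0..m+1}) ?A t" if t: "t \<in> T" for t
    proof -
      have "?p t = (\<Sum>l\<in>{0..m+1}. (t - X k) * (C i l / (t - X l)))"
        unfolding rat_def add_0_left sum_distrib_left ..
      also have "\<dots> = (\<Sum>l\<in>{0..m+1}. C i l + C i l * (X l - X k) / (t - X l))"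
      proof (rule sum.cong[OF refl])
        fix l assume "l \<in> {0..m+1}"
        hence "t - X l \<noteq> 0" using t unfolding T_def by auto
        thus "(t - X k) * (C i l / (t - X l)) = C i l + C i l * (X l - X k) / (t - X l)" by (simp add: field_simps)
      qed
      also have "\<dots> = rat (sum (C i) {0..m+1}) ?A t" by (simp only: sum.distrib rat_def)
      finally show ?thesis .
    qed
    have fm: "fmul (\<lambda>t. t - pt m x k) (phi m x i) = fdt ?p"
      unfolding phi[OF i] by (simp add: fmul_def fdt_def X_def fun_eq_iff)
    have res: "(\<Sum>l\<in>{0..m+1}. ?A l * C j l / \<alpha> l) =
        (1 - X k) / \<alpha> (m + 1) + (if i = j \<and> i \<noteq> 0 then (X i - X k) / \<alpha> i else 0)"
    proof -
      have Cj: "C j (m + 1) = 1" "i \<noteq> 0 \<Longrightarrow> C j i = - of_bool (i = j)" using i j by (auto simp: C_def)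
      have "(\<Sum>l\<in>{0..m+1}. ?A l * C j l / \<alpha> l) = (\<Sum>l\<in>{0..m+1}. C i l * ((X l - X k) * C j l / \<alpha> l))"
        by (simp only: mult.assoc times_divide_eq_right)
      also have "\<dots> = (1 - X k) / \<alpha> (m + 1) - (if i = 0 then 0 else (X i - X k) * C j i / \<alpha> i)"
        unfolding Csum[OF i] Cj(1) X(2) by simp
      also have "\<dots> = (1 - X k) / \<alpha> (m + 1) + (if i = j \<and> i \<noteq> 0 then (X i - X k) / \<alpha> i else 0)"
      proof -
        have "p - u * - of_bool P / v = p + (if P then u / v else 0)" for p u v :: complex and P by simp
        thus ?thesis using Cj(2) by (cases "i = 0") (simp_all only: if_True if_False simp_thms diff_0_right add_0_right)
      qed
      finally show ?thesis .
    qed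
    have sA: "sum ?A {0..m+1} = (1 - X k) - (if i = 0 then 0 else X i - X k)"
      unfolding Csum[OF i] X(2) ..
    have sB: "(\<Sum>l\<in>{0..m+1}. C j l * X l) = 1 - (if j = 0 then 0 else X j)"
      unfolding Csum[OF j] X(2) ..
    have alg: "2 * pi * \<i> * (r - ((u - v * (w / (1 + - a))) / (- a) * y + w / (1 + - a) * z)) =
        2 * pi * \<i> * (r + (u - v * (w / (1 - a))) / a * y - w / (1 - a) * z)" for r u v w y z :: complex
      by simp
    show ?thesis
      unfolding fm phi[OF j] \<omega> T
      by (simp only: intersection_number[OF p refl] res sA sB Csum1[OF i] Csum1[OF j] s\<alpha> s1 alg)
  qed
  show ?thesis
  proof (rule eq_matI)
    fix i j assume "i < dim_row ?R" "j < dim_col ?R"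
    hence i: "i < m + 1" and j: "j < m + 1" by (auto simp: mat_diag_def)
    have "Qmat m a b c x k $$ (i, j) = 2 * pi * \<i> * ((1 - X k) / \<alpha> (m + 1) + (if i = j \<and> i \<noteq> 0 then (X i - X k) / \<alpha> i else 0)
      + ((1 - X k) - (if i = 0 then 0 else X i - X k) - s1 * (of_bool (i = 0) / (1 - a))) / a * of_bool (j = 0)
      - of_bool (i = 0) / (1 - a) * (1 - (if j = 0 then 0 else X j)))"
      using i j by (subst entry[symmetric]) (simp_all add: Qmat_def Let_def)
    also have "\<dots> = ?R $$ (i, j)"
    proof -
      have "?R $$ (i, j) = 2 * pi * \<i> * ((1 - X k) / \<alpha> (m + 1)
          + 1 / a * ((if i = 0 then 0 else 1 - X i) * (if j = 0 then 1 else 0))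
          - 1 / (1 - a) * ((if i = 0 then 1 else 0) * (if j = 0 then 0 else 1 - X j))
          + (if i = j then if i = 0 then (1 - X k) / a - 1 / (1 - a) * (s1 / a + 1) else (X i - X k) / \<alpha> i else 0))"
        unfolding mat_diag_Nmat_mat_diag a s1_def[symmetric] using i j by (auto simp: mat_diag_def Nmat_def)
      \<comment> \<open>The corner entry i = j = 0, the only one in which both Taylor coefficients
        at infinity contribute; in the first column below it, (1 - X k) - (X i - X k) collapses to 1
        - X i.\<close>
      moreover have "(1 - X k - s1 * (1 / (1 - a))) / a - 1 / (1 - a) = (1 - X k) / a - 1 / (1 - a) * (s1 / a + 1)"
        by (simp add: diff_divide_distrib add_divide_distrib mult.commute)
      ultimately show ?thesis by (cases "i = 0"; cases "j = 0") auto
    qed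
    finally show "Qmat m a b c x k $$ (i, j) = ?R $$ (i, j)" .
  qed (auto simp: Qmat_def Let_def mat_diag_def)
qed

end
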